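(* Let $n\ge3$, $2\le k\le n-1$ and $0<\sigma<1$. There exists a constant $C=C(n,k,\sigma)>0$ with the following property. Let $\Omega\subset\mathbb{R}^n$ be a bounded smooth domain, let $\varepsilon>0$, and let $u\in C^4(\Omega)\cap C^2(\overline\Omega)$, $u>0$, be an admissible solution of the Dirichlet problem $$H_k(\kappa[u])=\sigma\ \text{ in }\Omega,\qquad u=\varepsilon\ \text{ on }\partial\Omega,$$ satisfying $$\vartheta:=\frac{1}{\sqrt{1+|Du|^2}}\ge\sigma .$$ Let $\Sigma$ be the vertical graph of $u$. Then $$\max_{\Sigma}|\kappa[u]|\le C\Big(1+\max_{\partial\Sigma}|\kappa[u]|\Big).$$ In particular, $C$ is independent of $\varepsilon$.
   Context: $\mathbb{H}^{n+1}$ is hyperbolic space in the upper half-space model $\{(x,x_{n+1})\in\mathbb{R}^{n+1}:x_{n+1}>0\}$ with metric $\bar g=x_{n+1}^{-2}\sum_{i=1}^{n+1}dx_i^2$. The vertical graph of a positive function $u$ is $\Sigma=\{(x,u(x))\}\subset\mathbb{H}^{n+1}$; here it is regarded as a hypersurface with boundary, with $x$ ranging over $\overline\Omega$ and $\partial\Sigma=\{(x,u(x)):x\in\partial\Omega\}$. Principal curvatures. For a positive $C^2$ function $u$ with graph $\Sigma$, let $w=\sqrt{1+|Du|^2}$ and let $\nu=(-Du,1)/w$ be the Euclidean upward unit normal; the hyperbolic unit normal is $\mathbf{n}=u\nu$. The vector $\kappa[u]=\kappa[\Sigma]=(\kappa_1,\dots,\kappa_n)$ consists of the hyperbolic principal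 curvatures of $\Sigma$ with respect to $\mathbf{n}$. Equivalently, $\kappa_i=u\tilde\kappa_i+\frac1w$, where $\tilde\kappa_i$ are the Euclidean principal curvatures with respect to $\nu$; that is, $\kappa_1,\dots,\kappa_n$ are the eigenvalues of the matrix $$\frac1w\Big(\delta_{ij}+u\sum_{k,l}\gamma^{ik}u_{x_kx_l}\gamma^{lj}\Big),\qquad \gamma^{ij}=\delta_{ij}-\frac{u_{x_i}u_{x_j}}{w(1+w)} .$$ $|\kappa[u]|$ denotes the Euclidean norm of this vector. Symmetric functions. For $\lambda\in\mathbb{R}^n$, $\sigma_j(\lambda)=\sum_{1\le i_1<\cdots<i_j\le n}\lambda_{i_1}\cdots\lambda_{i_j}$ is the $j$-th elementary symmetric polynomial (not to be confused with the constant $\sigma$), and $H_k(\lambda)=\binom{n}{k}^{-1}\sigma_k(\lambda)$. The Gårding cone is $\Gamma_k=\{\lambda\in\mathbb{R}^n:\sigma_j(\lambda)>0\text{ for all }1\le j\le k\}$. A function $u\in C^2(\Omega)$ is admissible if $\kappa[u]\in\Gamma_k$ at every point of $\Omega$. *)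

theory Defs
  imports "HOL-Analysis.Analysis"
begin

section \<open>Function spaces and smooth domains\<close>

definition pd :: "'n::finite \<Rightarrow> (real^'n \<Rightarrow> real) \<Rightarrow> real^'n \<Rightarrow> real" where
  "pd i f x = frechet_derivative f (at x) (axis i 1)"

text \<open>Intended for open \<open>S\<close>, where this is the usual class \<open>C\<^sup>m(S)\<close>.\<close>

primrec Ck :: "nat \<Rightarrow> (real^'n::finite) set \<Rightarrow> (real^'n \<Rightarrow> real) \<Rightarrow> bool" where
  "Ck 0 S f \<longleftrightarrow> continuous_on S f"
| "Ck (Suc m) S f \<longleftrightarrow> (\<forall>x\<in>S. f differentiable (at x)) \<and> (\<forall>i. Ck m S (pd i f))"

text \<open>Continuous extension of a function from an open set \<open>S\<close> to its closure (meaningful where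
  the limit exists).\<close>

definition ext_cl :: "(real^'n::finite) set \<Rightarrow> (real^'n \<Rightarrow> real) \<Rightarrow> real^'n \<Rightarrow> real" where
  "ext_cl S f x = (if x \<in> S then f x else Lim (at x within S) f)"

text \<open>\<open>C\<^sup>2\<close> up to the boundary: \<open>f\<close> is \<open>C\<^sup>2\<close> in the open set \<open>S\<close>, and \<open>f\<close> and its partial
  derivatives of order at most two extend continuously to the closure, the values of \<open>f\<close> on the
  frontier being those of the extension.\<close>

definition C2_closure :: "(real^'n::finite) set \<Rightarrow> (real^'n \<Rightarrow> real) \<Rightarrow> bool" where
  "C2_closure S f \<longleftrightarrow> Ck 2 S f \<and> continuous_on (closure S) f \<and>
     (\<forall>i. continuous_on (closure S) (ext_cl S (pd i f))) \<and>
     (\<forall>i j. continuous_on (closure S) (ext_cl S (pd i (pd j f))))"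

definition grad_cl :: "(real^'n::finite) set \<Rightarrow> (real^'n \<Rightarrow> real) \<Rightarrow> real^'n \<Rightarrow> real^'n" where
  "grad_cl S f x = (\<chi> i. ext_cl S (pd i f) x)"

definition hess_cl :: "(real^'n::finite) set \<Rightarrow> (real^'n \<Rightarrow> real) \<Rightarrow> real^'n \<Rightarrow> real^'n^'n" where
  "hess_cl S f x = (\<chi> i j. ext_cl S (pd i (pd j f)) x)"

definition bounded_smooth_domain :: "(real^'n::finite) set \<Rightarrow> bool" where
  "bounded_smooth_domain S \<longleftrightarrow> open S \<and> connected S \<and> S \<noteq> {} \<and> bounded S \<and>
     (\<forall>p\<in>frontier S. \<exists>U \<rho>. open U \<and> p \<in> U \<and> (\<forall>m. Ck m U \<rho>) \<and>
        (\<forall>x\<in>U. \<exists>i. pd i \<rho> x \<noteq> 0) \<and> S \<inter> U = {x \<in> U. \<rho> x < 0})"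


section \<open>Hyperbolic space (upper half-space model)\<close>

text \<open>Points are pairs \<open>(x, x\<^sub>n\<^sub>+\<^sub>1)\<close> with positive second component.  By the Koszul formula for
  constant vector fields, \<open>hyp_chris p X Y Z\<close> is the hyperbolic inner product at \<open>p\<close> of \<open>Z\<close> with the
  Levi-Civita derivative of \<open>Y\<close> in the direction \<open>X\<close>.\<close>

definition hyp_metric ::
  "(real^'n::finite) \<times> real \<Rightarrow> (real^'n) \<times> real \<Rightarrow> (real^'n) \<times> real \<Rightarrow> real" where
  "hyp_metric p X Y = (X \<bullet> Y) / (snd p)\<^sup>2"

definition hyp_chris ::
  "(real^'n::finite) \<times> real \<Rightarrow> (real^'n) \<times> real \<Rightarrow> (real^'n) \<times> real \<Rightarrow> (real^'n) \<times> real \<Rightarrow> real" where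
  "hyp_chris p X Y Z =
     (deriv (\<lambda>t. hyp_metric (p + t *\<^sub>R X) Y Z) 0
      + deriv (\<lambda>t. hyp_metric (p + t *\<^sub>R Y) X Z) 0
      - deriv (\<lambda>t. hyp_metric (p + t *\<^sub>R Z) X Y) 0) / 2"


section \<open>Curvature of vertical graphs\<close>

text \<open>Pointwise data of the graph of \<open>u\<close> at \<open>p = (x, u x)\<close>, as functions of the gradient
  \<open>q\<close> and the Hessian \<open>r\<close> of \<open>u\<close> at \<open>x\<close>.\<close>

definition slope_w :: "real^'n::finite \<Rightarrow> real" where
  "slope_w q = sqrt (1 + (norm q)\<^sup>2)"

definition graph_tangent :: "real^'n::finite \<Rightarrow> 'n \<Rightarrow> (real^'n) \<times> real" where
  "graph_tangent q i = (axis i 1, q $ i)"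

definition hyp_normal :: "(real^'n::finite) \<times> real \<Rightarrow> real^'n \<Rightarrow> (real^'n) \<times> real" where
  "hyp_normal p q = snd p *\<^sub>R ((1 / slope_w q) *\<^sub>R (- q, 1))"

definition first_form :: "(real^'n::finite) \<times> real \<Rightarrow> real^'n \<Rightarrow> real^'n^'n" where
  "first_form p q = (\<chi> i j. hyp_metric p (graph_tangent q i) (graph_tangent q j))"

text \<open>\<open>(0, r $ i $ j)\<close> is the flat derivative of the \<open>j\<close>-th tangent field along the \<open>i\<close>-th one.\<close>

definition second_form :: "(real^'n::finite) \<times> real \<Rightarrow> real^'n \<Rightarrow> real^'n^'n \<Rightarrow> real^'n^'n" where
  "second_form p q r = (\<chi> i j.
     hyp_metric p (0, r $ i $ j) (hyp_normal p q)
     + hyp_chris p (graph_tangent q i) (graph_tangent q j) (hyp_normal p q))"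

definition shape_op :: "(real^'n::finite) \<times> real \<Rightarrow> real^'n \<Rightarrow> real^'n^'n \<Rightarrow> real^'n^'n" where
  "shape_op p q r = matrix_inv (first_form p q) ** second_form p q r"

text \<open>The eigenvalues with multiplicity, in some order; everything below is symmetric in them.
  Existence for symmetric matrices is lemma \<open>eigvals_symmetric\<close>, and
  \<open>eigvals_shape_op\<close> reduces the shape operator to that case.\<close>

definition eigvals :: "real^'n^'n::finite \<Rightarrow> real^'n" where
  "eigvals A = (SOME l. \<forall>t. det (mat t - A) = (\<Prod>i\<in>UNIV. t - l $ i))"

text \<open>Hyperbolic principal curvatures of the graph of \<open>u\<close> over the closure of \<open>S\<close>; on the
  frontier the derivatives of \<open>u\<close> are the continuous extensions from \<open>S\<close>.\<close>

definition kappa :: "(real^'n::finite) set \<Rightarrow> (real^'n \<Rightarrow> real) \<Rightarrow> real^'n \<Rightarrow> real^'n" where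
  "kappa S u x = eigvals (shape_op (x, u x) (grad_cl S u x) (hess_cl S u x))"

definition vgraph :: "(real^'n \<Rightarrow> real) \<Rightarrow> (real^'n::finite) set \<Rightarrow> ((real^'n) \<times> real) set" where
  "vgraph u S = (\<lambda>x. (x, u x)) ` S"


section \<open>Symmetric functions and admissibility\<close>

definition esym :: "nat \<Rightarrow> real^'n::finite \<Rightarrow> real" where
  "esym j l = (\<Sum>I | card I = j. \<Prod>i\<in>I. l $ i)"

definition Hk :: "nat \<Rightarrow> real^'n::finite \<Rightarrow> real" where
  "Hk k l = esym k l / real (CARD('n) choose k)"

definition Garding_cone :: "nat \<Rightarrow> (real^'n::finite) set" where
  "Garding_cone k = {l. \<forall>j\<in>{1..k}. esym j l > 0}"

definition admissible :: "nat \<Rightarrow> (real^'n::finite) set \<Rightarrow> (real^'n \<Rightarrow> real) \<Rightarrow> bool" where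
  "admissible k S u \<longleftrightarrow> Ck 2 S u \<and> (\<forall>x\<in>S. kappa S u x \<in> Garding_cone k)"

definition is_max_on :: "('a \<Rightarrow> real) \<Rightarrow> 'a set \<Rightarrow> real \<Rightarrow> bool" where
  "is_max_on f A M \<longleftrightarrow> (\<exists>a\<in>A. f a = M) \<and> (\<forall>a\<in>A. f a \<le> M)"


section \<open>Agreement with the explicit curvature matrix\<close>

definition gamma_mat :: "real^'n::finite \<Rightarrow> real^'n^'n" where
  "gamma_mat q = (\<chi> i j. (if i = j then 1 else 0) - q $ i * q $ j / (slope_w q * (1 + slope_w q)))"

definition curv_mat :: "real \<Rightarrow> real^'n::finite \<Rightarrow> real^'n^'n \<Rightarrow> real^'n^'n" where
  "curv_mat z q r = (\<chi> i j. 1 / slope_w q * ((if i = j then 1 else 0)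
     + z * (\<Sum>k\<in>UNIV. \<Sum>l\<in>UNIV. gamma_mat q $ i $ k * r $ k $ l * gamma_mat q $ l $ j)))"

lemma slope_w_ge_1: "slope_w q \<ge> 1"
  by (simp add: slope_w_def)

lemma slope_w_sq: "(slope_w q)\<^sup>2 = 1 + (norm q)\<^sup>2"
  by (simp add: slope_w_def)

lemma deriv_hyp_metric:
  assumes "snd p > 0"
  shows "deriv (\<lambda>t. hyp_metric (p + t *\<^sub>R X) Y Z) 0 = - 2 * snd X * (Y \<bullet> Z) / (snd p) ^ 3"
proof (rule DERIV_imp_deriv)
  show "((\<lambda>t. hyp_metric (p + t *\<^sub>R X) Y Z) has_field_derivative
      - 2 * snd X * (Y \<bullet> Z) / (snd p) ^ 3) (at 0)"
    unfolding hyp_metric_def snd_add snd_scaleR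
    by (rule derivative_eq_intros refl | use assms in \<open>simp add: field_simps power2_eq_square power3_eq_cube\<close>)+
qed

lemma hyp_chris_eq:
  assumes "snd p > 0"
  shows "hyp_chris p X Y Z =
    (snd Z * (X \<bullet> Y) - snd X * (Y \<bullet> Z) - snd Y * (X \<bullet> Z)) / (snd p) ^ 3"
  unfolding hyp_chris_def deriv_hyp_metric[OF assms] using assms by (simp add: field_simps)

lemma tangent_inner:
  "graph_tangent q i \<bullet> graph_tangent q j = (if i = j then 1 else 0) + q $ i * q $ j"
  by (simp add: graph_tangent_def inner_Pair inner_axis_axis)

lemma tangent_normal: "graph_tangent q i \<bullet> hyp_normal p q = 0"
  by (simp add: graph_tangent_def hyp_normal_def inner_Pair inner_axis')

lemma first_form_eq:
  "first_form p q $ i $ j = ((if i = j then 1 else 0) + q $ i * q $ j) / (snd p)\<^sup>2"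
  by (simp add: first_form_def hyp_metric_def tangent_inner)

lemma second_form_eq:
  assumes "snd p > 0"
  shows "second_form p q r $ i $ j = r $ i $ j / (snd p * slope_w q)
    + ((if i = j then 1 else 0) + q $ i * q $ j) / ((snd p)\<^sup>2 * slope_w q)"
proof -
  have "snd (hyp_normal p q) = snd p / slope_w q" by (simp add: hyp_normal_def)
  moreover have "slope_w q > 0" using slope_w_ge_1[of q] by linarith
  moreover have "hyp_metric p (0, r $ i $ j) (hyp_normal p q) = r $ i $ j / (snd p * slope_w q)"
    using assms by (simp add: hyp_metric_def hyp_normal_def inner_Pair power2_eq_square)
  ultimately show ?thesis
    using assms
    by (simp add: second_form_def hyp_chris_eq[OF assms] tangent_normal tangent_inner
        power2_eq_square power3_eq_cube)
qed

definition rank1 :: "real \<Rightarrow> real^'n::finite \<Rightarrow> real^'n^'n" where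
  "rank1 a q = (\<chi> i j. (if i = j then 1 else 0) + a * (q $ i * q $ j))"

lemma rank1_mult: "rank1 a q ** rank1 b q = rank1 (a + b + a * b * (norm q)\<^sup>2) q"
proof -
  have n: "(norm q)\<^sup>2 = (\<Sum>k\<in>UNIV. q $ k * q $ k)"
    by (simp add: power2_norm_eq_inner inner_vec_def)
  have "(rank1 a q ** rank1 b q) $ i $ j = rank1 (a + b + a * b * (norm q)\<^sup>2) q $ i $ j" for i j
  proof -
    have "(rank1 a q ** rank1 b q) $ i $ j =
      (\<Sum>k\<in>UNIV. (if i = k then (if k = j then 1 else 0) else 0) + (if i = k then b * (q $ k * q $ j) else 0)
        + (if k = j then a * (q $ i * q $ k) else 0) + a * b * q $ i * q $ j * (q $ k * q $ k))"
      unfolding matrix_matrix_mult_def rank1_def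
      by (simp, rule sum.cong) (auto simp: algebra_simps)
    also have "\<dots> = (if i = j then 1 else 0) + b * (q $ i * q $ j) + a * (q $ i * q $ j)
        + a * b * q $ i * q $ j * (norm q)\<^sup>2"
      unfolding n by (simp add: sum.distrib sum_distrib_left)
    finally show ?thesis by (simp add: rank1_def algebra_simps)
  qed
  then show ?thesis by (simp add: vec_eq_iff)
qed

lemma rank1_0: "rank1 0 q = mat 1"
  by (simp add: rank1_def mat_def)

lemma gamma_rank1: "gamma_mat q = rank1 (- 1 / (slope_w q * (1 + slope_w q))) q"
  by (simp add: gamma_mat_def rank1_def vec_eq_iff)

lemma gamma_gamma_metric: "gamma_mat q ** gamma_mat q ** rank1 1 q = mat 1"
proof -
  define w where "w = slope_w q"
  have w: "w \<ge> 1" "(norm q)\<^sup>2 = w\<^sup>2 - 1"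
    using slope_w_ge_1[of q] slope_w_sq[of q] by (auto simp: w_def)
  define c where "c = - 1 / (w * (1 + w))"
  define d where "d = c + c + c * c * (norm q)\<^sup>2"
  have "w \<noteq> 0" "1 + w \<noteq> 0" using w(1) by auto
  then have c: "c * w * (1 + w) = - 1" by (simp add: c_def mult.assoc)
  have "d * w\<^sup>2 = - 1"
  proof -
    have "d * (w\<^sup>2 * (1 + w)\<^sup>2) = 2 * (c * w * (1 + w)) * (w * (1 + w)) + (c * w * (1 + w))\<^sup>2 * (w\<^sup>2 - 1)"
      unfolding d_def w(2) by (simp add: algebra_simps power2_eq_square)
    also have "\<dots> = - ((1 + w)\<^sup>2)"
      unfolding c by (simp add: algebra_simps power2_eq_square)
    finally have "d * w\<^sup>2 * (1 + w)\<^sup>2 = - 1 * (1 + w)\<^sup>2" by (simp add: algebra_simps)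
    then have "d * w\<^sup>2 = - 1" using w by (subst (asm) mult_right_cancel) auto
    then show ?thesis .
  qed
  then have "d + 1 + d * 1 * (norm q)\<^sup>2 = 0"
    by (simp add: w(2) right_diff_distrib)
  moreover have "gamma_mat q ** gamma_mat q ** rank1 1 q = rank1 (d + 1 + d * 1 * (norm q)\<^sup>2) q"
    unfolding gamma_rank1 w_def[symmetric] c_def[symmetric] rank1_mult d_def ..
  ultimately show ?thesis by (simp add: rank1_0)
qed

lemma curv_mat_eq: "curv_mat z q r =
    (1 / slope_w q) *\<^sub>R (mat 1 + z *\<^sub>R (gamma_mat q ** r ** gamma_mat q))"
proof -
  have "(gamma_mat q ** r ** gamma_mat q) $ i $ j =
    (\<Sum>k\<in>UNIV. \<Sum>l\<in>UNIV. gamma_mat q $ i $ k * r $ k $ l * gamma_mat q $ l $ j)" for i j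
    by (simp add: matrix_matrix_mult_def sum_distrib_right) (rule sum.swap)
  then show ?thesis by (simp add: curv_mat_def vec_eq_iff mat_def)
qed

lemma matrix_scaleR_left: "(c *\<^sub>R A) ** B = c *\<^sub>R (A ** B)" for A B :: "real^'n^'n::finite"
  by (simp add: scalar_matrix_assoc)

lemma matrix_scaleR_right: "A ** (c *\<^sub>R B) = c *\<^sub>R (A ** B)" for A B :: "real^'n^'n::finite"
  by (simp add: matrix_scalar_ac scalar_matrix_assoc)

lemma matrix_diff_left: "(A - B) ** D = A ** D - B ** D" for A B D :: "real^'n^'n::finite"
  by (simp add: matrix_matrix_mult_def vec_eq_iff left_diff_distrib sum_subtractf)

lemma matrix_diff_right: "D ** (A - B) = D ** A - D ** B" for A B D :: "real^'n^'n::finite"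
  by (simp add: matrix_matrix_mult_def vec_eq_iff right_diff_distrib sum_subtractf)

lemma matrix_add_left: "(A + B) ** D = A ** D + B ** D" for A B D :: "real^'n^'n::finite"
  by (simp add: matrix_matrix_mult_def vec_eq_iff distrib_right sum.distrib)

lemma transpose_plus: "transpose (A + B) = transpose A + transpose B" for A B :: "real^'n^'n::finite"
  by (simp add: transpose_def vec_eq_iff)

lemma mat_scaleR: "(mat t :: real^'n^'n::finite) = t *\<^sub>R mat 1"
  by (simp add: mat_def vec_eq_iff)

lemma charpoly_similar:
  fixes A B P :: "real^'n^'n::finite"
  assumes "det P \<noteq> 0" and "A ** P = P ** B"
  shows "det (mat t - A) = det (mat t - B)"
proof -
  have "(mat t - A) ** P = P ** (mat t - B)"
    by (simp add: assms(2) matrix_diff_left matrix_diff_right mat_scaleR[of t]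
        matrix_scaleR_left matrix_scaleR_right)
  then have "det (mat t - A) * det P = det P * det (mat t - B)"
    by (metis det_mul)
  then show ?thesis using assms(1) by simp
qed

lemma shape_op_eq:
  fixes q :: "real^'n::finite"
  assumes "snd p > 0"
  shows "shape_op p q r =
    (1 / slope_w q) *\<^sub>R (mat 1 + snd p *\<^sub>R (gamma_mat q ** gamma_mat q ** r))"
proof -
  define z where "z = snd p"
  define w where "w = slope_w q"
  define \<Gamma> where "\<Gamma> = gamma_mat q ** gamma_mat q"
  define G where "G = rank1 1 q"
  have z: "z > 0" and w: "w > 0"
    using assms slope_w_ge_1[of q] by (auto simp: z_def w_def)
  have \<Gamma>G: "\<Gamma> ** G = mat 1" unfolding \<Gamma>_def G_def by (rule gamma_gamma_metric)
  have ff: "first_form p q = (1 / z\<^sup>2) *\<^sub>R G"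
    by (simp add: vec_eq_iff first_form_eq G_def rank1_def z_def)
  have sf: "second_form p q r = (1 / (z * w)) *\<^sub>R r + (1 / (z\<^sup>2 * w)) *\<^sub>R G"
    by (simp add: vec_eq_iff second_form_eq[OF assms] G_def rank1_def z_def w_def)
  have l: "(z\<^sup>2 *\<^sub>R \<Gamma>) ** first_form p q = mat 1"
    unfolding ff using z \<Gamma>G by (simp add: matrix_scaleR_left matrix_scaleR_right)
  then have r: "first_form p q ** (z\<^sup>2 *\<^sub>R \<Gamma>) = mat 1"
    by (simp only: matrix_left_right_inverse)
  have "matrix_inv (first_form p q) = z\<^sup>2 *\<^sub>R \<Gamma>"
    unfolding matrix_inv_def
  proof (rule some_equality)
    show "first_form p q ** (z\<^sup>2 *\<^sub>R \<Gamma>) = mat 1 \<and> (z\<^sup>2 *\<^sub>R \<Gamma>) ** first_form p q = mat 1"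
      using l r by simp
    fix B assume B: "first_form p q ** B = mat 1 \<and> B ** first_form p q = mat 1"
    have "B = B ** (first_form p q ** (z\<^sup>2 *\<^sub>R \<Gamma>))" unfolding r by simp
    also have "\<dots> = z\<^sup>2 *\<^sub>R \<Gamma>" using B by (simp only: matrix_mul_assoc matrix_mul_lid)
    finally show "B = z\<^sup>2 *\<^sub>R \<Gamma>" .
  qed
  then have "shape_op p q r = z\<^sup>2 *\<^sub>R (\<Gamma> ** ((1 / (z * w)) *\<^sub>R r + (1 / (z\<^sup>2 * w)) *\<^sub>R G))"
    unfolding shape_op_def sf by (simp only: matrix_scaleR_left)
  also have "\<dots> = z\<^sup>2 *\<^sub>R ((1 / (z * w)) *\<^sub>R (\<Gamma> ** r) + (1 / (z\<^sup>2 * w)) *\<^sub>R mat 1)"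
    by (simp only: matrix_add_ldistrib matrix_scaleR_right \<Gamma>G)
  also have "\<dots> = (1 / w) *\<^sub>R (mat 1 + z *\<^sub>R (\<Gamma> ** r))"
    using z w by (simp add: scaleR_add_right power2_eq_square)
  finally show ?thesis unfolding z_def w_def \<Gamma>_def .
qed

lemma eigvals_shape_op:
  fixes q :: "real^'n::finite"
  assumes "snd p > 0"
  shows "eigvals (shape_op p q r) = eigvals (curv_mat (snd p) q r)"
proof -
  define \<gamma> where "\<gamma> = gamma_mat q"
  have "\<gamma> ** (\<gamma> ** rank1 1 q) = mat 1"
    using gamma_gamma_metric[of q] by (simp add: \<gamma>_def matrix_mul_assoc)
  then have d: "det \<gamma> \<noteq> 0"
    by (metis det_I det_mul mult_zero_left zero_neq_one)
  have "shape_op p q r ** \<gamma> = \<gamma> ** curv_mat (snd p) q r"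
    by (simp add: shape_op_eq[OF assms] curv_mat_eq \<gamma>_def matrix_scaleR_left matrix_scaleR_right
        matrix_add_ldistrib matrix_add_left matrix_mul_assoc)
  then have "det (mat t - shape_op p q r) = det (mat t - curv_mat (snd p) q r)" for t
    by (rule charpoly_similar[OF d])
  then show ?thesis by (simp add: eigvals_def)
qed

lemma kappa_eq_curv_mat:
  assumes "u x > 0"
  shows "kappa S u x = eigvals (curv_mat (u x) (grad_cl S u x) (hess_cl S u x))"
  unfolding kappa_def by (subst eigvals_shape_op) (use assms in simp_all)

lemma curv_mat_symmetric:
  assumes "transpose r = r"
  shows "transpose (curv_mat z q r) = curv_mat z q r"
proof -
  have "transpose (gamma_mat q) = gamma_mat q"
    by (simp add: gamma_mat_def transpose_def vec_eq_iff mult.commute)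
  then show ?thesis
    by (simp add: curv_mat_eq transpose_scalar transpose_plus matrix_transpose_mul assms
        matrix_mul_assoc transpose_mat)
qed

lemma symmetric_eigenvector:
  fixes A :: "real^'n^'n::finite" and W :: "(real^'n) set"
  assumes sym: "transpose A = A" and W: "subspace W" "\<And>x. x \<in> W \<Longrightarrow> A *v x \<in> W"
    and nz: "\<exists>x\<in>W. x \<noteq> 0"
  shows "\<exists>v\<in>W. \<exists>c. norm v = 1 \<and> A *v v = c *\<^sub>R v"
proof -
  have comm: "x \<bullet> (A *v y) = (A *v x) \<bullet> y" for x y
    by (metis dot_lmul_matrix sym vector_transpose_matrix)
  have cpt: "compact (W \<inter> sphere 0 1)"
    using closed_subspace[OF W(1)] by (simp add: closed_Int_compact)
  obtain x0 where "x0 \<in> W" "x0 \<noteq> 0" using nz by blast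
  then have "x0 /\<^sub>R norm x0 \<in> W \<inter> sphere 0 1" using W(1) by (simp add: subspace_scale)
  then have ne: "W \<inter> sphere 0 1 \<noteq> {}" by blast
  have cont: "continuous_on (W \<inter> sphere 0 1) (\<lambda>x. x \<bullet> (A *v x))"
    by (intro continuous_intros matrix_vector_mult_linear_continuous_on)
  obtain v where v: "v \<in> W" "norm v = 1"
    and mx: "\<And>x. x \<in> W \<Longrightarrow> norm x = 1 \<Longrightarrow> x \<bullet> (A *v x) \<le> v \<bullet> (A *v v)"
    using continuous_attains_sup[OF cpt ne cont] by force
  define c where "c = v \<bullet> (A *v v)"
  define f where "f x = c * (x \<bullet> x) - x \<bullet> (A *v x)" for x
  have f_ge: "f x \<ge> 0" if "x \<in> W" for x
  proof (cases "x = 0")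
    case False
    have "(x /\<^sub>R norm x) \<bullet> (A *v (x /\<^sub>R norm x)) \<le> c"
      unfolding c_def using that W(1) False by (intro mx) (auto simp: subspace_scale)
    then have "(x \<bullet> (A *v x)) / (norm x)\<^sup>2 \<le> c"
      by (simp add: matrix_vector_mult_scaleR power2_eq_square divide_inverse mult_ac)
    then show ?thesis using False
      by (simp add: f_def power2_norm_eq_inner[symmetric] divide_le_eq)
  qed (simp add: f_def)
  define w where "w = c *\<^sub>R v - A *v v"
  have wW: "w \<in> W" using v W by (simp add: w_def subspace_diff subspace_scale)
  have fv: "f v = 0" using v by (simp add: f_def c_def norm_eq_1)
  have expand: "f (v + t *\<^sub>R w) = 2 * t * (w \<bullet> w) + t\<^sup>2 * f w" for t
  proof -
    have "f (v + t *\<^sub>R w) = f v + 2 * t * (w \<bullet> (c *\<^sub>R v - A *v v)) + t\<^sup>2 * f w"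
      using comm[of v w]
      by (simp add: f_def matrix_vector_right_distrib matrix_vector_mult_scaleR inner_add_left
          inner_add_right inner_diff_right inner_commute[of v w] inner_commute[of "A *v v" w] algebra_simps power2_eq_square)
    then show ?thesis by (simp add: fv w_def[symmetric])
  qed
  define a where "a = w \<bullet> w"
  define b where "b = f w"
  have b: "b \<ge> 0" using f_ge wW by (simp add: b_def)
  have "0 \<le> 2 * (- a / (b + 1)) * a + (- a / (b + 1))\<^sup>2 * b"
    using f_ge[of "v + (- a / (b + 1)) *\<^sub>R w", unfolded expand, folded a_def b_def] v wW W(1)
    by (metis subspace_add subspace_scale)
  also have "\<dots> = - (a\<^sup>2 * (b + 2) / (b + 1)\<^sup>2)"
  proof -
    define e where "e = b + 1"
    have e: "e \<noteq> 0" "b + 1 = e" "b + 2 = e + 1" "b = e - 1" using b by (auto simp: e_def)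
    show ?thesis unfolding e(2,3) unfolding e(4) using e(1)
      by (simp add: field_simps power2_eq_square)
  qed
  finally have "a\<^sup>2 * (b + 2) / (b + 1)\<^sup>2 \<le> 0" by simp
  then have "a\<^sup>2 * (b + 2) \<le> 0" using b by (simp add: divide_le_0_iff)
  then have "a = 0" using b by (simp add: mult_le_0_iff)
  then have "A *v v = c *\<^sub>R v" by (simp add: a_def w_def)
  with v show ?thesis by blast
qed

lemma symmetric_eigenbasis:
  fixes A :: "real^'n^'n::finite"
  assumes sym: "transpose A = A"
  shows "\<exists>B. pairwise orthogonal B \<and> (\<forall>v\<in>B. norm v = 1 \<and> (\<exists>c. A *v v = c *\<^sub>R v)) \<and> card B = CARD('n)
    \<and> finite B"
proof -
  define good where "good B \<longleftrightarrow> pairwise orthogonal B \<and>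
    (\<forall>v\<in>B. norm v = 1 \<and> (\<exists>c. A *v v = c *\<^sub>R v))" for B
  have indep: "independent B" if "good B" for B
    using that by (intro pairwise_orthogonal_independent) (auto simp: good_def)
  have bound: "finite B \<and> card B \<le> CARD('n)" if "good B" for B
    using independent_bound[OF indep[OF that]] by simp
  have "good {}" by (simp add: good_def)
  then obtain B where B: "good B" and mx: "\<And>B'. good B' \<Longrightarrow> card B' \<le> card B"
    using ex_has_greatest_nat[of good "{}" card "Suc CARD('n)"] bound
    by (metis le_imp_less_Suc)
  have "span B = UNIV"
  proof (rule ccontr)
    assume ne: "span B \<noteq> UNIV"
    define W where "W = {x. \<forall>b\<in>B. orthogonal b x}"
    have "subspace W" unfolding W_def by (rule subspace_orthogonal_to_vectors)
    moreover have "A *v x \<in> W" if "x \<in> W" for x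
      unfolding W_def
    proof (clarify)
      fix b assume b: "b \<in> B"
      then obtain c where c: "A *v b = c *\<^sub>R b" using B by (auto simp: good_def)
      have "b \<bullet> (A *v x) = (A *v b) \<bullet> x"
        by (metis dot_lmul_matrix sym vector_transpose_matrix)
      then show "orthogonal b (A *v x)"
        using that b by (simp add: W_def orthogonal_def c)
    qed
    moreover have "\<exists>x\<in>W. x \<noteq> 0"
    proof -
      have "span B \<subset> span UNIV" using ne by auto
      then obtain x where "x \<noteq> 0" "\<And>y. y \<in> span B \<Longrightarrow> orthogonal x y"
        using orthogonal_to_subspace_exists_gen by metis
      then show ?thesis unfolding W_def
        by (intro bexI[of _ x]) (auto simp: span_base orthogonal_commute)
    qed
    ultimately obtain v c where v: "v \<in> W" "norm v = 1" "A *v v = c *\<^sub>R v"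
      using symmetric_eigenvector[OF sym] by metis
    have "v \<notin> B"
      using v by (auto simp: W_def orthogonal_def norm_eq_1)
    moreover have "good (insert v B)"
      using B v unfolding good_def W_def pairwise_insert by (auto simp: orthogonal_commute)
    ultimately show False using mx[of "insert v B"] bound[OF B] by simp
  qed
  then have "card B = CARD('n)"
    using dim_eq_card_independent[OF indep[OF B]] dim_span[of B] by simp
  then show ?thesis using B bound[OF B] by (auto simp: good_def)
qed

lemma eigvals_symmetric:
  fixes A :: "real^'n^'n::finite"
  assumes "transpose A = A"
  shows "det (mat t - A) = (\<Prod>i\<in>UNIV. t - eigvals A $ i)"
proof -
  obtain B where B: "pairwise orthogonal B" "\<forall>v\<in>B. norm v = 1 \<and> (\<exists>c. A *v v = c *\<^sub>R v)"
    "card B = CARD('n)" "finite B"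
    using symmetric_eigenbasis[OF assms] by blast
  then obtain f :: "'n \<Rightarrow> real^'n" where f: "bij_betw f UNIV B"
    by (metis finite_same_card_bij finite_class.finite_UNIV)
  define P :: "real^'n^'n" where "P = (\<chi> i j. f j $ i)"
  define l :: "real^'n" where "l = (\<chi> j. SOME c. A *v f j = c *\<^sub>R f j)"
  define D :: "real^'n^'n" where "D = (\<chi> i j. if i = j then l $ j else 0)"
  have fB: "f j \<in> B" for j using f by (auto simp: bij_betw_def)
  have l: "A *v f j = l $ j *\<^sub>R f j" for j
    using someI_ex[of "\<lambda>c. A *v f j = c *\<^sub>R f j"] B(2) fB by (simp add: l_def)
  have "orthogonal_matrix P"
    unfolding orthogonal_matrix_orthonormal_columns
  proof (intro conjI allI impI)
    show "norm (column i P) = 1" for i using B(2) fB by (simp add: P_def column_def)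
    show "orthogonal (column i P) (column j P)" if "i \<noteq> j" for i j
    proof -
      have "f i \<noteq> f j" using f that by (auto simp: bij_betw_def inj_eq)
      then show ?thesis using B(1) fB by (simp add: P_def column_def pairwise_def)
    qed
  qed
  then have "det P \<noteq> 0" using det_orthogonal_matrix by fastforce
  moreover have "A ** P = P ** D"
  proof -
    have "(A ** P) $ i $ j = (A *v f j) $ i" for i j
      by (simp add: matrix_matrix_mult_def matrix_vector_mult_def P_def)
    moreover have "(P ** D) $ i $ j = l $ j * f j $ i" for i j
      by (simp add: matrix_matrix_mult_def P_def D_def if_distrib cong: if_cong)
    ultimately show ?thesis by (simp add: vec_eq_iff l)
  qed
  ultimately have "det (mat t - A) = det (mat t - D)" for t by (rule charpoly_similar)
  moreover have "det (mat t - D) = (\<Prod>i\<in>UNIV. t - l $ i)" for t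
    by (subst det_diagonal) (auto simp: D_def mat_def)
  ultimately have "\<exists>l::real^'n. \<forall>t. det (mat t - A) = (\<Prod>i\<in>UNIV. t - l $ i)" by auto
  from someI_ex[OF this] show ?thesis unfolding eigvals_def by blast
qed

end

theory Submission
  imports Defs "HOL-Computational_Algebra.Polynomial"
begin

text \<open>
  The estimate is a maximum principle for the function
  \<open>\<Psi>(x, V) = w^(b-1) * C(V, V) / g(V, V)\<close> of a point \<open>x\<close> and a direction \<open>V\<close>, where
  \<open>w = sqrt (1 + |Du|^2)\<close>, \<open>g\<close> is the Euclidean first fundamental form of the graph,
  \<open>C = g + u D^2 u\<close>, and \<open>b = 1 + 1/N\<close> with \<open>N = n - k + 1\<close>.  For fixed \<open>x\<close> the maximum over \<open>V\<close> is
  \<open>w^b * \<kappa>_max\<close>.  Since \<open>1 \<le> w \<le> 1/\<sigma>\<close>, and since \<open>|\<kappa>| \<le> \<sigma>_1 \<le> n * \<kappa>_max\<close> in the cone (as \<open>k \<ge> 2\<close>),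
  a bound for \<open>\<Psi>\<close> bounds \<open>|\<kappa>|\<close>.  A maximum of \<open>\<Psi>\<close> over the boundary is controlled by the boundary
  curvature, so it remains to show that at an interior maximum the largest curvature \<open>\<kappa>_p\<close> is at most a constant
  depending on \<open>n\<close>, \<open>k\<close> and \<open>\<sigma>\<close> (\<open>interior_maximum_bound\<close>).

  At an interior maximum take a frame \<open>e_a\<close> of principal directions.  The point may move along \<open>e_c\<close> while the
  direction rotates as \<open>e_p + t m\<close> with arbitrary \<open>m\<close>; each choice gives a second-order inequality.  Adding these
  with the weights \<open>f_c = d \<sigma>_k / d \<kappa>_c\<close> makes the fourth derivatives of \<open>u\<close> into the second derivative of the
  equation \<open>\<sigma>_k(\<kappa>) = const\<close> in the direction \<open>e_p\<close>, computed in \<open>sigma_variation\<close>.  With the rotations that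
  complete squares, all third derivatives cancel, have a favourable sign or are determined by the first-order
  conditions, except for the derivatives \<open>\<xi>_a\<close> of the curvatures \<open>\<kappa>_a\<close> in the direction \<open>e_p\<close>.  These satisfy
  \<open>\<Sum> f_a \<xi>_a = 0\<close>, and they enter through the quadratic form
  \<open>2 \<Sum> f_a \<xi>_a^2 / (\<kappa>_p - \<kappa>_a + \<delta>) - \<Sum> f_ab \<xi>_a \<xi>_b\<close>, with \<open>f_ab\<close> the second derivatives of \<open>\<sigma>_k\<close> and
  the first sum over \<open>a \<noteq> p\<close> (lemma \<open>balance\<close>).

  The heart of the matter is a lower bound for this form by \<open>f_p \<xi>_p^2 / (\<kappa>_p + r)\<close> with
  \<open>r = (\<kappa>_p + \<delta>) (n - k) / k\<close> (\<open>top_entry_inequality\<close>).  It expresses that, after the change of variables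
  \<open>x \<mapsto> 1/(K - x)\<close>, quotients of consecutive elementary symmetric polynomials have the concavity property
  \<open>concave_esquot\<close>, so that the largest curvature plus a constant is midpoint log-convex along curves in the level
  set of \<open>\<sigma>_k\<close>.  The first-order condition gives \<open>\<xi>_p\<close> explicitly, and \<open>\<kappa>_p + r \<le> N \<kappa>_p\<close> together with
  \<open>b (1 - 1/N) \<le> 1\<close> shows that this gain compensates the one dangerous negative term, the square of the logarithmic
  derivative of \<open>w^b\<close> in the direction \<open>e_p\<close>.  The other gradient terms are absorbed by \<open>(b - 1) \<Sum> f_a\<close>, and for large
  \<open>\<kappa>_p\<close> the positive term \<open>k \<sigma>_k \<kappa>_p\<close> dominates what remains (\<open>critical_bound\<close>).
\<close>

section \<open>Elementary symmetric polynomials over finite index sets\<close>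

text \<open>The index set is an argument because almost every argument below removes one or two variables:
  \<open>es k (I - {i}) x\<close> is the derivative of \<open>es (Suc k) I\<close> with respect to \<open>x i\<close>.\<close>

definition es :: "nat \<Rightarrow> 'a set \<Rightarrow> ('a \<Rightarrow> real) \<Rightarrow> real" where
  "es k I x = (\<Sum>J | J \<subseteq> I \<and> card J = k. \<Prod>i\<in>J. x i)"

lemma es_0 [simp]: assumes "finite I" shows "es 0 I x = 1"
proof -
  have "{J. J \<subseteq> I \<and> card J = 0} = {{}}" using assms finite_subset by fastforce
  then show ?thesis by (simp add: es_def)
qed

lemma es_empty: "es (Suc k) {} x = 0"
proof -
  have "{J. J \<subseteq> {} \<and> card J = Suc k} = ({}::'a set set)" by auto
  then show ?thesis by (simp add: es_def)
qed

lemma es_insert: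
  assumes "finite I" "i \<notin> I"
  shows "es (Suc k) (insert i I) x = x i * es k I x + es (Suc k) I x"
proof -
  have split: "{J. J \<subseteq> insert i I \<and> card J = Suc k} =
      insert i ` {J. J \<subseteq> I \<and> card J = k} \<union> {J. J \<subseteq> I \<and> card J = Suc k}" (is "?L = ?A \<union> ?B")
  proof (intro equalityI subsetI)
    fix J assume J: "J \<in> ?L"
    show "J \<in> ?A \<union> ?B"
    proof (cases "i \<in> J")
      case True
      have "finite J" using J assms(1) by (auto intro: finite_subset)
      then have "card (J - {i}) = k" "J - {i} \<subseteq> I" "J = insert i (J - {i})"
        using J True by auto
      then show ?thesis by blast
    next
      case False then show ?thesis using J by auto
    qed
  next
    fix J assume "J \<in> ?A \<union> ?B"
    then show "J \<in> ?L" using assms by (auto simp: finite_subset card_insert_if)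
  qed
  have fin: "finite {J. J \<subseteq> I \<and> card J = m}" for m using assms(1) by simp
  have inj: "inj_on (insert i) {J. J \<subseteq> I \<and> card J = k}"
    using assms(2) by (auto simp: inj_on_def)
  have "es (Suc k) (insert i I) x = sum (prod x) ?A + sum (prod x) ?B"
    unfolding es_def split using assms(2) fin by (intro sum.union_disjoint) auto
  also have "sum (prod x) ?A = (\<Sum>J | J \<subseteq> I \<and> card J = k. x i * prod x J)"
    unfolding sum.reindex[OF inj] comp_def
  proof (rule sum.cong[OF refl])
    fix J assume "J \<in> {J. J \<subseteq> I \<and> card J = k}"
    then have "finite J" "i \<notin> J" using assms by (auto intro: finite_subset)
    then show "prod x (insert i J) = x i * prod x J" by simp
  qed
  finally show ?thesis by (simp add: es_def sum_distrib_left)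
qed

lemma es_remove:
  assumes "finite I" "i \<in> I"
  shows "es (Suc k) I x = x i * es k (I - {i}) x + es (Suc k) (I - {i}) x"
  using es_insert[of "I - {i}" i k x] assms by (simp add: insert_absorb)

lemma es_cong: "(\<And>i. i \<in> I \<Longrightarrow> x i = y i) \<Longrightarrow> es k I x = es k I y"
  unfolding es_def by (intro sum.cong prod.cong) auto

lemma es_too_large: "finite I \<Longrightarrow> card I < k \<Longrightarrow> es k I x = 0"
  by (simp add: es_def) (metis (mono_tags, lifting) card_mono leD mem_Collect_eq sum.neutral)

text \<open>Euler's identity for a homogeneous polynomial of degree \<open>k + 1\<close>.\<close>

lemma es_euler:
  assumes "finite I"
  shows "(\<Sum>i\<in>I. x i * es k (I - {i}) x) = real (Suc k) * es (Suc k) I x"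
  using assms
proof (induction I arbitrary: k rule: finite_induct)
  case empty then show ?case by (simp add: es_empty)
next
  case (insert a I)
  have rem: "insert a I - {i} = insert a (I - {i})" if "i \<in> I" for i
    using that insert.hyps by auto
  have "(\<Sum>i\<in>insert a I. x i * es k (insert a I - {i}) x)
      = x a * es k I x + (\<Sum>i\<in>I. x i * es k (insert a (I - {i})) x)"
    using insert.hyps by (simp add: rem)
  also have "(\<Sum>i\<in>I. x i * es k (insert a (I - {i})) x)
      = real k * x a * es k I x + real (Suc k) * es (Suc k) I x"
  proof (cases k)
    case 0
    then show ?thesis using insert.IH[of 0] insert.hyps by simp
  next
    case (Suc m)
    have "(\<Sum>i\<in>I. x i * es k (insert a (I - {i})) x)
        = (\<Sum>i\<in>I. x a * (x i * es m (I - {i}) x) + x i * es (Suc m) (I - {i}) x)"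
      using insert.hyps Suc by (intro sum.cong refl) (simp add: es_insert algebra_simps)
    also have "\<dots> = x a * (real (Suc m) * es (Suc m) I x) + real (Suc k) * es (Suc k) I x"
      by (simp only: sum.distrib sum_distrib_left[symmetric] insert.IH Suc)
    finally show ?thesis using Suc by (simp add: algebra_simps)
  qed
  finally show ?case using insert.hyps by (simp add: es_insert algebra_simps)
qed

text \<open>Each monomial of degree \<open>k\<close> survives the removal of \<open>i\<close> for exactly the \<open>card I - k\<close> indices
  that it does not contain.\<close>

lemma es_count:
  assumes "finite I"
  shows "(\<Sum>i\<in>I. es k (I - {i}) x) = (real (card I) - real k) * es k I x"
proof (cases k)
  case 0 then show ?thesis using assms by simp
next
  case (Suc m)
  have "real (card I) * es k I x = (\<Sum>i\<in>I. x i * es m (I - {i}) x + es k (I - {i}) x)"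
    using assms by (simp add: es_remove[symmetric] Suc)
  then show ?thesis using es_euler[OF assms, of x m] Suc by (simp add: sum.distrib algebra_simps)
qed

lemma tendsto_es [tendsto_intros]:
  assumes "\<And>i. i \<in> I \<Longrightarrow> ((\<lambda>t. x t i) \<longlongrightarrow> l i) F"
  shows "((\<lambda>t. es k I (x t)) \<longlongrightarrow> es k I l) F"
  unfolding es_def using assms by (intro tendsto_sum tendsto_prod) auto

section \<open>Newton's inequality\<close>

text \<open>Vieta: the coefficients of this polynomial are the elementary symmetric polynomials of \<open>x\<close>, which
  makes real-rootedness available for Newton's inequality.\<close>

definition rootpoly :: "'a set \<Rightarrow> ('a \<Rightarrow> real) \<Rightarrow> real poly" where
  "rootpoly I x = (\<Prod>i\<in>I. [:x i, 1:])"

lemma degree_rootpoly: "finite I \<Longrightarrow> degree (rootpoly I x) = card I"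
  unfolding rootpoly_def by (subst degree_prod_eq_sum_degree) auto

lemma coeff_rootpoly:
  assumes "finite I" "k \<le> card I"
  shows "coeff (rootpoly I x) (card I - k) = es k I x"
  using assms
proof (induction I arbitrary: k rule: finite_induct)
  case empty then show ?case by (simp add: rootpoly_def)
next
  case (insert a I)
  have rp: "rootpoly (insert a I) x = smult (x a) (rootpoly I x) + pCons 0 (rootpoly I x)"
    using insert.hyps by (simp add: rootpoly_def)
  show ?case
  proof (cases k)
    case 0
    have "coeff (rootpoly I x) (Suc (card I)) = 0"
      by (rule coeff_eq_0) (simp add: degree_rootpoly insert.hyps)
    then show ?thesis using insert.hyps insert.IH[of 0] 0 by (simp add: rp)
  next
    case (Suc m)
    then have m: "m \<le> card I" using insert by simp
    have 1: "coeff (rootpoly I x) (card I - m) = es m I x" using insert.IH[OF m] .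
    show ?thesis
    proof (cases "m = card I")
      case True
      then show ?thesis using insert.hyps 1 Suc by (simp add: rp es_insert es_too_large)
    next
      case False
      then have 2: "coeff (rootpoly I x) (card I - Suc m) = es (Suc m) I x"
        using insert.IH[of "Suc m"] m by simp
      have "card I - m = Suc (card I - Suc m)" using False m by simp
      then show ?thesis using insert.hyps 1 2 Suc by (simp add: rp es_insert coeff_pCons)
    qed
  qed
qed

text \<open>Rolle between consecutive roots.  The bound by the largest root is carried along so that the point
  found between the last two roots is new.\<close>

lemma pderiv_distinct_roots:
  fixes p :: "real poly"
  assumes "finite R" "R \<noteq> {}" "\<And>r. r \<in> R \<Longrightarrow> poly p r = 0"
  shows "\<exists>R'. finite R' \<and> card R' = card R - 1 \<and> (\<forall>r\<in>R'. poly (pderiv p) r = 0) \<and>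
     (\<forall>r\<in>R'. r < Max R)"
  using assms
proof (induction "card R" arbitrary: R rule: less_induct)
  case less
  define m where "m = Max R"
  have m: "m \<in> R" using less.prems by (simp add: m_def)
  show ?case
  proof (cases "R = {m}")
    case True then show ?thesis by (intro exI[of _ "{}"]) simp
  next
    case False
    define S where "S = R - {m}"
    have S: "finite S" "S \<noteq> {}" "card S < card R" "card R = Suc (card S)"
      using False m less.prems by (auto simp: S_def card_Diff_singleton card_gt_0_iff)
    obtain R' where R': "finite R'" "card R' = card S - 1" "\<forall>r\<in>R'. poly (pderiv p) r = 0"
      "\<forall>r\<in>R'. r < Max S"
      using less.hyps[OF S(3) S(1,2)] less.prems by (auto simp: S_def)
    have ms: "Max S \<in> S" using S by simp
    have lt: "Max S < m"
      using ms Max_ge[OF less.prems(1), of "Max S"] by (auto simp: S_def m_def order_less_le)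
    have z: "poly p (Max S) = 0" "poly p m = 0" using ms m less.prems by (auto simp: S_def)
    obtain c where c: "Max S < c" "c < m" "poly (pderiv p) c = 0"
      using poly_MVT[OF lt, of p] z lt by auto
    have "c \<notin> R'" using R'(4) c(1) by auto
    moreover have "card S \<ge> 1" using S by (simp add: Suc_le_eq card_gt_0_iff)
    ultimately have "card (insert c R') = card R - 1" using R' S by simp
    moreover have "\<forall>r\<in>insert c R'. r < Max R" using R'(4) lt c(2) by (auto simp: m_def[symmetric])
    ultimately show ?thesis
      using R' c(3) by (intro exI[of _ "insert c R'"]) auto
  qed
qed

text \<open>For \<open>p = c * prod (t - r)\<close> the difference \<open>p'^2 - p * p''\<close> is \<open>p^2\<close> times the sum of the
  \<open>1/(t - r)^2\<close>; splitting off one linear factor at a time avoids the division.\<close>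

lemma split_laguerre:
  fixes p :: "real poly"
  assumes "finite R" "card R = degree p" "\<And>r. r \<in> R \<Longrightarrow> poly p r = 0"
  shows "poly p 0 * poly (pderiv (pderiv p)) 0 \<le> (poly (pderiv p) 0)\<^sup>2"
  using assms
proof (induction R arbitrary: p rule: finite_induct)
  case empty
  then obtain c where "p = [:c:]" by (metis card.empty degree_eq_zeroE)
  then show ?case by (simp add: pderiv_pCons)
next
  case (insert r R)
  have "[:- r, 1:] dvd p" using insert.prems by (simp add: poly_eq_0_iff_dvd)
  then obtain p1 where p1: "p = [:- r, 1:] * p1" by (auto elim: dvdE)
  have "p \<noteq> 0" using insert.prems insert.hyps by auto
  then have "p1 \<noteq> 0" using p1 by auto
  then have "degree p = Suc (degree p1)" unfolding p1 by (subst degree_mult_eq) auto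
  moreover have "poly p1 t = 0" if "t \<in> R" for t
    using insert.prems(2)[of t] insert.hyps that by (auto simp: p1)
  ultimately have IH: "poly p1 0 * poly (pderiv (pderiv p1)) 0 \<le> (poly (pderiv p1) 0)\<^sup>2"
    using insert.IH[of p1] insert.prems insert.hyps by auto
  have "(poly (pderiv p) 0)\<^sup>2 - poly p 0 * poly (pderiv (pderiv p)) 0
      = (poly p1 0)\<^sup>2 + r\<^sup>2 * ((poly (pderiv p1) 0)\<^sup>2 - poly p1 0 * poly (pderiv (pderiv p1)) 0)"
    unfolding p1 pderiv_mult by (simp add: pderiv_mult pderiv_add pderiv_diff pderiv_smult pderiv_pCons power2_eq_square algebra_simps)
  also have "\<dots> \<ge> 0" using IH by (intro add_nonneg_nonneg mult_nonneg_nonneg) auto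
  finally show ?case by simp
qed

lemma higher_pderiv_distinct_roots:
  fixes p :: "real poly"
  assumes "finite R" "card R = degree p" "\<And>r. r \<in> R \<Longrightarrow> poly p r = 0" "m \<le> degree p"
  shows "\<exists>R'. finite R' \<and> card R' = degree ((pderiv ^^ m) p) \<and> (\<forall>r\<in>R'. poly ((pderiv ^^ m) p) r = 0)"
  using assms(4)
proof (induction m)
  case 0 then show ?case using assms by auto
next
  case (Suc m)
  then obtain R' where R': "finite R'" "card R' = degree ((pderiv ^^ m) p)"
    "\<forall>r\<in>R'. poly ((pderiv ^^ m) p) r = 0" by auto
  have "degree ((pderiv ^^ m) p) = degree p - m" by (induction m) (simp_all add: degree_pderiv)
  then have "R' \<noteq> {}" using R'(2) Suc.prems by auto
  from pderiv_distinct_roots[OF R'(1) this] R'(3)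
  obtain R'' where "finite R''" "card R'' = card R' - 1" "\<forall>r\<in>R''. poly (pderiv ((pderiv ^^ m) p)) r = 0"
    by metis
  then show ?case using R'(2) by (intro exI[of _ R'']) (simp add: degree_pderiv)
qed

lemma poly_pderiv_iter_0: "poly ((pderiv ^^ m) p) 0 = fact m * coeff (p :: real poly) m"
proof -
  have "coeff ((pderiv ^^ m) p) j = pochhammer (real (Suc j)) m * coeff p (j + m)" for j
    by (induction m arbitrary: j) (simp_all add: coeff_pderiv pochhammer_rec algebra_simps)
  from this[of 0] show ?thesis by (simp add: poly_0_coeff_0 pochhammer_fact)
qed

text \<open>The derivative of order \<open>card I - k - 2\<close> of \<open>rootpoly\<close> is still real-rooted, and its values and
  first two derivatives at \<open>0\<close> are the three symmetric polynomials up to factorials.\<close>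

lemma newton_distinct:
  assumes I: "finite I" and inj: "inj_on x I" and k: "Suc (Suc k) \<le> card I"
  shows "es k I x * es (Suc (Suc k)) I x \<le> (es (Suc k) I x)\<^sup>2"
proof -
  define p where "p = rootpoly I x"
  define m where "m = card I - Suc (Suc k)"
  have d: "degree p = card I" by (simp add: p_def degree_rootpoly I)
  define R where "R = (\<lambda>i. - x i) ` I"
  have R: "finite R" "card R = degree p" "\<And>r. r \<in> R \<Longrightarrow> poly p r = 0"
    using I inj unfolding R_def d by (auto simp: card_image inj_on_def p_def rootpoly_def poly_prod intro!: prod_zero)
  obtain R' where R': "finite R'" "card R' = degree ((pderiv ^^ m) p)"
    "\<And>r. r \<in> R' \<Longrightarrow> poly ((pderiv ^^ m) p) r = 0"
    using higher_pderiv_distinct_roots[OF R, of m] d by (auto simp: m_def)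
  have c: "coeff p m = es (Suc (Suc k)) I x" "coeff p (Suc m) = es (Suc k) I x"
    "coeff p (Suc (Suc m)) = es k I x"
    using coeff_rootpoly[OF I, of "Suc (Suc k)" x] coeff_rootpoly[OF I, of "Suc k" x]
      coeff_rootpoly[OF I, of k x] k
    by (simp_all add: p_def m_def Suc_diff_Suc)
  have "poly ((pderiv ^^ m) p) 0 * poly ((pderiv ^^ Suc (Suc m)) p) 0 \<le> (poly ((pderiv ^^ Suc m) p) 0)\<^sup>2"
    using split_laguerre[OF R'] by simp
  then have *: "fact m * es (Suc (Suc k)) I x * (fact (Suc (Suc m)) * es k I x)
      \<le> (fact (Suc m) * es (Suc k) I x)\<^sup>2"
    unfolding poly_pderiv_iter_0 c .
  show ?thesis
  proof (cases "es k I x * es (Suc (Suc k)) I x \<le> 0")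
    case True then show ?thesis by (meson order_trans zero_le_power2)
  next
    case False
    define F where "F = (fact m :: real)"
    have F: "F > 0" by (simp add: F_def)
    have "F * F * (real (Suc m) * real (Suc (Suc m))) * (es k I x * es (Suc (Suc k)) I x)
        \<le> F * F * (real (Suc m) * real (Suc m)) * (es (Suc k) I x)\<^sup>2"
      using * by (simp add: F_def power2_eq_square algebra_simps)
    then have "(real (Suc m) * real (Suc (Suc m))) * (es k I x * es (Suc (Suc k)) I x)
        \<le> (real (Suc m) * real (Suc m)) * (es (Suc k) I x)\<^sup>2"
      using F by (simp add: mult.assoc)
    moreover have "(real (Suc m) * real (Suc m)) * (es k I x * es (Suc (Suc k)) I x)
        \<le> (real (Suc m) * real (Suc (Suc m))) * (es k I x * es (Suc (Suc k)) I x)"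
      using False by (intro mult_right_mono mult_left_mono) auto
    ultimately have "(real (Suc m) * real (Suc m)) * (es k I x * es (Suc (Suc k)) I x)
        \<le> (real (Suc m) * real (Suc m)) * (es (Suc k) I x)\<^sup>2" by linarith
    then show ?thesis by (simp add: mult_le_cancel_left del: of_nat_Suc)
  qed
qed

text \<open>Newton's inequality without the binomial factor.  Distinct entries are dense: the entries are moved
  along a line on which coincidences occur at finitely many parameters only.\<close>

lemma newton:
  assumes I: "finite I"
  shows "es k I x * es (Suc (Suc k)) I x \<le> (es (Suc k) I x)\<^sup>2"
proof (cases "Suc (Suc k) \<le> card I")
  case False
  then show ?thesis using I by (simp add: es_too_large)
next
  case True
  obtain c :: "'a \<Rightarrow> nat" where c: "inj_on c I" using I finite_imp_inj_to_nat_seg by blast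
  define y where "y t i = x i + t * real (c i)" for t i
  \<comment> \<open>the parameters at which two of the moved entries coincide\<close>
  define B where "B = (\<lambda>(i, j). (x j - x i) / (real (c i) - real (c j))) ` (I \<times> I)"
  have "finite B" using I by (simp add: B_def)
  have inj: "inj_on (y t) I" if "t \<notin> B" for t
  proof (rule inj_onI, rule ccontr)
    fix i j assume ij: "i \<in> I" "j \<in> I" "y t i = y t j" "i \<noteq> j"
    then have "real (c i) - real (c j) \<noteq> 0" using c by (auto simp: inj_on_def)
    then have "t = (x j - x i) / (real (c i) - real (c j))"
      using ij(3) by (simp add: y_def field_simps)
    then show False using ij that by (force simp: B_def)
  qed
  have "eventually (\<lambda>t. t \<notin> B) (at (0::real))"
  proof -
    have "closed (B - {0})" using \<open>finite B\<close> by (intro finite_imp_closed) simp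
    then show ?thesis unfolding eventually_at_topological
      by (intro exI[of _ "- (B - {0})"]) (auto simp del: Compl_Diff_eq)
  qed
  then have ev: "eventually (\<lambda>t. es k I (y t) * es (Suc (Suc k)) I (y t) \<le> (es (Suc k) I (y t))\<^sup>2) (at 0)"
    by eventually_elim (use newton_distinct[OF I inj True] in blast)
  have lim: "((\<lambda>t. y t i) \<longlongrightarrow> x i) (at 0)" for i
    unfolding y_def by (rule tendsto_eq_intros refl | simp)+
  show ?thesis
    by (rule tendsto_le[OF _ _ _ ev]) (intro tendsto_intros lim | simp)+
qed

section \<open>Garding cones\<close>

text \<open>The case \<open>j = 0\<close> holds automatically for finite \<open>I\<close>; including it lets inductions on \<open>k\<close> start
  at \<open>0\<close>.\<close>

definition garding :: "nat \<Rightarrow> 'a set \<Rightarrow> ('a \<Rightarrow> real) \<Rightarrow> bool" where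
  "garding k I x \<longleftrightarrow> (\<forall>j\<le>k. es j I x > 0)"

text \<open>The classical monotonicity of the Garding cones.  If \<open>es (k+1)\<close> of the remaining variables were
  nonpositive, then positivity of \<open>es (k+1)\<close> and \<open>es (k+2)\<close> of all variables would violate Newton's
  inequality for the remaining ones.\<close>

lemma garding_remove:
  assumes I: "finite I" "i \<in> I" and g: "garding (Suc k) I x"
  shows "garding k (I - {i}) x"
  using g
proof (induction k)
  case 0 then show ?case using I by (simp add: garding_def)
next
  case (Suc k)
  let ?e = "\<lambda>j. es j (I - {i}) x"
  have IH: "garding k (I - {i}) x" using Suc by (auto simp: garding_def)
  have "?e (Suc k) > 0"
  proof (rule ccontr)
    assume "\<not> ?e (Suc k) > 0"
    then have le: "?e (Suc k) \<le> 0" by simp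
    have pk: "?e k > 0" using IH by (simp add: garding_def)
    have "es (Suc k) I x > 0" "es (Suc (Suc k)) I x > 0"
      using Suc.prems unfolding garding_def by auto
    then have 1: "x i * ?e k + ?e (Suc k) > 0" "x i * ?e (Suc k) + ?e (Suc (Suc k)) > 0"
      using es_remove[OF I, of k x] es_remove[OF I, of "Suc k" x]
      by auto
    have "?e k * (x i * ?e (Suc k)) + ?e k * ?e (Suc (Suc k)) > 0"
      using mult_pos_pos[OF pk 1(2)] by (simp add: algebra_simps)
    moreover have "(x i * ?e k) * ?e (Suc k) + ?e (Suc k) * ?e (Suc k) \<le> 0"
      using mult_nonneg_nonpos[OF less_imp_le[OF 1(1)] le] by (simp add: algebra_simps)
    moreover have "?e k * ?e (Suc (Suc k)) \<le> (?e (Suc k))\<^sup>2" using newton I by blast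
    ultimately show False by (simp add: algebra_simps power2_eq_square)
  qed
  then show ?case using IH by (auto simp: garding_def le_Suc_eq)
qed


section \<open>Concavity of quotients of elementary symmetric polynomials\<close>

text \<open>The parallel sum \<open>a b / (a + b)\<close> is homogeneous of degree one and concave on the half plane
  \<open>a + b > 0\<close>; the defect is a square over a positive denominator.  Neither argument has to be positive,
  which matters for entries of either sign.\<close>

lemma parallel_sum_superadditive:
  fixes a b c d :: real
  assumes "a + b > 0" "c + d > 0"
  shows "a * b / (a + b) + c * d / (c + d) \<le> (a + c) * (b + d) / (a + c + (b + d))"
proof -
  define s where "s = a + b" define s' where "s' = c + d"
  have s: "s > 0" "s' > 0" using assms by (auto simp: s_def s'_def)
  have b: "b = s - a" "d = s' - c" by (auto simp: s_def s'_def)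
  have "(a + c) * (b + d) / (s + s') - (a * b / s + c * d / s') = (a * s' - c * s)\<^sup>2 / (s * s' * (s + s'))"
    using s unfolding b by (simp add: field_simps power2_eq_square)
  also have "\<dots> \<ge> 0" using s by (intro divide_nonneg_nonneg) auto
  finally show ?thesis by (simp add: s_def s'_def add_ac)
qed

lemma parallel_sum_mono:
  fixes a b c d :: real
  assumes "a + b > 0" "a \<le> c" "b \<le> d"
  shows "a * b / (a + b) \<le> c * d / (c + d)"
proof -
  have "a * b / (a + b) \<le> c * b / (c + b)"
  proof -
    have "c * b / (c + b) - a * b / (a + b) = (c - a) * b\<^sup>2 / ((c + b) * (a + b))"
      using assms by (simp add: field_simps power2_eq_square)
    also have "\<dots> \<ge> 0" using assms by (intro divide_nonneg_nonneg mult_nonneg_nonneg) auto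
    finally show ?thesis by simp
  qed
  also have "\<dots> \<le> c * d / (c + d)"
  proof -
    have "c * d / (c + d) - c * b / (c + b) = (d - b) * c\<^sup>2 / ((c + b) * (c + d))"
      using assms by (simp add: field_simps power2_eq_square)
    also have "\<dots> \<ge> 0" using assms by (intro divide_nonneg_nonneg mult_nonneg_nonneg) auto
    finally show ?thesis by simp
  qed
  finally show ?thesis .
qed

text \<open>A concave function that is nondecreasing in each argument, composed with concave functions.\<close>

lemma concave_on_parallel_sum:
  fixes A B :: "real \<Rightarrow> real"
  assumes A: "concave_on J A" and B: "concave_on J B" and pos: "\<And>t. t \<in> J \<Longrightarrow> A t + B t > 0"
  shows "concave_on J (\<lambda>t. A t * B t / (A t + B t))"
  unfolding concave_on_iff
proof (intro conjI ballI allI impI)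
  show "convex J" using A by (simp add: concave_on_iff)
  fix x y u v :: real
  assume xy: "x \<in> J" "y \<in> J" and uv: "0 \<le> u" "0 \<le> v" "u + v = 1"
  let ?z = "u *\<^sub>R x + v *\<^sub>R y"
  have a: "u * A x + v * A y \<le> A ?z" "u * B x + v * B y \<le> B ?z"
    using A B xy uv unfolding concave_on_iff by blast+
  have scale: "c * (p * q / (p + q)) = (c * p) * (c * q) / (c * p + c * q)" for c p q :: real
    by (cases "c = 0") (simp_all add: distrib_left[symmetric])
  show "u * (A x * B x / (A x + B x)) + v * (A y * B y / (A y + B y)) \<le> A ?z * B ?z / (A ?z + B ?z)"
  proof (cases "u = 0 \<or> v = 0")
    case True then show ?thesis using uv by auto
  next
    case False
    then have uv': "u > 0" "v > 0" using uv by auto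
    have p: "u * A x + u * B x > 0" "v * A y + v * B y > 0"
      using pos[OF xy(1)] pos[OF xy(2)] uv' by (simp_all flip: distrib_left)
    have "u * (A x * B x / (A x + B x)) + v * (A y * B y / (A y + B y))
        \<le> (u * A x + v * A y) * (u * B x + v * B y) / (u * A x + v * A y + (u * B x + v * B y))"
      unfolding scale by (rule parallel_sum_superadditive[OF p])
    also have "\<dots> \<le> A ?z * B ?z / (A ?z + B ?z)"
      by (rule parallel_sum_mono) (use p a in auto)
    finally show ?thesis .
  qed
qed

lemma concave_on_eq_on:
  fixes f g :: "real \<Rightarrow> real"
  assumes eq: "\<And>t. t \<in> J \<Longrightarrow> f t = g t" and f: "concave_on J f"
  shows "concave_on J g"
  unfolding concave_on_iff
proof (intro conjI ballI allI impI)
  show J: "convex J" using f by (simp add: concave_on_iff)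
  fix x y u v :: real
  assume xy: "x \<in> J" "y \<in> J" and uv: "0 \<le> u" "0 \<le> v" "u + v = 1"
  have "u *\<^sub>R x + v *\<^sub>R y \<in> J" using J xy uv by (rule convexD)
  moreover have "u * f x + v * f y \<le> f (u *\<^sub>R x + v *\<^sub>R y)"
    using f xy uv unfolding concave_on_iff by blast
  ultimately show "u * g x + v * g y \<le> g (u *\<^sub>R x + v *\<^sub>R y)" using eq xy by metis
qed

text \<open>Iterated parallel sums.\<close>

lemma concave_on_harmonic_sum:
  fixes P :: "'a \<Rightarrow> real \<Rightarrow> real"
  assumes "finite I" "I \<noteq> {}" "\<And>i. i \<in> I \<Longrightarrow> concave_on J (P i)" "\<And>i t. i \<in> I \<Longrightarrow> t \<in> J \<Longrightarrow> P i t > 0"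
  shows "concave_on J (\<lambda>t. 1 / (\<Sum>i\<in>I. 1 / P i t))"
  using assms
proof (induction I rule: finite_ne_induct)
  case (singleton i) then show ?case by simp
next
  case (insert i I)
  let ?S = "\<lambda>t. 1 / (\<Sum>i\<in>I. 1 / P i t)"
  have S: "(\<Sum>i\<in>I. 1 / P i t) > 0" if "t \<in> J" for t
    using insert that by (intro sum_pos) auto
  have c: "concave_on J (\<lambda>t. P i t * ?S t / (P i t + ?S t))"
    by (rule concave_on_parallel_sum) (use insert S in \<open>auto intro!: add_pos_pos\<close>)
  have eq: "P i t * ?S t / (P i t + ?S t) = 1 / (\<Sum>i\<in>insert i I. 1 / P i t)" if "t \<in> J" for t
  proof -
    have "P i t > 0" using insert.prems that by auto
    then show ?thesis using S[OF that] insert.hyps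
      by (simp add: field_simps)
  qed
  show ?case by (rule concave_on_eq_on[OF eq c])
qed

text \<open>In the variables \<open>A\<close> and \<open>B\<close>, affine in \<open>1/(K - x)\<close> and \<open>1/(r - q)\<close>, the quantity
  \<open>1/(c - p)\<close> for the parallel sum \<open>p\<close> of \<open>x\<close> and \<open>q\<close> is again an affine function of a parallel sum.
  This is why the transformation \<open>x \<mapsto> 1/(K - x)\<close> is compatible with the recursion for quotients.\<close>

lemma parallel_transform:
  fixes K r x q :: real
  assumes "0 < K" "0 < r" "x < K" "q < r" "x + q > 0"
  defines "A \<equiv> K\<^sup>2 * (1 / (K - x)) - K" and "B \<equiv> r\<^sup>2 * (1 / (r - q)) - r" and "c \<equiv> K * r / (K + r)"
    and "p \<equiv> x * q / (x + q)"
  shows "A + B > 0" and "p < c" and "1 / (c - p) = (A * B / (A + B) + c) / c\<^sup>2"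
proof -
  have key: "K * r * (x + q) - (K + r) * (x * q) > 0"
  proof (cases "x > 0 \<and> q > 0")
    case True
    then have "K * (x * (r - q)) + r * (q * (K - x)) > 0" using assms by (intro add_pos_pos mult_pos_pos) auto
    then show ?thesis by (simp add: algebra_simps)
  next
    case False
    then have "x * q \<le> 0" using assms by (auto simp: mult_le_0_iff not_less)
    then have "(K + r) * (x * q) \<le> 0" using assms by (simp add: mult_le_0_iff)
    moreover have "K * r * (x + q) > 0" using assms by simp
    ultimately show ?thesis by linarith
  qed
  define N where "N = K * r * (x + q) - (K + r) * (x * q)"
  define X where "X = K - x" define Y where "Y = r - q"
  have X: "X > 0" "Y > 0" using assms by (auto simp: X_def Y_def)
  have A: "A = K * x / X" unfolding A_def X_def[symmetric] using X by (simp add: field_simps X_def power2_eq_square)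
  have B: "B = r * q / Y" unfolding B_def Y_def[symmetric] using X by (simp add: field_simps Y_def power2_eq_square)
  have AB: "A + B = N / (X * Y)" unfolding A B using X by (simp add: field_simps N_def X_def Y_def)
  then show "A + B > 0" using key X by (simp add: N_def)
  have cp: "c - p = N / ((K + r) * (x + q))"
    unfolding c_def p_def N_def using assms by (simp add: field_simps)
  then show "p < c" using key assms by (smt (verit) N_def divide_pos_pos mult_pos_pos)
  have N: "N > 0" using key by (simp add: N_def)
  have "A * B = K * r * (x * q) / (X * Y)" unfolding A B by (simp add: mult_ac)
  then have "A * B / (A + B) = K * r * (x * q) / N" unfolding AB using X by simp
  define s where "s = K + r" define u where "u = K * r" define v where "v = x * q"
  have suv: "s > 0" "u > 0" using assms by (auto simp: s_def u_def)
  have "A * B / (A + B) + c = u * v / N + u / s"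
    using \<open>A * B / (A + B) = K * r * (x * q) / N\<close> by (simp add: c_def s_def u_def v_def)
  also have "\<dots> = u * (s * v + N) / (N * s)" using N suv by (simp add: field_simps)
  also have "s * v + N = u * (x + q)" by (simp add: N_def s_def u_def v_def)
  finally have "(A * B / (A + B) + c) / c\<^sup>2 = u * (u * (x + q)) / (N * s) / (u / s)\<^sup>2"
    by (simp add: c_def s_def u_def)
  also have "\<dots> = (x + q) * s / N" using N suv by (simp add: power2_eq_square)
  finally have "(A * B / (A + B) + c) / c\<^sup>2 = (x + q) * (K + r) / N" by (simp add: s_def)
  then show "1 / (c - p) = (A * B / (A + B) + c) / c\<^sup>2" unfolding cp by (simp add: mult.commute)
qed

definition esquot :: "nat \<Rightarrow> 'a set \<Rightarrow> ('a \<Rightarrow> real) \<Rightarrow> real" where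
  "esquot j I x = es (Suc j) I x / es j I x"

lemma concave_on_affine:
  fixes f :: "real \<Rightarrow> real"
  assumes "concave_on J f" "a \<ge> 0"
  shows "concave_on J (\<lambda>t. a * f t + c)"
  using assms unfolding concave_on_iff
proof (intro conjI ballI allI impI)
  fix x y u v :: real
  assume *: "convex J \<and> (\<forall>x\<in>J. \<forall>y\<in>J. \<forall>u\<ge>0. \<forall>v\<ge>0. u + v = 1 \<longrightarrow> u * f x + v * f y \<le> f (u *\<^sub>R x + v *\<^sub>R y))"
    and xy: "x \<in> J" "y \<in> J" and uv: "0 \<le> u" "0 \<le> v" "u + v = 1"
  have "a * (u * f x + v * f y) \<le> a * f (u *\<^sub>R x + v *\<^sub>R y)"
    using * xy uv assms(2) by (intro mult_left_mono) auto
  moreover have "u * c + v * c = c" using uv by (simp flip: distrib_right)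
  ultimately show "u * (a * f x + c) + v * (a * f y + c) \<le> a * f (u *\<^sub>R x + v *\<^sub>R y) + c"
    by (simp add: algebra_simps)
qed auto

text \<open>Induction on \<open>j\<close>: Euler's identity writes \<open>(j+2)\<close> times the quotient as the sum of the
  parallel sums of \<open>x i\<close> with the quotient of index \<open>j\<close> in the other variables;
  \<open>parallel_transform\<close> preserves the concavity of the transformed quantities, and summing the
  differences \<open>c - p i\<close> is a harmonic sum.\<close>

lemma concave_esquot:
  fixes x :: "real \<Rightarrow> 'a \<Rightarrow> real"
  assumes "finite I" "j < card I" "0 < K" "convex J"
    and "\<And>t. t \<in> J \<Longrightarrow> garding j I (x t)" "\<And>t i. t \<in> J \<Longrightarrow> i \<in> I \<Longrightarrow> x t i < K"
    and "\<And>i. i \<in> I \<Longrightarrow> concave_on J (\<lambda>t. 1 / (K - x t i))"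
  defines "r \<equiv> K * (real (card I) - real j) / real (Suc j)"
  shows "(\<forall>t\<in>J. esquot j I (x t) < r) \<and> concave_on J (\<lambda>t. 1 / (r - esquot j I (x t)))"
  unfolding r_def using assms(1-7)
proof (induction j arbitrary: I)
  case 0
  have q: "esquot 0 I (x t) = (\<Sum>i\<in>I. x t i)" for t
    using es_euler[OF 0(1), of "x t" 0] 0(1) by (simp add: esquot_def)
  have I: "I \<noteq> {}" using 0 by auto
  have d: "K * real (card I) - (\<Sum>i\<in>I. x t i) = (\<Sum>i\<in>I. 1 / (1 / (K - x t i)))" for t
    by (simp add: sum_subtractf mult.commute)
  have "(\<Sum>i\<in>I. 1 / (1 / (K - x t i))) > 0" if "t \<in> J" for t
    using 0 I that by (intro sum_pos) auto
  then have lt: "\<forall>t\<in>J. (\<Sum>i\<in>I. x t i) < K * real (card I)" by (smt (verit) d)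
  have "concave_on J (\<lambda>t. 1 / (\<Sum>i\<in>I. 1 / (1 / (K - x t i))))"
    by (rule concave_on_harmonic_sum) (use 0 I in auto)
  then show ?case using lt unfolding q d[symmetric] by simp
next
  case (Suc j)
  define n where "n = real (card I)"
  define r' where "r' = K * (n - 1 - real j) / real (Suc j)"
  define c where "c = K * r' / (K + r')"
  define p where "p t i = x t i * es (Suc j) (I - {i}) (x t) / es (Suc j) I (x t)" for t i
  have n: "n > real (Suc j)" using Suc.prems by (simp add: n_def)
  have ci: "real (card (I - {i})) = n - 1" "card (I - {i}) > j" if "i \<in> I" for i
    using that Suc.prems by (auto simp: n_def)
  have r': "r' > 0" using n Suc.prems by (simp add: r'_def)
  have g: "garding j (I - {i}) (x t)" if "t \<in> J" "i \<in> I" for t i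
    using garding_remove[of I i j "x t"] Suc.prems that by auto
  have IH: "(\<forall>t\<in>J. esquot j (I - {i}) (x t) < r') \<and> concave_on J (\<lambda>t. 1 / (r' - esquot j (I - {i}) (x t)))"
    if "i \<in> I" for i
    using Suc.IH[of "I - {i}"] Suc.prems g that ci[OF that] by (simp add: r'_def)
  have pos: "es j (I - {i}) (x t) > 0" "es (Suc j) I (x t) > 0"
    "x t i + esquot j (I - {i}) (x t) > 0"
    "p t i = x t i * esquot j (I - {i}) (x t) / (x t i + esquot j (I - {i}) (x t))"
    if "t \<in> J" "i \<in> I" for t i
  proof -
    show 1: "es j (I - {i}) (x t) > 0" using g[OF that] by (simp add: garding_def)
    show 2: "es (Suc j) I (x t) > 0" using Suc.prems(5)[OF that(1)] by (simp add: garding_def)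
    have 3: "x t i + esquot j (I - {i}) (x t) = es (Suc j) I (x t) / es j (I - {i}) (x t)"
      unfolding es_remove[OF Suc.prems(1) that(2)] using 1 by (simp add: esquot_def field_simps)
    then show "x t i + esquot j (I - {i}) (x t) > 0" using 1 2 by simp
    show "p t i = x t i * esquot j (I - {i}) (x t) / (x t i + esquot j (I - {i}) (x t))"
      unfolding 3 using 1 2 by (simp add: p_def esquot_def)
  qed
  define A where "A i t = K\<^sup>2 * (1 / (K - x t i)) - K" for i t
  define B where "B i t = r'\<^sup>2 * (1 / (r' - esquot j (I - {i}) (x t))) - r'" for i t
  have tr: "A i t + B i t > 0" "p t i < c" "1 / (c - p t i) = (A i t * B i t / (A i t + B i t) + c) / c\<^sup>2"
    if "t \<in> J" "i \<in> I" for t i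
    using parallel_transform[of K r' "x t i" "esquot j (I - {i}) (x t)"] Suc.prems(3,6) r' IH pos(3,4) that
    by (auto simp: A_def B_def c_def)
  have cA: "concave_on J (A i)" "concave_on J (B i)" if "i \<in> I" for i
    using concave_on_affine[OF Suc.prems(7)[OF that], of "K\<^sup>2" "- K"]
      concave_on_affine[OF conjunct2[OF IH[OF that]], of "r'\<^sup>2" "- r'"]
    by (simp_all add: A_def[abs_def] B_def[abs_def])
  have cP: "concave_on J (\<lambda>t. 1 / (c - p t i))" if "i \<in> I" for i
  proof -
    have "concave_on J (\<lambda>t. A i t * B i t / (A i t + B i t))"
      using cA tr that by (intro concave_on_parallel_sum) auto
    from concave_on_affine[OF this, of "1 / c\<^sup>2" "c / c\<^sup>2"]
    have "concave_on J (\<lambda>t. 1 / c\<^sup>2 * (A i t * B i t / (A i t + B i t)) + c / c\<^sup>2)" by simp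
    then show ?thesis
      by (rule concave_on_eq_on[rotated]) (use tr that in \<open>simp add: add_divide_distrib\<close>)
  qed
  have I: "I \<noteq> {}" using Suc.prems by auto
  have nc: "n * c = real (Suc (Suc j)) * (K * (n - real (Suc j)) / real (Suc (Suc j)))"
  proof -
    have "K + r' = K * n / real (Suc j)" by (simp add: r'_def field_simps)
    then have "c = r' * real (Suc j) / n"
      using n Suc.prems(3) by (simp add: c_def del: of_nat_Suc)
    then have "c = K * (n - 1 - real j) / n" by (simp add: r'_def del: of_nat_Suc)
    moreover have "n - 1 - real j = n - real (Suc j)" by simp
    ultimately have "c = K * (n - real (Suc j)) / n" by metis
    then show ?thesis using n by (simp del: of_nat_Suc)
  qed
  have q: "real (Suc (Suc j)) * esquot (Suc j) I (x t) = (\<Sum>i\<in>I. p t i)" for t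
    using es_euler[OF Suc.prems(1), of "x t" "Suc j"]
    by (simp add: esquot_def p_def sum_divide_distrib[symmetric] del: of_nat_Suc)
  define rr where "rr = K * (n - real (Suc j)) / real (Suc (Suc j))"
  have S: "(\<Sum>i\<in>I. 1 / (1 / (c - p t i))) = real (Suc (Suc j)) * (rr - esquot (Suc j) I (x t))" for t
    using q[of t] nc by (simp add: sum_subtractf n_def[symmetric] right_diff_distrib rr_def del: of_nat_Suc)
  have "(\<Sum>i\<in>I. 1 / (1 / (c - p t i))) > 0" if "t \<in> J" for t
    using I that tr(2) Suc.prems(1) by (intro sum_pos) auto
  then have lt: "\<forall>t\<in>J. esquot (Suc j) I (x t) < rr"
    unfolding S by (auto simp: zero_less_mult_iff)
  have "concave_on J (\<lambda>t. 1 / (\<Sum>i\<in>I. 1 / (1 / (c - p t i))))"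
    by (rule concave_on_harmonic_sum) (use Suc.prems(1) I cP tr(2) in auto)
  from concave_on_affine[OF this, of "real (Suc (Suc j))" 0]
  have "concave_on J (\<lambda>t. 1 / (rr - esquot (Suc j) I (x t)))" unfolding S by simp
  then show ?case using lt by (simp add: rr_def n_def)
qed


section \<open>Second-order jets of functions of one real variable\<close>

text \<open>The value and the first two derivatives at \<open>0\<close>, with a derivative defined near \<open>0\<close> as the second
  derivative requires.  Working with such triples turns differentiation along a line into algebra.\<close>

definition jet2 :: "(real \<Rightarrow> real) \<Rightarrow> real \<Rightarrow> real \<Rightarrow> real \<Rightarrow> bool" where
  "jet2 f a b c \<longleftrightarrow> f 0 = a \<and>
     (\<exists>f'. (\<forall>\<^sub>F t in nhds 0. (f has_real_derivative f' t) (at t)) \<and> f' 0 = b \<and>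
       (f' has_real_derivative c) (at 0))"

lemma jet2I:
  assumes "f 0 = a" "\<forall>\<^sub>F t in nhds 0. (f has_real_derivative f' t) (at t)" "f' 0 = b"
    "(f' has_real_derivative c) (at 0)"
  shows "jet2 f a b c"
  using assms unfolding jet2_def by blast

lemma jet2E:
  assumes "jet2 f a b c"
  obtains f' where "f 0 = a" "\<forall>\<^sub>F t in nhds 0. (f has_real_derivative f' t) (at t)" "f' 0 = b"
    "(f' has_real_derivative c) (at 0)"
  using assms unfolding jet2_def by blast

lemma jet2_value: "jet2 f a b c \<Longrightarrow> f 0 = a" by (simp add: jet2_def)

lemma jet2_deriv: "jet2 f a b c \<Longrightarrow> (f has_real_derivative b) (at 0)"
  unfolding jet2_def by (auto dest: eventually_nhds_x_imp_x)

lemma jet2_tendsto: assumes "jet2 f a b c" shows "(f \<longlongrightarrow> a) (nhds 0)"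
proof -
  have "isCont f 0" using jet2_deriv[OF assms] by (rule DERIV_isCont)
  then show ?thesis using jet2_value[OF assms] continuous_at_imp_continuous_at_within
    by (metis isCont_def tendsto_nhds_iff)
qed

lemma jet2_const: "jet2 (\<lambda>t. c) c 0 0"
  by (rule jet2I[where f' = "\<lambda>t. 0"]) (auto intro: always_eventually)

lemma jet2_ident: "jet2 (\<lambda>t. t) 0 1 0"
  by (rule jet2I[where f' = "\<lambda>t. 1"]) (auto intro: always_eventually)

lemma jet2_add:
  assumes "jet2 f a b c" "jet2 g a' b' c'"
  shows "jet2 (\<lambda>t. f t + g t) (a + a') (b + b') (c + c')"
proof -
  obtain f' where f: "f 0 = a" "\<forall>\<^sub>F t in nhds 0. (f has_real_derivative f' t) (at t)" "f' 0 = b"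
    "(f' has_real_derivative c) (at 0)" using assms(1) by (rule jet2E)
  obtain g' where g: "g 0 = a'" "\<forall>\<^sub>F t in nhds 0. (g has_real_derivative g' t) (at t)" "g' 0 = b'"
    "(g' has_real_derivative c') (at 0)" using assms(2) by (rule jet2E)
  show ?thesis
  proof (rule jet2I[where f' = "\<lambda>t. f' t + g' t"])
    show "\<forall>\<^sub>F t in nhds 0. ((\<lambda>t. f t + g t) has_real_derivative f' t + g' t) (at t)"
      using f(2) g(2) by eventually_elim (rule DERIV_add)
  qed (use f g in \<open>auto intro!: derivative_eq_intros\<close>)
qed

lemma jet2_mult:
  assumes "jet2 f a b c" "jet2 g a' b' c'"
  shows "jet2 (\<lambda>t. f t * g t) (a * a') (a * b' + b * a') (a * c' + 2 * b * b' + c * a')"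
proof -
  obtain f' where f: "f 0 = a" "\<forall>\<^sub>F t in nhds 0. (f has_real_derivative f' t) (at t)" "f' 0 = b"
    "(f' has_real_derivative c) (at 0)" using assms(1) by (rule jet2E)
  obtain g' where g: "g 0 = a'" "\<forall>\<^sub>F t in nhds 0. (g has_real_derivative g' t) (at t)" "g' 0 = b'"
    "(g' has_real_derivative c') (at 0)" using assms(2) by (rule jet2E)
  show ?thesis
  proof (rule jet2I[where f' = "\<lambda>t. f t * g' t + f' t * g t"])
    show "\<forall>\<^sub>F t in nhds 0. ((\<lambda>t. f t * g t) has_real_derivative f t * g' t + f' t * g t) (at t)"
      using f(2) g(2) by eventually_elim (auto intro!: derivative_eq_intros)
    have "(f has_real_derivative b) (at 0)" "(g has_real_derivative b') (at 0)"
      using assms by (auto intro: jet2_deriv)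
    then show "((\<lambda>t. f t * g' t + f' t * g t) has_real_derivative a * c' + 2 * b * b' + c * a') (at 0)"
      by (auto intro!: derivative_eq_intros f(4) g(4) simp: f g algebra_simps)
  qed (use f g in auto)
qed

lemma jet2_cong:
  assumes "jet2 f a b c" "\<forall>\<^sub>F t in nhds 0. f t = g t"
  shows "jet2 g a b c"
proof -
  obtain f' where f: "f 0 = a" "\<forall>\<^sub>F t in nhds 0. (f has_real_derivative f' t) (at t)" "f' 0 = b"
    "(f' has_real_derivative c) (at 0)" using assms(1) by (rule jet2E)
  have "\<forall>\<^sub>F t in nhds 0. \<forall>\<^sub>F s in nhds t. f s = g s" using assms(2) by (simp add: eventually_eventually)
  then have "\<forall>\<^sub>F t in nhds 0. (g has_real_derivative f' t) (at t)"
    using f(2) by eventually_elim (subst (asm) DERIV_cong_ev, auto)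
  moreover have "g 0 = a" using assms(2) f(1) by (auto dest: eventually_nhds_x_imp_x)
  ultimately show ?thesis using f by (intro jet2I[where f' = f']) auto
qed

lemma jet2_eq: "jet2 f a b c \<Longrightarrow> a = a' \<Longrightarrow> b = b' \<Longrightarrow> c = c' \<Longrightarrow> jet2 f a' b' c'"
  by simp

lemma jet2_unique:
  assumes "jet2 f a b c" "jet2 f a' b' c'"
  shows "a = a' \<and> b = b' \<and> c = c'"
proof -
  obtain f' where f: "f 0 = a" "\<forall>\<^sub>F t in nhds 0. (f has_real_derivative f' t) (at t)" "f' 0 = b"
    "(f' has_real_derivative c) (at 0)" using assms(1) by (rule jet2E)
  obtain g' where g: "f 0 = a'" "\<forall>\<^sub>F t in nhds 0. (f has_real_derivative g' t) (at t)" "g' 0 = b'"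
    "(g' has_real_derivative c') (at 0)" using assms(2) by (rule jet2E)
  have ev: "\<forall>\<^sub>F t in nhds 0. f' t = g' t"
    using f(2) g(2) by eventually_elim (rule DERIV_unique)
  then have "(g' has_real_derivative c) (at 0)" using f(4) by (subst (asm) DERIV_cong_ev) auto
  then show ?thesis using f g ev by (auto dest: eventually_nhds_x_imp_x DERIV_unique)
qed

lemma jet2_cmult: "jet2 f a b c \<Longrightarrow> jet2 (\<lambda>t. k * f t) (k * a) (k * b) (k * c)"
  using jet2_mult[OF jet2_const[of k]] by (rule jet2_eq) auto

lemma jet2_uminus: "jet2 f a b c \<Longrightarrow> jet2 (\<lambda>t. - f t) (- a) (- b) (- c)"
  using jet2_cmult[of f a b c "-1"] by simp

lemma jet2_diff:
  "jet2 f a b c \<Longrightarrow> jet2 g a' b' c' \<Longrightarrow> jet2 (\<lambda>t. f t - g t) (a - a') (b - b') (c - c')"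
  using jet2_add[OF _ jet2_uminus] by fastforce

lemma jet2_sum:
  assumes "\<And>i. i \<in> I \<Longrightarrow> jet2 (f i) (a i) (b i) (c i)"
  shows "jet2 (\<lambda>t. \<Sum>i\<in>I. f i t) (\<Sum>i\<in>I. a i) (\<Sum>i\<in>I. b i) (\<Sum>i\<in>I. c i)"
  using assms by (induction I rule: infinite_finite_induct) (auto intro: jet2_const jet2_add)

lemma jet2_square: "jet2 f a b c \<Longrightarrow> jet2 (\<lambda>t. (f t)\<^sup>2) (a\<^sup>2) (2 * a * b) (2 * b\<^sup>2 + 2 * a * c)"
  unfolding power2_eq_square using jet2_mult[of f a b c f a b c] by (simp add: algebra_simps)

lemma jet2_compose:
  assumes f: "jet2 f a b c" and p: "\<forall>\<^sub>F y in nhds a. (p has_real_derivative p' y) (at y)"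
    and p2: "(p' has_real_derivative p2) (at a)"
  shows "jet2 (\<lambda>t. p (f t)) (p a) (p' a * b) (p2 * b\<^sup>2 + p' a * c)"
proof -
  obtain f' where f': "f 0 = a" "\<forall>\<^sub>F t in nhds 0. (f has_real_derivative f' t) (at t)" "f' 0 = b"
    "(f' has_real_derivative c) (at 0)" using f by (rule jet2E)
  have "\<forall>\<^sub>F t in nhds 0. (p has_real_derivative p' (f t)) (at (f t))"
    using jet2_tendsto[OF f] p by (rule filterlim_iff[THEN iffD1, rule_format])
  then have ev: "\<forall>\<^sub>F t in nhds 0. ((\<lambda>t. p (f t)) has_real_derivative p' (f t) * f' t) (at t)"
    using f'(2) by eventually_elim (rule DERIV_chain2)
  have "(f has_real_derivative b) (at 0)" using f by (rule jet2_deriv)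
  then have "((\<lambda>t. p' (f t)) has_real_derivative p2 * b) (at 0)"
    using p2 f'(1) by (intro DERIV_chain2[where f = p']) auto
  then have "((\<lambda>t. p' (f t) * f' t) has_real_derivative p2 * b\<^sup>2 + p' a * c) (at 0)"
    by (auto intro!: derivative_eq_intros f'(4) simp: f' power2_eq_square)
  with ev show ?thesis using f' by (intro jet2I[where f' = "\<lambda>t. p' (f t) * f' t"]) auto
qed

lemma jet2_ln:
  assumes "jet2 f a b c" "a > 0"
  shows "jet2 (\<lambda>t. ln (f t)) (ln a) (b / a) (c / a - (b / a)\<^sup>2)"
proof -
  have "\<forall>\<^sub>F y in nhds a. y \<in> {0<..}" by (rule eventually_nhds_in_open) (use assms(2) in auto)
  then have ev: "\<forall>\<^sub>F y in nhds a. (ln has_real_derivative inverse y) (at y)"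
    by eventually_elim (simp add: DERIV_ln)
  have d: "(inverse has_real_derivative - (inverse a)\<^sup>2) (at a)"
    using assms(2) by (auto intro!: derivative_eq_intros simp: power2_eq_square)
  show ?thesis
    by (rule jet2_eq[OF jet2_compose[OF assms(1) ev d]]) (use assms(2) in \<open>simp_all add: divide_inverse power_mult_distrib\<close>)
qed

lemma jet2_inverse:
  assumes "jet2 f a b c" "a \<noteq> 0"
  shows "jet2 (\<lambda>t. inverse (f t)) (inverse a) (- b / a\<^sup>2) (2 * b\<^sup>2 / a ^ 3 - c / a\<^sup>2)"
proof -
  have "\<forall>\<^sub>F y in nhds a. y \<noteq> 0" using assms(2) by (rule t1_space_nhds)
  then have ev: "\<forall>\<^sub>F y in nhds a. (inverse has_real_derivative - (inverse y)\<^sup>2) (at y)"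
    by eventually_elim (auto intro!: derivative_eq_intros simp: power2_eq_square)
  have d: "((\<lambda>y. - (inverse y)\<^sup>2) has_real_derivative 2 * (inverse a) ^ 3) (at a)"
    using assms(2) by (auto intro!: derivative_eq_intros simp: power2_eq_square power3_eq_cube)
  show ?thesis
    by (rule jet2_eq[OF jet2_compose[OF assms(1) ev d]]) (use assms(2) in \<open>simp_all add: divide_inverse power_inverse\<close>)
qed

lemma jet2_sqrt:
  assumes "jet2 f a b c" "a > 0"
  shows "jet2 (\<lambda>t. sqrt (f t)) (sqrt a) (b / (2 * sqrt a)) (c / (2 * sqrt a) - b\<^sup>2 / (4 * a * sqrt a))"
proof -
  have "\<forall>\<^sub>F y in nhds a. y \<in> {0<..}" by (rule eventually_nhds_in_open) (use assms(2) in auto)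
  then have ev: "\<forall>\<^sub>F y in nhds a. (sqrt has_real_derivative inverse (sqrt y) / 2) (at y)"
    by eventually_elim (simp add: DERIV_real_sqrt)
  have d: "((\<lambda>y. inverse (sqrt y) / 2) has_real_derivative - 1 / (4 * a * sqrt a)) (at a)"
    using assms(2) by (auto intro!: derivative_eq_intros simp: field_simps power2_eq_square)
  show ?thesis
    by (rule jet2_eq[OF jet2_compose[OF assms(1) ev d]]) (use assms(2) in \<open>simp_all add: field_simps\<close>)
qed

lemma jet2_reflect:
  assumes "jet2 f a b c" shows "jet2 (\<lambda>t. f (- t)) a (- b) c"
proof -
  obtain f' where f: "f 0 = a" "\<forall>\<^sub>F t in nhds 0. (f has_real_derivative f' t) (at t)" "f' 0 = b"
    "(f' has_real_derivative c) (at 0)" using assms(1) by (rule jet2E)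
  have "((\<lambda>t::real. t) \<longlongrightarrow> 0) (nhds 0)" by (rule filterlim_ident)
  from tendsto_minus[OF this] have lim: "LIM t nhds 0. - t :: real :> nhds 0" by simp
  have "\<forall>\<^sub>F t in nhds 0. (f has_real_derivative f' (- t)) (at (- t))"
    using lim f(2) by (rule filterlim_iff[THEN iffD1, rule_format])
  then have "\<forall>\<^sub>F t in nhds 0. ((\<lambda>t. f (- t)) has_real_derivative - f' (- t)) (at t)"
    by eventually_elim (subst DERIV_mirror[symmetric], simp)
  moreover have "((\<lambda>t. - f' (- t)) has_real_derivative c) (at 0)"
    using DERIV_minus[OF DERIV_mirror[THEN iffD1, of f' c 0]] f(4) by simp
  ultimately show ?thesis using f by (intro jet2I[where f' = "\<lambda>t. - f' (- t)"]) auto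
qed

text \<open>If the second derivative were positive, the derivative would be positive just to the right of \<open>0\<close>,
  and the mean value theorem would give a larger value there.\<close>

lemma jet2_local_max:
  assumes "jet2 f a b c" and mx: "\<forall>\<^sub>F t in nhds 0. f t \<le> f 0"
  shows "b = 0 \<and> c \<le> 0"
proof -
  obtain f' where f: "f 0 = a" "\<forall>\<^sub>F t in nhds 0. (f has_real_derivative f' t) (at t)" "f' 0 = b"
    "(f' has_real_derivative c) (at 0)" using assms(1) by (rule jet2E)
  have "\<forall>\<^sub>F t in nhds 0. (f has_real_derivative f' t) (at t) \<and> f t \<le> f 0"
    using f(2) mx by eventually_elim simp
  then obtain d where d: "d > 0" "\<And>t. \<bar>t\<bar> < d \<Longrightarrow> (f has_real_derivative f' t) (at t) \<and> f t \<le> f 0"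
    by (auto simp: eventually_nhds_metric dist_real_def)
  have b: "b = 0"
    by (rule DERIV_local_max[OF jet2_deriv[OF assms(1)] d(1)]) (use d in auto)
  moreover have "c \<le> 0"
  proof (rule ccontr)
    assume "\<not> c \<le> 0"
    then obtain e where e: "e > 0" "\<And>h. h > 0 \<Longrightarrow> h < e \<Longrightarrow> f' h > 0"
      using DERIV_pos_inc_right[OF f(4)] f(3) b by (auto simp: not_le)
    define h where "h = min d e / 2"
    have h: "h > 0" "h < d" "h < e" using d(1) e(1) by (auto simp: h_def)
    obtain z where z: "0 < z" "z < h" "f h - f 0 = (h - 0) * f' z"
      using MVT2[of 0 h f f'] d h by auto
    then have "f h - f 0 > 0" using e(2)[of z] h by simp
    then show False using d(2)[of h] h by simp
  qed
  ultimately show ?thesis by simp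
qed

lemma jet2_prod:
  assumes "finite S" "\<And>i. i \<in> S \<Longrightarrow> jet2 (f i) (a i) (b i) (c i)"
  shows "jet2 (\<lambda>t. \<Prod>i\<in>S. f i t) (prod a S) (\<Sum>i\<in>S. b i * prod a (S - {i}))
    ((\<Sum>i\<in>S. c i * prod a (S - {i})) + (\<Sum>i\<in>S. \<Sum>j\<in>S - {i}. b i * b j * prod a (S - {i} - {j})))"
  using assms
proof (induction S rule: finite_induct)
  case empty then show ?case using jet2_const[of 1] by simp
next
  case (insert s S)
  have s: "s \<notin> S" "finite S" using insert.hyps by auto
  have 1: "insert s S - {i} = insert s (S - {i})" if "i \<in> S" for i using that s by auto
  have 2: "(\<Sum>i\<in>insert s S. g i * prod a (insert s S - {i}))
      = g s * prod a S + a s * (\<Sum>i\<in>S. g i * prod a (S - {i}))" for g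
    using s by (simp add: 1 sum_distrib_left mult_ac)
  have 3: "(\<Sum>i\<in>insert s S. \<Sum>j\<in>insert s S - {i}. b i * b j * prod a (insert s S - {i} - {j}))
      = 2 * b s * (\<Sum>j\<in>S. b j * prod a (S - {j}))
        + a s * (\<Sum>i\<in>S. \<Sum>j\<in>S - {i}. b i * b j * prod a (S - {i} - {j}))"
  proof -
    have "(\<Sum>j\<in>insert s S - {i}. b i * b j * prod a (insert s S - {i} - {j}))
        = b s * (b i * prod a (S - {i})) + a s * (\<Sum>j\<in>S - {i}. b i * b j * prod a (S - {i} - {j}))"
      if i: "i \<in> S" for i
    proof -
      have "insert s (S - {i}) - {j} = insert s (S - {i} - {j})" if "j \<in> S - {i}" for j
        using that s by auto
      moreover have "insert s (S - {i}) - {s} = S - {i}" using s by auto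
      ultimately show ?thesis using s i by (simp add: 1 sum_distrib_left mult_ac)
    qed
    then have "(\<Sum>i\<in>S. \<Sum>j\<in>insert s S - {i}. b i * b j * prod a (insert s S - {i} - {j}))
      = b s * (\<Sum>j\<in>S. b j * prod a (S - {j}))
        + a s * (\<Sum>i\<in>S. \<Sum>j\<in>S - {i}. b i * b j * prod a (S - {i} - {j}))"
      by (simp add: sum.distrib sum_distrib_left)
    moreover have "(\<Sum>j\<in>S. b s * b j * prod a (S - {j})) = b s * (\<Sum>j\<in>S. b j * prod a (S - {j}))"
      by (simp add: sum_distrib_left mult_ac)
    ultimately show ?thesis using s by simp
  qed
  have "jet2 (\<lambda>t. f s t * (\<Prod>i\<in>S. f i t)) (a s * prod a S)
      (a s * (\<Sum>i\<in>S. b i * prod a (S - {i})) + b s * prod a S)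
      (a s * ((\<Sum>i\<in>S. c i * prod a (S - {i})) + (\<Sum>i\<in>S. \<Sum>j\<in>S - {i}. b i * b j * prod a (S - {i} - {j})))
        + 2 * b s * (\<Sum>i\<in>S. b i * prod a (S - {i})) + c s * prod a S)"
    by (rule jet2_mult) (use insert in auto)
  then show ?case unfolding 2 3 using s by (simp add: algebra_simps)
qed


section \<open>The concavity inequality at the largest entry\<close>

text \<open>Double counting of pairs \<open>(J, i)\<close> with \<open>i \<in> J\<close>.\<close>

lemma sum_subsets_remove:
  fixes g :: "'a \<Rightarrow> 'a set \<Rightarrow> real"
  assumes "finite U"
  shows "(\<Sum>J | J \<subseteq> U \<and> card J = Suc k. \<Sum>i\<in>J. g i (J - {i}))
    = (\<Sum>i\<in>U. \<Sum>J | J \<subseteq> U - {i} \<and> card J = k. g i J)"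
proof -
  have fin: "finite {J. J \<subseteq> V \<and> card J = m}" if "finite V" for V :: "'a set" and m using that by simp
  have finJ: "finite J" if "J \<subseteq> U" for J using that assms finite_subset by blast
  have "(\<Sum>J | J \<subseteq> U \<and> card J = Suc k. \<Sum>i\<in>J. g i (J - {i}))
     = (\<Sum>(J, i)\<in>Sigma {J. J \<subseteq> U \<and> card J = Suc k} (\<lambda>J. J). g i (J - {i}))"
    by (rule sum.Sigma) (use assms finJ in auto)
  also have "\<dots> = (\<Sum>(i, J)\<in>Sigma U (\<lambda>i. {J. J \<subseteq> U - {i} \<and> card J = k}). g i J)"
  proof (rule sum.reindex_bij_witness[where i = "\<lambda>(i, J). (insert i J, i)" and j = "\<lambda>(J, i). (i, J - {i})"])
    fix a assume "a \<in> Sigma U (\<lambda>i. {J. J \<subseteq> U - {i} \<and> card J = k})"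
    then obtain i J where a: "a = (i, J)" "i \<in> U" "J \<subseteq> U - {i}" "card J = k" by auto
    then have "finite J" "i \<notin> J" using assms by (auto intro: finite_subset)
    then show "(case a of (i, J) \<Rightarrow> (insert i J, i)) \<in> Sigma {J. J \<subseteq> U \<and> card J = Suc k} (\<lambda>J. J)"
      using a by auto
  qed (auto simp: finJ)
  also have "\<dots> = (\<Sum>i\<in>U. \<Sum>J | J \<subseteq> U - {i} \<and> card J = k. g i J)"
    by (rule sum.Sigma[symmetric]) (use assms in auto)
  finally show ?thesis .
qed

lemma jet2_es:
  assumes U: "finite U" and x: "\<And>i. i \<in> U \<Longrightarrow> jet2 (\<lambda>t. x t i) (a i) (b i) (c i)"
  shows "jet2 (\<lambda>t. es (Suc (Suc m)) U (x t)) (es (Suc (Suc m)) U a)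
    (\<Sum>i\<in>U. b i * es (Suc m) (U - {i}) a)
    ((\<Sum>i\<in>U. c i * es (Suc m) (U - {i}) a)
      + (\<Sum>i\<in>U. \<Sum>l\<in>U - {i}. b i * b l * es m (U - {i} - {l}) a))"
proof -
  let ?S = "{J. J \<subseteq> U \<and> card J = Suc (Suc m)}"
  have "jet2 (\<lambda>t. es (Suc (Suc m)) U (x t)) (\<Sum>J\<in>?S. prod a J)
    (\<Sum>J\<in>?S. \<Sum>i\<in>J. b i * prod a (J - {i}))
    (\<Sum>J\<in>?S. (\<Sum>i\<in>J. c i * prod a (J - {i})) + (\<Sum>i\<in>J. \<Sum>l\<in>J - {i}. b i * b l * prod a (J - {i} - {l})))"
    unfolding es_def by (intro jet2_sum jet2_prod x) (use U in \<open>auto dest: finite_subset\<close>)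
  moreover have "(\<Sum>J\<in>?S. \<Sum>i\<in>J. g i * prod a (J - {i})) = (\<Sum>i\<in>U. g i * es (Suc m) (U - {i}) a)" for g
    using sum_subsets_remove[OF U, where k = "Suc m" and g = "\<lambda>i J. g i * prod a J"]
    by (simp add: es_def sum_distrib_left)
  moreover have "(\<Sum>J\<in>?S. \<Sum>i\<in>J. \<Sum>l\<in>J - {i}. b i * b l * prod a (J - {i} - {l}))
      = (\<Sum>i\<in>U. \<Sum>l\<in>U - {i}. b i * b l * es m (U - {i} - {l}) a)"
  proof -
    have "(\<Sum>J | J \<subseteq> U - {i} \<and> card J = Suc m. \<Sum>l\<in>J. b i * b l * prod a (J - {l}))
        = (\<Sum>l\<in>U - {i}. b i * b l * es m (U - {i} - {l}) a)" for i
      using sum_subsets_remove[where U = "U - {i}" and k = m and g = "\<lambda>l J. b i * b l * prod a J"] U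
      by (simp add: es_def sum_distrib_left)
    then show ?thesis
      using sum_subsets_remove[OF U, where k = "Suc m" and g = "\<lambda>i J. \<Sum>l\<in>J. b i * b l * prod a (J - {l})"]
      by simp
  qed
  ultimately show ?thesis by (simp add: es_def sum.distrib)
qed

lemma jet2_es_exists:
  assumes U: "finite U" and x: "\<And>i. i \<in> U \<Longrightarrow> jet2 (\<lambda>t. x t i) (a i) (b i) (c i)"
  shows "\<exists>b' c'. jet2 (\<lambda>t. es m U (x t)) (es m U a) b' c'"
proof -
  have "jet2 (\<lambda>t. es m U (x t)) (\<Sum>J | J \<subseteq> U \<and> card J = m. prod a J)
    (\<Sum>J | J \<subseteq> U \<and> card J = m. \<Sum>i\<in>J. b i * prod a (J - {i}))
    (\<Sum>J | J \<subseteq> U \<and> card J = m. (\<Sum>i\<in>J. c i * prod a (J - {i})) + (\<Sum>i\<in>J. \<Sum>l\<in>J - {i}. b i * b l * prod a (J - {i} - {l})))"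
    unfolding es_def by (intro jet2_sum jet2_prod x) (use U in \<open>auto dest: finite_subset\<close>)
  then show ?thesis unfolding es_def by blast
qed

lemma concave_midpoint:
  fixes f :: "real \<Rightarrow> real"
  assumes "concave_on J f" "t \<in> J" "- t \<in> J"
  shows "f t + f (- t) \<le> 2 * f 0"
proof -
  have "(1/2) * f t + (1/2) * f (- t) \<le> f ((1/2) *\<^sub>R t + (1/2) *\<^sub>R (- t))"
    using assms unfolding concave_on_iff by (metis (no_types, opaque_lifting) field_sum_of_halves zero_le_divide_1_iff zero_le_numeral)
  then show ?thesis by simp
qed

text \<open>The Cauchy-Schwarz form of: sums of log-convex functions are log-convex.\<close>

lemma log_convex_add:
  fixes p p0 p1 s s0 s1 :: real
  assumes "p > 0" "p1 > 0" "s > 0" "s1 > 0" "p0 > 0" "s0 > 0" "p * p1 \<ge> p0\<^sup>2" "s * s1 \<ge> s0\<^sup>2"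
  shows "(p + s) * (p1 + s1) \<ge> (p0 + s0)\<^sup>2"
proof -
  have "(p0 * s0)\<^sup>2 \<le> (p * p1) * (s * s1)"
    unfolding power_mult_distrib using assms by (intro mult_mono) auto
  also have "4 * \<dots> \<le> (p * s1 + s * p1)\<^sup>2"
    using zero_le_power2[of "p * s1 - s * p1"] by (simp add: power2_eq_square algebra_simps)
  finally have "(2 * (p0 * s0))\<^sup>2 \<le> (p * s1 + s * p1)\<^sup>2" by (simp add: power2_eq_square)
  then have "2 * (p0 * s0) \<le> p * s1 + s * p1"
    by (rule power2_le_imp_le) (use assms in auto)
  then show ?thesis using assms by (simp add: power2_eq_square algebra_simps)
qed

lemma es_eq_prod_esquot:
  assumes "finite I" "\<And>l. l < j \<Longrightarrow> es l I x > 0"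
  shows "es j I x = (\<Prod>l<j. esquot l I x)"
  using assms
proof (induction j)
  case (Suc j)
  then have IH: "(\<Prod>l<j. esquot l I x) = es j I x" by auto
  have "es j I x > 0" using Suc.prems by simp
  then show ?case unfolding prod.lessThan_Suc IH by (simp add: esquot_def)
qed simp

text \<open>The level set of \<open>es (m+2)\<close> is a graph \<open>x p = h - R\<close> over the other entries.  Move these along the
  curve on which \<open>1/(K - x i)\<close> is affine with velocity \<open>\<xi> i\<close> of \<open>x i\<close>.  There \<open>h\<close>
  is the sum of \<open>c / es (m+1)\<close>, where \<open>es (m+1)\<close> is a product of concave positive quotients, and
  of a \<open>1/F\<close> with concave positive \<open>F\<close> (both by \<open>concave_esquot\<close>).  Both summands, hence \<open>h\<close>,
  satisfy \<open>h(t) h(-t) \<ge> h(0)^2\<close>, so \<open>h'^2 \<le> h h''\<close> at \<open>0\<close>.  Tangency makes \<open>h'\<close> equal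
  to \<open>\<xi> p\<close>, and differentiating the level-set equation twice expresses \<open>h''\<close> through
  the right-hand side.\<close>

lemma top_entry_inequality:
  fixes x \<xi> :: "'a \<Rightarrow> real"
  assumes I: "finite I" "p \<notin> I" and m: "Suc (Suc m) \<le> card I"
    and g: "garding (Suc (Suc m)) (insert p I) x"
    and top: "\<And>i. i \<in> I \<Longrightarrow> x i \<le> x p" and xp: "x p > 0" and d: "\<delta> > 0"
  defines "U \<equiv> insert p I"
  assumes tang: "(\<Sum>i\<in>U. \<xi> i * es (Suc m) (U - {i}) x) = 0"
  defines "r \<equiv> (x p + \<delta>) * (real (card I) - real (Suc m)) / real (Suc (Suc m))"
  shows "es (Suc m) I x * (\<xi> p)\<^sup>2 / (x p + r)
    \<le> 2 * (\<Sum>i\<in>I. (\<xi> i)\<^sup>2 * es (Suc m) (U - {i}) x / (x p + \<delta> - x i))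
      - (\<Sum>i\<in>U. \<Sum>l\<in>U - {i}. \<xi> i * \<xi> l * es m (U - {i} - {l}) x)"
proof -
  define K where "K = x p + \<delta>"
  define z where "z i = 1 / (K - x i)" for i
  have K: "K > 0" using xp d by (simp add: K_def)
  have Kx: "K - x i > 0" if "i \<in> I" for i using top[OF that] d by (simp add: K_def)
  have z: "z i > 0" if "i \<in> I" for i using Kx[OF that] by (simp add: z_def)
  \<comment> \<open>the curve with velocity \<open>\<xi> i\<close> along which \<open>1/(K - x i)\<close> is affine in \<open>t\<close>\<close>
  define X where "X t i = K - inverse (z i + t * (\<xi> i * (z i)\<^sup>2))" for t i
  have jX: "jet2 (\<lambda>t. X t i) (x i) (\<xi> i) (- 2 * (\<xi> i)\<^sup>2 / (K - x i))" if i: "i \<in> I" for i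
  proof -
    have "jet2 (\<lambda>t. z i + t * (\<xi> i * (z i)\<^sup>2)) (z i) (\<xi> i * (z i)\<^sup>2) 0"
      using jet2_add[OF jet2_const[of "z i"] jet2_mult[OF jet2_ident jet2_const[of "\<xi> i * (z i)\<^sup>2"]]] by simp
    from jet2_diff[OF jet2_const[of K] jet2_inverse[OF this]] z[OF i]
    have "jet2 (\<lambda>t. X t i) (K - inverse (z i)) (\<xi> i) (- (2 * (\<xi> i * (z i)\<^sup>2)\<^sup>2 / z i ^ 3))"
      unfolding X_def by simp
    moreover have "inverse (z i) = K - x i" by (simp add: z_def)
    moreover have "2 * (\<xi> i * (z i)\<^sup>2)\<^sup>2 / z i ^ 3 = 2 * (\<xi> i)\<^sup>2 * z i"
      using z[OF i] by (simp add: field_simps power2_eq_square power3_eq_cube)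
    ultimately show ?thesis by (simp add: z_def)
  qed
  have X0: "X 0 i = x i" if "i \<in> I" for i using jX[OF that] by (rule jet2_value)
  have gI: "garding (Suc m) I x"
    using garding_remove[of "insert p I" p "Suc m" x] I g by simp
  have ev: "\<forall>\<^sub>F t in nhds 0. (\<forall>i\<in>I. z i + t * (\<xi> i * (z i)\<^sup>2) > 0) \<and> (\<forall>l\<in>{..Suc m}. es l I (X t) > 0)"
  proof (intro eventually_conj eventually_ball_finite ballI)
    fix i assume i: "i \<in> I"
    have "((\<lambda>t. z i + t * (\<xi> i * (z i)\<^sup>2)) \<longlongrightarrow> z i) (nhds 0)"
      using jet2_tendsto[OF jet2_add[OF jet2_const[of "z i"] jet2_mult[OF jet2_ident jet2_const[of "\<xi> i * (z i)\<^sup>2"]]]] by simp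
    then show "\<forall>\<^sub>F t in nhds 0. z i + t * (\<xi> i * (z i)\<^sup>2) > 0"
      by (rule order_tendstoD) (use z[OF i] in auto)
  next
    fix l assume l: "l \<in> {..Suc m}"
    have "((\<lambda>t. es l I (X t)) \<longlongrightarrow> es l I x) (nhds 0)"
      by (intro tendsto_es jet2_tendsto[OF jX])
    then show "\<forall>\<^sub>F t in nhds 0. es l I (X t) > 0"
      by (rule order_tendstoD) (use gI l in \<open>auto simp: garding_def\<close>)
  qed (use I in auto)
  then obtain e where e: "e > 0" "\<And>t. \<bar>t\<bar> < e \<Longrightarrow> (\<forall>i\<in>I. z i + t * (\<xi> i * (z i)\<^sup>2) > 0) \<and> (\<forall>l\<in>{..Suc m}. es l I (X t) > 0)"
    by (auto simp: eventually_nhds_metric dist_real_def)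
  define J where "J = {- e<..<e}"
  have J: "convex J" by (simp add: J_def)
  have J0: "0 \<in> J" using e by (simp add: J_def)
  have Jm: "- t \<in> J" if "t \<in> J" for t using that by (auto simp: J_def)
  have inJ: "z i + t * (\<xi> i * (z i)\<^sup>2) > 0" "garding (Suc m) I (X t)" "X t i < K" if "t \<in> J" "i \<in> I" for t i
    using e(2)[of t] that by (auto simp: J_def garding_def X_def)
  have gJ: "garding (Suc m) I (X t)" if "t \<in> J" for t
    using e(2)[of t] that by (auto simp: J_def garding_def)
  have conc: "concave_on J (\<lambda>t. 1 / (K - X t i))" if "i \<in> I" for i
    unfolding concave_on_iff
  proof (intro conjI ballI allI impI)
    fix s t u v :: real
    assume uv: "u + v = 1"
    define a where "a = \<xi> i * (z i)\<^sup>2"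
    have X: "1 / (K - X t i) = z i + t * a" for t unfolding X_def a_def divide_inverse by simp
    have "u * (z i + s * a) + v * (z i + t * a) = (u + v) * z i + (u * s + v * t) * a"
      by (simp only: distrib_left distrib_right mult.assoc)
    then show "u * (1 / (K - X s i)) + v * (1 / (K - X t i)) \<le> 1 / (K - X (u *\<^sub>R s + v *\<^sub>R t) i)"
      unfolding X using uv by simp
  qed (rule J)
  define R where "R l = K * (real (card I) - real l) / real (Suc l)" for l
  define F where "F l t = 1 / (R l - esquot l I (X t))" for l t
  have F: "concave_on J (F l)" "t \<in> J \<Longrightarrow> F l t > 0" "t \<in> J \<Longrightarrow> esquot l I (X t) = R l - 1 / F l t" if "l \<le> Suc m" for l t
  proof -
    have gl: "garding l I (X t)" if "t \<in> J" for t using gJ[OF that] \<open>l \<le> Suc m\<close> by (auto simp: garding_def)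
    from concave_esquot[of I l K J X] conc inJ(3) gl J K I m that
    have *: "(\<forall>t\<in>J. esquot l I (X t) < R l) \<and> concave_on J (F l)" by (simp add: R_def F_def[abs_def])
    then show "concave_on J (F l)" by simp
    show "F l t > 0" "esquot l I (X t) = R l - 1 / F l t" if "t \<in> J"
      using * that by (auto simp: F_def)
  qed
  have Fmid: "F l t * F l (- t) \<le> (F l 0)\<^sup>2" "1 / F l t + 1 / F l (- t) \<ge> 2 / F l 0" if "l \<le> Suc m" "t \<in> J" for l t
  proof -
    define f g f0 where "f = F l t" "g = F l (- t)" "f0 = F l 0"
    have pos: "f > 0" "g > 0" "f0 > 0" using F(2)[OF that(1)] that(2) Jm J0 by (auto simp: f_g_f0_def)
    have mid: "f + g \<le> 2 * f0"
      using concave_midpoint[OF F(1)[OF that(1)] that(2) Jm[OF that(2)]] by (simp add: f_g_f0_def)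
    have "4 * (f * g) \<le> (f + g)\<^sup>2" using zero_le_power2[of "f - g"] by (simp add: power2_eq_square algebra_simps)
    also have "\<dots> \<le> (2 * f0)\<^sup>2" using mid pos by (intro power_mono) auto
    finally have fg: "f * g \<le> f0\<^sup>2" by (simp add: power2_eq_square)
    then show "F l t * F l (- t) \<le> (F l 0)\<^sup>2" by (simp add: f_g_f0_def)
    have "2 * (f * g) \<le> f0 * (f + g)"
    proof -
      have "4 * (f * g) \<le> (f + g) * (f + g)" using zero_le_power2[of "f - g"] by (simp add: power2_eq_square algebra_simps)
      also have "\<dots> \<le> (2 * f0) * (f + g)" using mid pos by (intro mult_right_mono) auto
      finally show ?thesis by simp
    qed
    then have "2 / f0 \<le> 1 / f + 1 / g" using pos by (simp add: field_simps)
    then show "1 / F l t + 1 / F l (- t) \<ge> 2 / F l 0" by (simp add: f_g_f0_def)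
  qed
  define G where "G t = es (Suc m) I (X t)" for t
  define c where "c = es (Suc (Suc m)) U x"
  \<comment> \<open>\<open>h - R (Suc m)\<close> is the \<open>p\<close>-th entry that keeps \<open>es (Suc (Suc m))\<close> equal to \<open>c\<close>: solve
    \<open>x p * es (Suc m) I + es (Suc (Suc m)) I = c\<close>\<close>
  define h where "h t = c * inverse (G t) + (R (Suc m) - esquot (Suc m) I (X t))" for t
  have c: "c > 0" using g by (simp add: c_def U_def garding_def)
  have G: "G t > 0" if "t \<in> J" for t using gJ[OF that] by (simp add: G_def garding_def)
  have Gprod: "G t = (\<Prod>l<Suc m. esquot l I (X t))" if "t \<in> J" for t
    unfolding G_def by (rule es_eq_prod_esquot) (use I gJ[OF that] in \<open>auto simp: garding_def\<close>)
  have qpos: "esquot l I (X t) > 0" if "l < Suc m" "t \<in> J" for l t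
    using gJ[OF that(2)] that(1) by (auto simp: esquot_def garding_def)
  have Gmid: "G t * G (- t) \<le> (G 0)\<^sup>2" if t: "t \<in> J" for t
  proof -
    have "esquot l I (X t) * esquot l I (X (- t)) \<le> (esquot l I (X 0))\<^sup>2" if l: "l < Suc m" for l
    proof -
      define f g f0 where "f = esquot l I (X t)" "g = esquot l I (X (- t))" "f0 = esquot l I (X 0)"
      have pos: "f > 0" "g > 0" "f0 > 0" using qpos[OF l] t Jm J0 by (auto simp: f_g_f0_def)
      have "f + g \<le> 2 * f0"
        using Fmid(2)[of l t] F(3)[of l] l t Jm[OF t] J0 by (simp add: f_g_f0_def)
      then have "(f + g)\<^sup>2 \<le> (2 * f0)\<^sup>2" using pos by (intro power_mono) auto
      moreover have "4 * (f * g) \<le> (f + g)\<^sup>2" using zero_le_power2[of "f - g"] by (simp add: power2_eq_square algebra_simps)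
      ultimately have "f * g \<le> f0\<^sup>2" by (simp add: power2_eq_square)
      then show ?thesis by (simp add: f_g_f0_def)
    qed
    then have "(\<Prod>l<Suc m. esquot l I (X t) * esquot l I (X (- t))) \<le> (\<Prod>l<Suc m. (esquot l I (X 0))\<^sup>2)"
      using qpos t Jm by (intro prod_mono) (auto intro!: mult_nonneg_nonneg less_imp_le)
    then show ?thesis unfolding Gprod[OF t] Gprod[OF Jm[OF t]] Gprod[OF J0]
      by (simp only: prod.distrib prod_power_distrib)
  qed
  have hmid: "(h 0)\<^sup>2 \<le> h t * h (- t)" if t: "t \<in> J" for t
    unfolding h_def
  proof (rule log_convex_add)
    show "c * inverse (G t) > 0" "c * inverse (G (- t)) > 0" "c * inverse (G 0) > 0"
      using c G t Jm J0 by auto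
    show "R (Suc m) - esquot (Suc m) I (X t) > 0" "R (Suc m) - esquot (Suc m) I (X (- t)) > 0"
      "R (Suc m) - esquot (Suc m) I (X 0) > 0"
      using F(2,3)[of "Suc m"] t Jm J0 by auto
    have "inverse ((G 0)\<^sup>2) \<le> inverse (G t * G (- t))"
      using Gmid[OF t] G t Jm by (intro le_imp_inverse_le) auto
    then have "c\<^sup>2 * inverse ((G 0)\<^sup>2) \<le> c\<^sup>2 * inverse (G t * G (- t))" by (intro mult_left_mono) auto
    then show "(c * inverse (G 0))\<^sup>2 \<le> c * inverse (G t) * (c * inverse (G (- t)))"
      by (simp add: power2_eq_square mult_ac)
    have "inverse ((F (Suc m) 0)\<^sup>2) \<le> inverse (F (Suc m) t * F (Suc m) (- t))"
      using Fmid(1)[of "Suc m" t] F(2)[of "Suc m"] t Jm by (intro le_imp_inverse_le) auto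
    then show "(R (Suc m) - esquot (Suc m) I (X 0))\<^sup>2
        \<le> (R (Suc m) - esquot (Suc m) I (X t)) * (R (Suc m) - esquot (Suc m) I (X (- t)))"
      using F(3)[of "Suc m"] t Jm[OF t] J0 by (simp add: divide_inverse power2_eq_square)
  qed
  obtain g1 g2 where jG: "jet2 G (es (Suc m) I x) g1 g2"
    using jet2_es_exists[where U = I and x = X and m = "Suc m", OF I(1) jX] unfolding G_def by blast
  obtain h1' h2' where jH: "jet2 (\<lambda>t. es (Suc (Suc m)) I (X t)) (es (Suc (Suc m)) I x) h1' h2'"
    using jet2_es_exists[where U = I and x = X and m = "Suc (Suc m)", OF I(1) jX] by blast
  define A where "A = es (Suc m) I x"
  have A: "A > 0" using gI by (simp add: A_def garding_def)
  have jI: "jet2 (\<lambda>t. inverse (G t)) (inverse A) (- g1 / A\<^sup>2) (2 * g1\<^sup>2 / A ^ 3 - g2 / A\<^sup>2)"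
    using jet2_inverse[OF jG] A unfolding A_def by (metis less_irrefl)
  have h_eq: "h = (\<lambda>t. c * inverse (G t) + (R (Suc m) - es (Suc (Suc m)) I (X t) * inverse (G t)))"
    by (rule ext) (simp only: h_def esquot_def divide_inverse G_def)
  note jh' = jet2_add[OF jet2_cmult[OF jI, of c] jet2_diff[OF jet2_const[of "R (Suc m)"] jet2_mult[OF jH jI]],
      folded h_eq]
  obtain h1 h2 where jh: "jet2 h (h 0) h1 h2"
    using jh' unfolding jet2_value[OF jh'] by blast
  have cU: "c = x p * A + es (Suc (Suc m)) I x"
    using es_insert[OF I, of "Suc m" x] by (simp add: c_def U_def A_def)
  have G0: "G 0 = A" using jet2_value[OF jG] by (simp add: A_def)
  have h0: "h 0 = x p + R (Suc m)"
  proof -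
    have "esquot (Suc m) I (X 0) = es (Suc (Suc m)) I x / A"
      using jet2_value[OF jH] G0 by (simp add: esquot_def G_def)
    then show ?thesis using A by (simp add: h_def G0 cU divide_inverse distrib_right)
  qed
  have Rpos: "R (Suc m) \<ge> 0" using K m by (simp add: R_def)
  have key: "h1\<^sup>2 \<le> h 0 * h2"
  proof -
    have "jet2 (\<lambda>t. - (h t * h (- t))) (- (h 0 * h 0)) 0 (- (h 0 * h2 + 2 * h1 * (- h1) + h2 * h 0))"
      using jet2_uminus[OF jet2_mult[OF jh jet2_reflect[OF jh]]] by simp
    moreover have "\<forall>\<^sub>F t in nhds 0. - (h t * h (- t)) \<le> - (h 0 * h (- 0))"
    proof -
      have "\<forall>\<^sub>F t in nhds 0. t \<in> J" by (rule eventually_nhds_in_open) (use J0 in \<open>auto simp: J_def\<close>)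
      then show ?thesis by eventually_elim (use hmid in \<open>simp add: power2_eq_square\<close>)
    qed
    ultimately have "- (h 0 * h2 + 2 * h1 * (- h1) + h2 * h 0) \<le> 0" using jet2_local_max by blast
    then show ?thesis by (simp add: power2_eq_square algebra_simps)
  qed
  define Y where "Y t i = (if i = p then h t - R (Suc m) else X t i)" for t i
  define b2 where "b2 i = (if i = p then h2 else - 2 * (\<xi> i)\<^sup>2 / (K - x i))" for i
  define b1 where "b1 i = (if i = p then h1 else \<xi> i)" for i
  have Up: "U - {p} = I" using I by (simp add: U_def)
  have finU: "finite U" using I by (simp add: U_def)
  have jY: "jet2 (\<lambda>t. Y t i) (x i) (b1 i) (b2 i)" if "i \<in> U" for i
  proof (cases "i = p")
    case True
    then show ?thesis using jet2_diff[OF jh jet2_const[of "R (Suc m)"]] by (simp add: Y_def b1_def b2_def h0)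
  next
    case False
    then show ?thesis using jX[of i] that by (simp add: Y_def b1_def b2_def U_def)
  qed
  have const: "es (Suc (Suc m)) U (Y t) = c" if t: "t \<in> J" for t
  proof -
    have "es l I (Y t) = es l I (X t)" for l using I by (intro es_cong) (auto simp: Y_def)
    then have "es (Suc (Suc m)) U (Y t) = (h t - R (Suc m)) * G t + es (Suc (Suc m)) I (X t)"
      unfolding U_def es_insert[OF I] by (simp add: G_def Y_def)
    also have "\<dots> = c" using G[OF t] by (simp add: h_def esquot_def G_def[symmetric] field_simps)
    finally show ?thesis .
  qed
  have "\<forall>\<^sub>F t in nhds 0. t \<in> J" by (rule eventually_nhds_in_open) (use J0 in \<open>auto simp: J_def\<close>)
  then have "\<forall>\<^sub>F t in nhds 0. es (Suc (Suc m)) U (Y t) = c" by eventually_elim (rule const)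
  from jet2_unique[OF jet2_cong[OF jet2_es[OF finU jY] this] jet2_const[of c]]
  have e1: "(\<Sum>i\<in>U. b1 i * es (Suc m) (U - {i}) x) = 0"
    and e2: "(\<Sum>i\<in>U. b2 i * es (Suc m) (U - {i}) x)
      + (\<Sum>i\<in>U. \<Sum>l\<in>U - {i}. b1 i * b1 l * es m (U - {i} - {l}) x) = 0" by auto
  have spl: "(\<Sum>i\<in>U. w i) = w p + (\<Sum>i\<in>I. w i)" for w :: "'a \<Rightarrow> real"
    using I by (simp add: U_def)
  have "h1 * A = \<xi> p * A"
  proof -
    have "(\<Sum>i\<in>I. b1 i * es (Suc m) (U - {i}) x) = (\<Sum>i\<in>I. \<xi> i * es (Suc m) (U - {i}) x)"
      using I by (intro sum.cong) (auto simp: b1_def)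
    then have "b1 p * A = \<xi> p * A" using e1 tang unfolding spl Up A_def by linarith
    then show ?thesis by (simp add: b1_def)
  qed
  then have h1: "h1 = \<xi> p" using A by simp
  have b1: "b1 = \<xi>" using h1 by (auto simp: b1_def)
  have "(\<Sum>i\<in>I. b2 i * es (Suc m) (U - {i}) x)
      = - 2 * (\<Sum>i\<in>I. (\<xi> i)\<^sup>2 * es (Suc m) (U - {i}) x / (K - x i))"
    unfolding sum_distrib_left using I by (intro sum.cong) (auto simp: b2_def)
  then have "h2 * A = 2 * (\<Sum>i\<in>I. (\<xi> i)\<^sup>2 * es (Suc m) (U - {i}) x / (K - x i))
      - (\<Sum>i\<in>U. \<Sum>l\<in>U - {i}. \<xi> i * \<xi> l * es m (U - {i} - {l}) x)"
    using e2 unfolding spl[of "\<lambda>i. b2 i * _ i"] Up b1 by (simp add: b2_def A_def)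
  moreover have "A * (\<xi> p)\<^sup>2 / (x p + R (Suc m)) \<le> h2 * A"
  proof -
    have pos: "h 0 > 0" using xp Rpos by (simp add: h0)
    have "(\<xi> p)\<^sup>2 / h 0 \<le> h2" using key pos by (simp add: h1 divide_le_eq mult.commute)
    from mult_left_mono[OF this less_imp_le[OF A]] show ?thesis by (simp add: h0 mult.commute)
  qed
  moreover have "R (Suc m) = r" by (simp add: R_def r_def K_def)
  ultimately show ?thesis by (simp add: A_def K_def)
qed


section \<open>Iterated directional derivatives\<close>

definition dd :: "real^'n::finite \<Rightarrow> (real^'n \<Rightarrow> real) \<Rightarrow> real^'n \<Rightarrow> real" where
  "dd v f x = (\<Sum>i\<in>UNIV. v $ i * pd i f x)"

lemma pd_cong:
  assumes "open S" "x \<in> S" "\<And>y. y \<in> S \<Longrightarrow> f y = g y"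
  shows "pd i f x = pd i g x"
proof -
  have "(f has_derivative D) (at x) \<longleftrightarrow> (g has_derivative D) (at x)" for D
    using has_derivative_transform_within_open[of f D x UNIV S g]
      has_derivative_transform_within_open[of g D x UNIV S f] assms by auto
  then show ?thesis by (simp add: pd_def frechet_derivative_def)
qed

lemma differentiable_cong_open:
  assumes "open S" "x \<in> S" "\<And>y. y \<in> S \<Longrightarrow> f y = g y"
  shows "f differentiable (at x) \<longleftrightarrow> g differentiable (at x)"
  using has_derivative_transform_within_open[of f _ x UNIV S g]
    has_derivative_transform_within_open[of g _ x UNIV S f] assms unfolding differentiable_def by auto

lemma Ck_cong:
  assumes "open S" "\<And>x. x \<in> S \<Longrightarrow> f x = g x"
  shows "Ck m S f \<longleftrightarrow> Ck m S g"
  using assms(2)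
proof (induction m arbitrary: f g)
  case 0 then show ?case by (auto intro: continuous_on_cong)
next
  case (Suc m)
  have "pd i f x = pd i g x" if "x \<in> S" for i x using pd_cong[OF assms(1) that] Suc.prems by blast
  then have "Ck m S (pd i f) \<longleftrightarrow> Ck m S (pd i g)" for i by (intro Suc.IH) auto
  moreover have "(\<forall>x\<in>S. f differentiable (at x)) \<longleftrightarrow> (\<forall>x\<in>S. g differentiable (at x))"
    using differentiable_cong_open[OF assms(1)] Suc.prems by blast
  ultimately show ?case by simp
qed

lemma Ck_less: "Ck (Suc m) S f \<Longrightarrow> Ck m S f"
proof (induction m arbitrary: f)
  case 0 then show ?case
    by (auto intro!: continuous_at_imp_continuous_on differentiable_imp_continuous_within)
next
  case (Suc m) then show ?case by (metis Ck.simps(2))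
qed

lemma Ck_continuous_on: "Ck m S f \<Longrightarrow> continuous_on S f"
  by (induction m) (auto dest: Ck_less simp del: Ck.simps(2))

lemma pd_add:
  assumes "f differentiable (at x)" "g differentiable (at x)"
  shows "pd i (\<lambda>y. f y + g y) x = pd i f x + pd i g x"
proof -
  have "((\<lambda>y. f y + g y) has_derivative (\<lambda>h. frechet_derivative f (at x) h + frechet_derivative g (at x) h)) (at x)"
    using assms by (intro has_derivative_add) (auto simp: frechet_derivative_works)
  from frechet_derivative_at[OF this] show ?thesis by (simp add: pd_def fun_eq_iff)
qed

lemma pd_cmult:
  assumes "f differentiable (at x)"
  shows "pd i (\<lambda>y. c * f y) x = c * pd i f x"
proof -
  have "((\<lambda>y. c * f y) has_derivative (\<lambda>h. c * frechet_derivative f (at x) h)) (at x)"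
    using assms by (intro has_derivative_mult_right) (auto simp: frechet_derivative_works)
  from frechet_derivative_at[OF this] show ?thesis by (simp add: pd_def fun_eq_iff)
qed

lemma Ck_add:
  assumes "open S" "Ck m S f" "Ck m S g"
  shows "Ck m S (\<lambda>x. f x + g x)"
  using assms(2,3)
proof (induction m arbitrary: f g)
  case 0 then show ?case by (auto intro: continuous_intros)
next
  case (Suc m)
  have "Ck m S (\<lambda>x. pd i f x + pd i g x)" for i using Suc by auto
  moreover have "Ck m S (\<lambda>x. pd i f x + pd i g x) \<longleftrightarrow> Ck m S (pd i (\<lambda>x. f x + g x))" for i
    using Suc.prems by (intro Ck_cong assms(1)) (auto simp: pd_add)
  ultimately show ?case using Suc.prems by auto
qed

lemma Ck_cmult:
  assumes "open S" "Ck m S f"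
  shows "Ck m S (\<lambda>x. c * f x)"
  using assms(2)
proof (induction m arbitrary: f)
  case 0 then show ?case by (auto intro: continuous_intros)
next
  case (Suc m)
  have "Ck m S (\<lambda>x. c * pd i f x)" for i using Suc by auto
  moreover have "Ck m S (\<lambda>x. c * pd i f x) \<longleftrightarrow> Ck m S (pd i (\<lambda>x. c * f x))" for i
    using Suc.prems by (intro Ck_cong assms(1)) (auto simp: pd_cmult)
  ultimately show ?case using Suc.prems by auto
qed

lemma Ck_const_zero: "Ck m S (\<lambda>x. 0)"
proof (induction m)
  case (Suc m)
  have "pd i (\<lambda>x::real^'a. 0) = (\<lambda>x. 0)" for i by (auto simp: pd_def)
  then show ?case using Suc by simp
qed simp

lemma Ck_sum:
  assumes "open S" "\<And>i. i \<in> I \<Longrightarrow> Ck m S (f i)"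
  shows "Ck m S (\<lambda>x. \<Sum>i\<in>I. f i x)"
  using assms(2) by (induction I rule: infinite_finite_induct) (auto intro: Ck_add assms(1) Ck_const_zero)

lemma Ck_dd: "open S \<Longrightarrow> Ck (Suc m) S f \<Longrightarrow> Ck m S (dd v f)"
  unfolding dd_def[abs_def] by (intro Ck_sum Ck_cmult) auto

lemma dd_cong:
  assumes "open S" "x \<in> S" "\<And>y. y \<in> S \<Longrightarrow> f y = g y"
  shows "dd v f x = dd v g x"
  unfolding dd_def using pd_cong[OF assms] by simp

lemma dd_frechet: 
  assumes "f differentiable (at x)"
  shows "frechet_derivative f (at x) v = dd v f x"
proof -
  have lin: "linear (frechet_derivative f (at x))"
    using assms by (simp add: linear_frechet_derivative)
  have "v = (\<Sum>i\<in>UNIV. v $ i *\<^sub>R axis i 1)"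
    by (simp add: vec_eq_iff axis_def if_distrib cong: if_cong)
  then have "frechet_derivative f (at x) v = frechet_derivative f (at x) (\<Sum>i\<in>UNIV. v $ i *\<^sub>R axis i 1)"
    by simp
  also have "\<dots> = (\<Sum>i\<in>UNIV. v $ i *\<^sub>R frechet_derivative f (at x) (axis i 1))"
    using lin by (simp add: linear_sum linear_scale)
  finally show ?thesis by (simp add: dd_def pd_def)
qed

lemma dd_line:
  assumes "f differentiable (at (x + t *\<^sub>R v))"
  shows "((\<lambda>t. f (x + t *\<^sub>R v)) has_real_derivative dd v f (x + t *\<^sub>R v)) (at t)"
proof -
  have "(f has_derivative frechet_derivative f (at (x + t *\<^sub>R v))) (at (x + t *\<^sub>R v))"
    using assms by (simp add: frechet_derivative_works)
  then have "((\<lambda>t. f (x + t *\<^sub>R v)) has_derivative (\<lambda>h. frechet_derivative f (at (x + t *\<^sub>R v)) (h *\<^sub>R v))) (at t)"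
    by (rule has_derivative_compose[rotated]) (auto intro!: derivative_eq_intros)
  moreover have "frechet_derivative f (at (x + t *\<^sub>R v)) (h *\<^sub>R v) = dd v f (x + t *\<^sub>R v) * h" for h
    using dd_frechet[OF assms, of "h *\<^sub>R v"] by (simp add: dd_def sum_distrib_left sum_distrib_right mult_ac)
  ultimately show ?thesis by (simp add: has_field_derivative_def)
qed

text \<open>The mean value theorem twice, first in the direction \<open>v\<close> and then in the direction \<open>w\<close>.\<close>

lemma double_difference_mean_value:
  assumes f: "Ck 2 S f" and S: "\<And>s t. 0 \<le> s \<Longrightarrow> s \<le> h \<Longrightarrow> 0 \<le> t \<Longrightarrow> t \<le> h \<Longrightarrow> x + s *\<^sub>R v + t *\<^sub>R w \<in> S"
    and h: "h > 0" and op: "open S"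
  shows "\<exists>s t. 0 \<le> s \<and> s \<le> h \<and> 0 \<le> t \<and> t \<le> h \<and>
    f (x + h *\<^sub>R v + h *\<^sub>R w) - f (x + h *\<^sub>R v) - f (x + h *\<^sub>R w) + f x
      = h * h * dd w (dd v f) (x + s *\<^sub>R v + t *\<^sub>R w)"
proof -
  have df: "f differentiable (at y)" if "y \<in> S" for y using f that by (auto simp: numeral_2_eq_2)
  have dv: "dd v f differentiable (at y)" if "y \<in> S" for y
    using Ck_dd[OF op, of 1 f v] f that by (auto simp: numeral_2_eq_2)
  define g where "g s = f (x + s *\<^sub>R v + h *\<^sub>R w) - f (x + s *\<^sub>R v)" for s
  have "(g has_real_derivative dd v f (x + s *\<^sub>R v + h *\<^sub>R w) - dd v f (x + s *\<^sub>R v)) (at s)"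
    if "0 \<le> s" "s \<le> h" for s
  proof -
    have "((\<lambda>s. f (x + h *\<^sub>R w + s *\<^sub>R v)) has_real_derivative dd v f (x + h *\<^sub>R w + s *\<^sub>R v)) (at s)"
      using df S[of s h] that h by (intro dd_line) (simp add: add_ac)
    moreover have "((\<lambda>s. f (x + s *\<^sub>R v)) has_real_derivative dd v f (x + s *\<^sub>R v)) (at s)"
      using df S[of s 0] that h by (intro dd_line) simp
    ultimately show ?thesis unfolding g_def by (intro DERIV_diff) (simp_all add: add_ac)
  qed
  from MVT2[OF h this] obtain s where s: "0 < s" "s < h"
    "g h - g 0 = (h - 0) * (dd v f (x + s *\<^sub>R v + h *\<^sub>R w) - dd v f (x + s *\<^sub>R v))" by auto
  have "((\<lambda>t. dd v f (x + s *\<^sub>R v + t *\<^sub>R w)) has_real_derivative dd w (dd v f) (x + s *\<^sub>R v + t *\<^sub>R w)) (at t)"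
    if "0 \<le> t" "t \<le> h" for t
    using dv S[of s t] that s by (intro dd_line) simp
  from MVT2[OF h this] obtain t where t: "0 < t" "t < h"
    "dd v f (x + s *\<^sub>R v + h *\<^sub>R w) - dd v f (x + s *\<^sub>R v + 0 *\<^sub>R w) = (h - 0) * dd w (dd v f) (x + s *\<^sub>R v + t *\<^sub>R w)"
    by auto
  show ?thesis
    by (rule exI[of _ s], rule exI[of _ t]) (use s t in \<open>simp add: g_def\<close>)
qed

text \<open>The double difference is symmetric in \<open>v\<close> and \<open>w\<close>, and on small parallelograms it is close to
  either mixed derivative by continuity.\<close>

lemma dd_commute:
  assumes f: "Ck 2 S f" and op: "open S" and x: "x \<in> S"
  shows "dd w (dd v f) x = dd v (dd w f) x"
proof (rule ccontr)
  let ?F = "dd w (dd v f)" and ?G = "dd v (dd w f)"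
  assume ne: "?F x \<noteq> ?G x"
  \<comment> \<open>half the difference: both mixed derivatives cannot stay this close to their values at \<open>x\<close>\<close>
  define \<epsilon> where "\<epsilon> = \<bar>?F x - ?G x\<bar> / 2"
  have e: "\<epsilon> > 0" using ne by (simp add: \<epsilon>_def)
  have "continuous_on S ?F" "continuous_on S ?G"
    using Ck_dd[OF op Ck_dd[OF op]] f by (auto simp: numeral_2_eq_2 simp del: Ck.simps(2) intro!: Ck_continuous_on[of 0])
  then have "isCont ?F x" "isCont ?G x" using op x by (auto simp: continuous_on_eq_continuous_at)
  then have "\<forall>\<^sub>F y in nhds x. dist (?F y) (?F x) < \<epsilon> \<and> dist (?G y) (?G x) < \<epsilon> \<and> y \<in> S"
    using e op x by (intro eventually_conj eventually_nhds_in_open) (auto dest!: tendstoD simp: isCont_def eventually_nhds_conv_at)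
  then obtain d where d: "d > 0" "\<And>y. dist y x < d \<Longrightarrow> dist (?F y) (?F x) < \<epsilon> \<and> dist (?G y) (?G x) < \<epsilon> \<and> y \<in> S"
    by (auto simp: eventually_nhds_metric)
  define h where "h = d / (2 * (norm v + norm w + 1))"
  have n: "norm v + norm w + 1 > 0" by (smt (verit) norm_ge_zero)
  have h: "h > 0" using d n by (simp add: h_def)
  have hb: "h * (norm v + norm w) < d"
  proof -
    have "h * (norm v + norm w + 1) = d / 2"
      using n unfolding h_def by (simp only: times_divide_eq_left mult.commute[of 2] nonzero_mult_divide_mult_cancel_right)
        (metis less_irrefl mult.commute nonzero_mult_divide_mult_cancel_left)
    then show ?thesis using h d by (simp add: algebra_simps)
  qed
  have near: "dist (x + s *\<^sub>R v + t *\<^sub>R w) x < d" if "0 \<le> s" "s \<le> h" "0 \<le> t" "t \<le> h" for s t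
  proof -
    have "dist (x + s *\<^sub>R v + t *\<^sub>R w) x \<le> norm (s *\<^sub>R v) + norm (t *\<^sub>R w)"
      by (simp add: dist_norm) (metis add.assoc add_diff_cancel_left' norm_scaleR norm_triangle_ineq real_norm_def)
    also have "\<dots> \<le> h * norm v + h * norm w" using that by (intro add_mono) (auto intro: mult_right_mono)
    finally show ?thesis using hb by (simp add: algebra_simps)
  qed
  obtain s t where st: "0 \<le> s" "s \<le> h" "0 \<le> t" "t \<le> h"
    "f (x + h *\<^sub>R v + h *\<^sub>R w) - f (x + h *\<^sub>R v) - f (x + h *\<^sub>R w) + f x = h * h * ?F (x + s *\<^sub>R v + t *\<^sub>R w)"
    using double_difference_mean_value[OF f _ h op, of x v w] near d by blast
  obtain s' t' where st': "0 \<le> s'" "s' \<le> h" "0 \<le> t'" "t' \<le> h"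
    "f (x + h *\<^sub>R w + h *\<^sub>R v) - f (x + h *\<^sub>R w) - f (x + h *\<^sub>R v) + f x = h * h * ?G (x + s' *\<^sub>R w + t' *\<^sub>R v)"
    using double_difference_mean_value[OF f _ h op, of x w v] near d
    by (smt (verit, best) add.commute add.left_commute)
  have "h * h * ?F (x + s *\<^sub>R v + t *\<^sub>R w) = h * h * ?G (x + s' *\<^sub>R w + t' *\<^sub>R v)"
  proof -
    have eq: "x + h *\<^sub>R w + h *\<^sub>R v = x + h *\<^sub>R v + h *\<^sub>R w" by simp
    show ?thesis using st(5) st'(5)[unfolded eq] by linarith
  qed
  then have "?F (x + s *\<^sub>R v + t *\<^sub>R w) = ?G (x + t' *\<^sub>R v + s' *\<^sub>R w)" using h by (simp add: add_ac)
  moreover have "dist (?F (x + s *\<^sub>R v + t *\<^sub>R w)) (?F x) < \<epsilon>" "dist (?G (x + t' *\<^sub>R v + s' *\<^sub>R w)) (?G x) < \<epsilon>"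
    using d near st st' by auto
  ultimately show False unfolding \<epsilon>_def dist_real_def by (smt (verit) field_sum_of_halves)
qed

lemma jet2_line:
  assumes f: "Ck 2 S f" and op: "open S" and x: "x \<in> S"
  shows "jet2 (\<lambda>t. f (x + t *\<^sub>R v)) (f x) (dd v f x) (dd v (dd v f) x)"
proof (rule jet2I[where f' = "\<lambda>t. dd v f (x + t *\<^sub>R v)"])
  have df: "f differentiable (at y)" if "y \<in> S" for y using f that by (auto simp: numeral_2_eq_2)
  have dv: "dd v f differentiable (at y)" if "y \<in> S" for y
    using Ck_dd[OF op, of 1 f v] f that by (auto simp: numeral_2_eq_2)
  have "((\<lambda>t. x + t *\<^sub>R v) \<longlongrightarrow> x + 0 *\<^sub>R v) (nhds 0)"
    by (intro tendsto_intros filterlim_ident)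
  then have "\<forall>\<^sub>F t in nhds 0. x + t *\<^sub>R v \<in> S" using op x by (auto elim: topological_tendstoD)
  then show "\<forall>\<^sub>F t in nhds 0. ((\<lambda>t. f (x + t *\<^sub>R v)) has_real_derivative dd v f (x + t *\<^sub>R v)) (at t)"
    by eventually_elim (intro dd_line df)
  show "((\<lambda>t. dd v f (x + t *\<^sub>R v)) has_real_derivative dd v (dd v f) x) (at 0)"
    using dd_line[of "dd v f" x 0 v] dv x by simp
qed auto


section \<open>Variations of a symmetric function of relative eigenvalues\<close>

text \<open>In the Leibniz expansion only the identity contributes to a term with one differentiated factor, and
  only the identity and the transposition of \<open>i\<close> and \<open>j\<close> to one with two.\<close>

lemma jet2_det_diagonal:
  fixes M :: "real \<Rightarrow> real^'n^'n::finite"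
  assumes jM: "\<And>i j. jet2 (\<lambda>t. M t $ i $ j) (m0 i j) (m1 i j) (m2 i j)"
    and diag: "\<And>i j. i \<noteq> j \<Longrightarrow> m0 i j = 0"
  defines "d \<equiv> \<lambda>i. m0 i i"
  shows "jet2 (\<lambda>t. det (M t)) (prod d UNIV) (\<Sum>i\<in>UNIV. m1 i i * prod d (UNIV - {i}))
    ((\<Sum>i\<in>UNIV. m2 i i * prod d (UNIV - {i}))
     + (\<Sum>i\<in>UNIV. \<Sum>j\<in>UNIV - {i}. (m1 i i * m1 j j - m1 i j * m1 j i) * prod d (UNIV - {i} - {j})))"
proof -
  let ?P = "{p. p permutes (UNIV::'n set)}"
  have finP: "finite ?P" by (rule finite_permutations) simp
  have idP: "id \<in> ?P" by (simp add: permutes_id)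
  have sum1: "(\<Sum>p\<in>?P. of_int (sign p) * (X p * (\<Prod>j\<in>UNIV - {i}. m0 j (p j)))) = X id * prod d (UNIV - {i})"
    for X :: "('n \<Rightarrow> 'n) \<Rightarrow> real" and i
  proof -
    have "(\<Prod>j\<in>UNIV - {i}. m0 j (p j)) = 0" if p: "p \<in> ?P - {id}" for p
    proof -
      have "\<exists>j. j \<noteq> i \<and> p j \<noteq> j"
      proof (rule ccontr)
        assume "\<not> ?thesis"
        then have "\<And>j. j \<noteq> i \<Longrightarrow> p j = j" by blast
        moreover have "inj p" using p by (auto intro: permutes_inj)
        ultimately have "p j = j" for j by (metis injD)
        then show False using p by (auto simp: fun_eq_iff)
      qed
      then obtain j where "j \<noteq> i" "p j \<noteq> j" by blast
      then show ?thesis by (intro prod_zero) (auto intro!: bexI[of _ j] diag)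
    qed
    then have "(\<Sum>p\<in>?P. of_int (sign p) * (X p * (\<Prod>j\<in>UNIV - {i}. m0 j (p j))))
      = (\<Sum>p\<in>{id}. of_int (sign p) * (X p * (\<Prod>j\<in>UNIV - {i}. m0 j (p j))))"
      by (intro sum.mono_neutral_right finP) (auto simp: idP permutes_id)
    then show ?thesis by (simp add: d_def sign_id)
  qed
  have sum2: "(\<Sum>p\<in>?P. of_int (sign p) * (X p * (\<Prod>l\<in>UNIV - {i} - {j}. m0 l (p l))))
      = (X id - X (Transposition.transpose i j)) * prod d (UNIV - {i} - {j})"
    if ij: "i \<noteq> j" for X :: "('n \<Rightarrow> 'n) \<Rightarrow> real" and i j
  proof -
    have tP: "Transposition.transpose i j \<in> ?P" by (simp add: permutes_swap_id)
    have tid: "Transposition.transpose i j \<noteq> id" using ij by (metis id_apply transpose_apply_first)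
    have "(\<Prod>l\<in>UNIV - {i} - {j}. m0 l (p l)) = 0" if p: "p \<in> ?P - {id, Transposition.transpose i j}" for p
    proof -
      have "\<exists>l. l \<noteq> i \<and> l \<noteq> j \<and> p l \<noteq> l"
      proof (rule ccontr)
        assume "\<not> ?thesis"
        then have "p permutes {i, j}" using p by (auto simp: permutes_def)
        then show False using p by (simp add: permutes_doubleton_iff)
      qed
      then obtain l where "l \<noteq> i" "l \<noteq> j" "p l \<noteq> l" by blast
      then show ?thesis by (intro prod_zero) (auto intro!: bexI[of _ l] diag)
    qed
    then have "(\<Sum>p\<in>?P. of_int (sign p) * (X p * (\<Prod>l\<in>UNIV - {i} - {j}. m0 l (p l))))
      = (\<Sum>p\<in>{id, Transposition.transpose i j}. of_int (sign p) * (X p * (\<Prod>l\<in>UNIV - {i} - {j}. m0 l (p l))))"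
      using tP by (intro sum.mono_neutral_right finP) (auto simp: idP permutes_id)
    also have "\<dots> = X id * prod d (UNIV - {i} - {j}) - X (Transposition.transpose i j) * (\<Prod>l\<in>UNIV - {i} - {j}. m0 l (Transposition.transpose i j l))"
      using tid ij by (simp add: sign_id sign_swap_id d_def)
    also have "(\<Prod>l\<in>UNIV - {i} - {j}. m0 l (Transposition.transpose i j l)) = prod d (UNIV - {i} - {j})"
      unfolding d_def by (intro prod.cong) auto
    finally show ?thesis by (simp only: left_diff_distrib)
  qed
  have "jet2 (\<lambda>t. det (M t)) (\<Sum>p\<in>?P. of_int (sign p) * (\<Prod>i\<in>UNIV. m0 i (p i)))
    (\<Sum>p\<in>?P. of_int (sign p) * (\<Sum>i\<in>UNIV. m1 i (p i) * (\<Prod>j\<in>UNIV - {i}. m0 j (p j))))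
    (\<Sum>p\<in>?P. of_int (sign p) * ((\<Sum>i\<in>UNIV. m2 i (p i) * (\<Prod>j\<in>UNIV - {i}. m0 j (p j)))
      + (\<Sum>i\<in>UNIV. \<Sum>j\<in>UNIV - {i}. m1 i (p i) * m1 j (p j) * (\<Prod>l\<in>UNIV - {i} - {j}. m0 l (p l)))))"
    unfolding det_def by (intro jet2_sum jet2_cmult jet2_prod jM) simp
  moreover have "(\<Sum>p\<in>?P. of_int (sign p) * (\<Prod>i\<in>UNIV. m0 i (p i))) = prod d UNIV"
  proof -
    obtain i :: 'n where True by blast
    have "(\<Prod>i\<in>UNIV. m0 i (p i)) = m0 i (p i) * (\<Prod>j\<in>UNIV - {i}. m0 j (p j))" for p
      by (rule prod.remove) auto
    then show ?thesis using sum1[of "\<lambda>p. m0 i (p i)" i] prod.remove[of UNIV i d] by (simp add: d_def)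
  qed
  moreover have "(\<Sum>p\<in>?P. of_int (sign p) * (\<Sum>i\<in>UNIV. Y i (p i) * (\<Prod>j\<in>UNIV - {i}. m0 j (p j))))
      = (\<Sum>i\<in>UNIV. Y i i * prod d (UNIV - {i}))" for Y
    unfolding sum_distrib_left using sum1[of "\<lambda>p. Y _ (p _)"] by (subst sum.swap) simp
  moreover have "(\<Sum>p\<in>?P. of_int (sign p) * (\<Sum>i\<in>UNIV. \<Sum>j\<in>UNIV - {i}. m1 i (p i) * m1 j (p j) * (\<Prod>l\<in>UNIV - {i} - {j}. m0 l (p l))))
      = (\<Sum>i\<in>UNIV. \<Sum>j\<in>UNIV - {i}. (m1 i i * m1 j j - m1 i j * m1 j i) * prod d (UNIV - {i} - {j}))"
  proof -
    have "(\<Sum>p\<in>?P. of_int (sign p) * (\<Sum>i\<in>UNIV. \<Sum>j\<in>UNIV - {i}. m1 i (p i) * m1 j (p j) * (\<Prod>l\<in>UNIV - {i} - {j}. m0 l (p l))))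
      = (\<Sum>i\<in>UNIV. \<Sum>p\<in>?P. \<Sum>j\<in>UNIV - {i}. of_int (sign p) * (m1 i (p i) * m1 j (p j) * (\<Prod>l\<in>UNIV - {i} - {j}. m0 l (p l))))"
      unfolding sum_distrib_left by (rule sum.swap)
    also have "\<dots> = (\<Sum>i\<in>UNIV. \<Sum>j\<in>UNIV - {i}. \<Sum>p\<in>?P. of_int (sign p) * (m1 i (p i) * m1 j (p j) * (\<Prod>l\<in>UNIV - {i} - {j}. m0 l (p l))))"
      by (intro sum.cong refl sum.swap)
    also have "\<dots> = (\<Sum>i\<in>UNIV. \<Sum>j\<in>UNIV - {i}. (m1 i i * m1 j j - m1 i j * m1 j i) * prod d (UNIV - {i} - {j}))"
      by (intro sum.cong refl, subst sum2) auto
    finally show ?thesis .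
  qed
  ultimately show ?thesis by (simp add: distrib_left sum.distrib)
qed

text \<open>Lagrange interpolation at \<open>0, ..., n\<close>.  It replaces the coefficients of a determinant, viewed as a
  polynomial in \<open>s\<close>, by its values, whose jets are already known.\<close>

lemma coefficient_functional:
  "\<exists>w :: nat \<Rightarrow> real. \<forall>p. degree p \<le> n \<longrightarrow> (\<Sum>l\<le>n. w l * poly p (real l)) = coeff p j"
proof -
  define L where "L l = (\<Prod>r\<in>{..n} - {l}. smult (1 / (real l - real r)) [:- real r, 1:])" for l
  have degL: "degree (L l) \<le> n" if "l \<le> n" for l
  proof -
    have "degree (L l) \<le> (\<Sum>r\<in>{..n} - {l}. degree (smult (1 / (real l - real r)) [:- real r, 1:]))"
      unfolding L_def using degree_prod_sum_le[of "{..n} - {l}" "\<lambda>r. smult (1 / (real l - real r)) [:- real r, 1:]"] by (simp only: o_def finite_Diff finite_atMost)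
    also have "\<dots> \<le> (\<Sum>r\<in>{..n} - {l}. 1)"
      by (intro sum_mono order.trans[OF degree_smult_le]) simp
    also have "\<dots> = n" using that by simp
    finally show ?thesis .
  qed
  have Lval: "poly (L l) (real i) = (if i = l then 1 else 0)" if "i \<le> n" for l i
  proof (cases "i = l")
    case True
    then show ?thesis by (auto simp: L_def poly_prod diff_divide_distrib[symmetric] intro!: prod.neutral)
  next
    case False
    then have "i \<in> {..n} - {l}" using that by simp
    then show ?thesis using False by (auto simp: L_def poly_prod intro!: prod_zero)
  qed
  have "(\<Sum>l\<le>n. coeff (L l) j * poly p (real l)) = coeff p j" if p: "degree p \<le> n" for p :: "real poly"
  proof -
    have "p = (\<Sum>l\<le>n. smult (poly p (real l)) (L l))"
    proof (rule poly_eqI_degree[where A = "real ` {..n}"])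
      have c: "card (real ` {..n}) = Suc n" by (simp add: card_image inj_on_def)
      show "card (real ` {..n}) > degree p" using p c by simp
      have "degree (\<Sum>l\<le>n. smult (poly p (real l)) (L l)) \<le> n"
        by (intro degree_sum_le order.trans[OF degree_smult_le] degL) auto
      then show "card (real ` {..n}) > degree (\<Sum>l\<le>n. smult (poly p (real l)) (L l))" using c by simp
      fix x assume "x \<in> real ` {..n}"
      then obtain i where i: "i \<le> n" "x = real i" by auto
      then show "poly p x = poly (\<Sum>l\<le>n. smult (poly p (real l)) (L l)) x"
        by (simp add: poly_sum Lval if_distrib cong: if_cong)
    qed
    then have "coeff p j = coeff (\<Sum>l\<le>n. smult (poly p (real l)) (L l)) j" by simp
    then show ?thesis by (simp add: coeff_sum mult.commute)
  qed
  then show ?thesis by (intro exI[of _ "\<lambda>l. coeff (L l) j"]) auto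
qed

lemma es_uminus: "es k I (\<lambda>i. - x i) = (-1) ^ k * es k I x"
  unfolding es_def sum_distrib_left by (intro sum.cong refl) (auto simp: prod_uminus)

text \<open>A linear functional of monic polynomials that measures the deviation of \<open>es (m+2)\<close> of the roots from
  its value at \<open>\<kappa>\<close>.  Subtracting a multiple of the top coefficient makes the functional vanish on
  the level set regardless of a scalar factor.\<close>

lemma sigma_functional:
  fixes \<kappa> :: "'n::finite \<Rightarrow> real"
  assumes m: "Suc (Suc m) \<le> CARD('n)"
  shows "\<exists>w :: nat \<Rightarrow> real. let \<Phi> = (\<lambda>f. \<Sum>l\<le>CARD('n). w l * f (real l)) in
    (\<forall>\<mu> :: 'n \<Rightarrow> real. es (Suc (Suc m)) UNIV \<mu> = es (Suc (Suc m)) UNIV \<kappa> \<longrightarrow> \<Phi> (\<lambda>s. \<Prod>i\<in>UNIV. s - \<mu> i) = 0)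
    \<and> (\<forall>a. \<Phi> (\<lambda>s. \<Prod>i\<in>UNIV - {a}. s - \<kappa> i) = - ((-1) ^ m * es (Suc m) (UNIV - {a}) \<kappa>))
    \<and> (\<forall>a b. a \<noteq> b \<longrightarrow> \<Phi> (\<lambda>s. \<Prod>i\<in>UNIV - {a} - {b}. s - \<kappa> i) = (-1) ^ m * es m (UNIV - {a} - {b}) \<kappa>)"
proof -
  define n where "n = CARD('n)"
  \<comment> \<open>\<open>(-1) ^ (m + 2) = (-1) ^ m\<close> is the sign of \<open>es (m + 2)\<close> as a coefficient of \<open>\<Prod> (s - \<mu> i)\<close>\<close>
  define c where "c = (-1) ^ m * es (Suc (Suc m)) UNIV \<kappa>"
  obtain w1 where w1: "\<And>p :: real poly. degree p \<le> n \<Longrightarrow> (\<Sum>l\<le>n. w1 l * poly p (real l)) = coeff p (n - Suc (Suc m))"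
    using coefficient_functional[of n "n - Suc (Suc m)"] by blast
  obtain w2 where w2: "\<And>p :: real poly. degree p \<le> n \<Longrightarrow> (\<Sum>l\<le>n. w2 l * poly p (real l)) = coeff p n"
    using coefficient_functional[of n n] by blast
  define \<Phi> where "\<Phi> f = (\<Sum>l\<le>n. (w1 l - c * w2 l) * f (real l))" for f :: "real \<Rightarrow> real"
  have \<Phi>: "\<Phi> (\<lambda>s. \<Prod>i\<in>J. s - \<mu> i)
      = coeff (rootpoly J (\<lambda>i. - \<mu> i)) (n - Suc (Suc m)) - c * coeff (rootpoly J (\<lambda>i. - \<mu> i)) n"
    for J :: "'n set" and \<mu>
  proof -
    have p: "(\<Prod>i\<in>J. s - \<mu> i) = poly (rootpoly J (\<lambda>i. - \<mu> i)) s" for s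
      by (simp add: rootpoly_def poly_prod)
    have d: "degree (rootpoly J (\<lambda>i. - \<mu> i)) \<le> n"
      by (simp add: degree_rootpoly n_def card_mono)
    show ?thesis unfolding \<Phi>_def p
      by (simp add: left_diff_distrib sum_subtractf mult.assoc sum_distrib_left[symmetric] w1[OF d] w2[OF d])
  qed
  have top0: "coeff (rootpoly J (\<lambda>i. - \<mu> i)) n = 0" if "card J < n" for J :: "'n set" and \<mu>
    using that by (intro coeff_eq_0) (simp add: degree_rootpoly)
  have "\<Phi> (\<lambda>s. \<Prod>i\<in>UNIV. s - \<mu> i) = 0" if "es (Suc (Suc m)) UNIV \<mu> = es (Suc (Suc m)) UNIV \<kappa>" for \<mu> :: "'n \<Rightarrow> real"
    using coeff_rootpoly[of "UNIV :: 'n set" "Suc (Suc m)" "\<lambda>i. - \<mu> i"] coeff_rootpoly[of "UNIV :: 'n set" 0 "\<lambda>i. - \<mu> i"] m that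
    by (simp add: \<Phi> n_def es_uminus c_def)
  moreover have "\<Phi> (\<lambda>s. \<Prod>i\<in>UNIV - {a}. s - \<kappa> i) = - ((-1) ^ m * es (Suc m) (UNIV - {a}) \<kappa>)" for a
  proof -
    have ca: "card (UNIV - {a}) = n - 1" by (simp add: n_def)
    have "n - Suc (Suc m) = card (UNIV - {a}) - Suc m" "Suc m \<le> card (UNIV - {a})" "card (UNIV - {a}) < n"
      using m by (auto simp: ca n_def)
    then show ?thesis using coeff_rootpoly[of "UNIV - {a}" "Suc m" "\<lambda>i. - \<kappa> i"] top0[of "UNIV - {a}"]
      by (simp add: \<Phi> es_uminus)
  qed
  moreover have "\<Phi> (\<lambda>s. \<Prod>i\<in>UNIV - {a} - {b}. s - \<kappa> i) = (-1) ^ m * es m (UNIV - {a} - {b}) \<kappa>" if "a \<noteq> b" for a b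
  proof -
    have ca: "card (UNIV - {a} - {b}) = n - 2" using that by (simp add: n_def)
    have "n - Suc (Suc m) = card (UNIV - {a} - {b}) - m" "m \<le> card (UNIV - {a} - {b})" "card (UNIV - {a} - {b}) < n"
      using m by (auto simp: ca n_def)
    then show ?thesis using coeff_rootpoly[of "UNIV - {a} - {b}" m "\<lambda>i. - \<kappa> i"] top0[of "UNIV - {a} - {b}"]
      by (simp add: \<Phi> es_uminus)
  qed
  ultimately show ?thesis unfolding \<Phi>_def n_def Let_def by (intro exI[of _ "\<lambda>l. w1 l - c * w2 l"]) blast
qed

text \<open>Derivatives of individual eigenvalues are avoided: the functional of \<open>sigma_functional\<close> applied to
  \<open>s \<mapsto> det (s G(t) - C(t))\<close> vanishes for all small \<open>t\<close>, and \<open>jet2_det_diagonal\<close> expands it.  In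
  the expansion \<open>s\<close> occurs as \<open>s - \<kappa> i\<close>, which restores a factor of the characteristic polynomial, plus
  the shifted derivatives \<open>X\<close>; the terms with the full product are annihilated by the functional.\<close>

lemma sigma_variation:
  fixes G C :: "real \<Rightarrow> real^'n^'n::finite" and \<kappa> :: "'n \<Rightarrow> real"
  assumes m: "Suc (Suc m) \<le> CARD('n)"
    and jG: "\<And>i j. jet2 (\<lambda>t. G t $ i $ j) (if i = j then 1 else 0) (G1 i j) (G2 i j)"
    and jC: "\<And>i j. jet2 (\<lambda>t. C t $ i $ j) (if i = j then \<kappa> i else 0) (C1 i j) (C2 i j)"
    and symG: "\<And>i j. G1 i j = G1 j i" and symC: "\<And>i j. C1 i j = C1 j i"
    and level: "\<forall>\<^sub>F t in nhds 0. \<exists>\<Lambda> (\<mu> :: 'n \<Rightarrow> real). (\<forall>s. det (s *\<^sub>R G t - C t) = \<Lambda> * (\<Prod>i\<in>UNIV. s - \<mu> i))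
        \<and> es (Suc (Suc m)) UNIV \<mu> = es (Suc (Suc m)) UNIV \<kappa>"
  defines "f \<equiv> \<lambda>a. es (Suc m) (UNIV - {a}) \<kappa>" and "ff \<equiv> \<lambda>a b. es m (UNIV - {a} - {b}) \<kappa>"
    and "X \<equiv> \<lambda>a b. C1 a b - \<kappa> a * G1 a b"
  shows "(\<Sum>a\<in>UNIV. f a * X a a) = 0"
    and "(\<Sum>a\<in>UNIV. f a * (C2 a a - \<kappa> a * G2 a a))
      + 2 * (\<Sum>a\<in>UNIV. \<Sum>b\<in>UNIV - {a}. f a * (X a a * G1 b b - X a b * G1 a b))
      + (\<Sum>a\<in>UNIV. \<Sum>b\<in>UNIV - {a}. ff a b * (X a a * X b b - X a b * X b a)) = 0"
proof -
  obtain w :: "nat \<Rightarrow> real" where w: "let \<Phi> = (\<lambda>f. \<Sum>l\<le>CARD('n). w l * f (real l)) in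
    (\<forall>\<mu> :: 'n \<Rightarrow> real. es (Suc (Suc m)) UNIV \<mu> = es (Suc (Suc m)) UNIV \<kappa> \<longrightarrow> \<Phi> (\<lambda>s. \<Prod>i\<in>UNIV. s - \<mu> i) = 0)
    \<and> (\<forall>a. \<Phi> (\<lambda>s. \<Prod>i\<in>UNIV - {a}. s - \<kappa> i) = - ((-1) ^ m * es (Suc m) (UNIV - {a}) \<kappa>))
    \<and> (\<forall>a b. a \<noteq> b \<longrightarrow> \<Phi> (\<lambda>s. \<Prod>i\<in>UNIV - {a} - {b}. s - \<kappa> i) = (-1) ^ m * es m (UNIV - {a} - {b}) \<kappa>)"
    using sigma_functional[OF m, of \<kappa>] by blast
  define \<Phi> where "\<Phi> f = (\<Sum>l\<le>CARD('n). w l * f (real l))" for f :: "real \<Rightarrow> real"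
  define p where "p J s = (\<Prod>i\<in>J. s - \<kappa> i)" for J s
  have \<Phi>: "\<And>\<mu> :: 'n \<Rightarrow> real. es (Suc (Suc m)) UNIV \<mu> = es (Suc (Suc m)) UNIV \<kappa> \<Longrightarrow> \<Phi> (\<lambda>s. \<Prod>i\<in>UNIV. s - \<mu> i) = 0"
    "\<And>a. \<Phi> (p (UNIV - {a})) = - ((-1) ^ m * f a)"
    "\<And>a b. a \<noteq> b \<Longrightarrow> \<Phi> (p (UNIV - {a} - {b})) = (-1) ^ m * ff a b"
    using w unfolding Let_def \<Phi>_def[symmetric] p_def[abs_def] f_def ff_def by blast+
  have \<Phi>0: "\<Phi> (p UNIV) = 0" using \<Phi>(1)[of \<kappa>] by (simp add: p_def[abs_def])
  have \<Phi>_sum: "\<Phi> (\<lambda>s. \<Sum>i\<in>I. h i s) = (\<Sum>i\<in>I. \<Phi> (h i))" for I :: "'n set" and h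
    unfolding \<Phi>_def sum_distrib_left by (rule sum.swap)
  have \<Phi>_lin: "\<Phi> (\<lambda>s. h s + k s) = \<Phi> h + \<Phi> k" "\<Phi> (\<lambda>s. h s - k s) = \<Phi> h - \<Phi> k" "\<Phi> (\<lambda>s. c * h s) = c * \<Phi> h" for h k c
    by (simp_all add: \<Phi>_def algebra_simps sum.distrib sum_subtractf sum_distrib_left)
  define D1 where "D1 s = (\<Sum>i\<in>UNIV. (s * G1 i i - C1 i i) * p (UNIV - {i}) s)" for s
  define D2 where "D2 s = (\<Sum>i\<in>UNIV. (s * G2 i i - C2 i i) * p (UNIV - {i}) s)
     + (\<Sum>i\<in>UNIV. \<Sum>j\<in>UNIV - {i}. ((s * G1 i i - C1 i i) * (s * G1 j j - C1 j j)
         - (s * G1 i j - C1 i j) * (s * G1 j i - C1 j i)) * p (UNIV - {i} - {j}) s)" for s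
  have jD: "jet2 (\<lambda>t. det (s *\<^sub>R G t - C t)) (p UNIV s) (D1 s) (D2 s)" for s
  proof -
    have *: "jet2 (\<lambda>t. (s *\<^sub>R G t - C t) $ i $ j) (if i = j then s - \<kappa> i else 0) (s * G1 i j - C1 i j) (s * G2 i j - C2 i j)" for i j
      using jet2_diff[OF jet2_cmult[OF jG, of s i j] jC[of i j]] by (cases "i = j") simp_all
    show ?thesis using jet2_det_diagonal[OF *] by (simp add: p_def D1_def D2_def)
  qed
  have "jet2 (\<lambda>t. \<Phi> (\<lambda>s. det (s *\<^sub>R G t - C t))) (\<Phi> (p UNIV)) (\<Phi> D1) (\<Phi> D2)"
    unfolding \<Phi>_def by (intro jet2_sum jet2_cmult jD)
  moreover have "\<forall>\<^sub>F t in nhds 0. \<Phi> (\<lambda>s. det (s *\<^sub>R G t - C t)) = 0"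
    using level
  proof eventually_elim
    case (elim t)
    then obtain \<Lambda> and \<mu> :: "'n \<Rightarrow> real" where "\<forall>s. det (s *\<^sub>R G t - C t) = \<Lambda> * (\<Prod>i\<in>UNIV. s - \<mu> i)"
      "es (Suc (Suc m)) UNIV \<mu> = es (Suc (Suc m)) UNIV \<kappa>" by blast
    then show ?case using \<Phi>(1) \<Phi>_lin(3) by simp
  qed
  ultimately have z: "\<Phi> D1 = 0" "\<Phi> D2 = 0"
    using jet2_unique[OF jet2_cong jet2_const[of 0]] by blast+
  have p1: "(s - \<kappa> i) * p (UNIV - {i}) s = p UNIV s" for i s
    unfolding p_def by (rule prod.remove[symmetric]) auto
  have p2: "(s - \<kappa> j) * p (UNIV - {i} - {j}) s = p (UNIV - {i}) s" if "i \<noteq> j" for i j s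
    unfolding p_def by (rule prod.remove[symmetric]) (use that in auto)
  have p2': "(s - \<kappa> i) * p (UNIV - {i} - {j}) s = p (UNIV - {j}) s" if "i \<noteq> j" for i j s
  proof -
    have "UNIV - {i} - {j} = UNIV - {j} - {i}" by auto
    then show ?thesis using p2[of j i] that by simp
  qed
  have "D1 s = (\<Sum>i\<in>UNIV. G1 i i * p UNIV s - X i i * p (UNIV - {i}) s)" for s
    unfolding D1_def
  proof (intro sum.cong refl)
    fix i show "(s * G1 i i - C1 i i) * p (UNIV - {i}) s = G1 i i * p UNIV s - X i i * p (UNIV - {i}) s"
      unfolding p1[of s i, symmetric] X_def by (simp add: algebra_simps)
  qed
  then have "D1 = (\<lambda>s. \<Sum>i\<in>UNIV. G1 i i * p UNIV s - X i i * p (UNIV - {i}) s)" by auto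
  then have "\<Phi> D1 = (-1) ^ m * (\<Sum>i\<in>UNIV. f i * X i i)"
    by (simp add: \<Phi>_sum \<Phi>_lin \<Phi>0 \<Phi>(2) sum_distrib_left mult_ac)
  then show "(\<Sum>a\<in>UNIV. f a * X a a) = 0" using z(1) by simp
  have t1: "(s * G2 i i - C2 i i) * p (UNIV - {i}) s = G2 i i * p UNIV s - (C2 i i - \<kappa> i * G2 i i) * p (UNIV - {i}) s" for i s
    unfolding p1[of s i, symmetric] by (simp add: algebra_simps)
  have t2: "((s * G1 i i - C1 i i) * (s * G1 j j - C1 j j) - (s * G1 i j - C1 i j) * (s * G1 j i - C1 j i)) * p (UNIV - {i} - {j}) s
     = (G1 i i * G1 j j - G1 i j * G1 i j) * p UNIV s - (G1 i i * X j j - G1 i j * X j i) * p (UNIV - {j}) s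
       - (G1 j j * X i i - G1 i j * X i j) * p (UNIV - {i}) s + (X i i * X j j - X i j * X j i) * p (UNIV - {i} - {j}) s"
    if "i \<noteq> j" for i j s
  proof -
    have e: "s * G1 i i - C1 i i = G1 i i * (s - \<kappa> i) - X i i" "s * G1 j j - C1 j j = G1 j j * (s - \<kappa> j) - X j j"
      "s * G1 i j - C1 i j = G1 i j * (s - \<kappa> i) - X i j" "s * G1 j i - C1 j i = G1 i j * (s - \<kappa> j) - X j i"
      using symG[of i j] by (simp_all add: X_def algebra_simps)
    show ?thesis unfolding e p1[of s i, symmetric] p2[OF that, of s, symmetric] p2'[OF that, of s, symmetric]
      by (simp add: algebra_simps)
  qed
  have "D2 s = (\<Sum>i\<in>UNIV. G2 i i * p UNIV s - (C2 i i - \<kappa> i * G2 i i) * p (UNIV - {i}) s)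
     + (\<Sum>i\<in>UNIV. \<Sum>j\<in>UNIV - {i}. (G1 i i * G1 j j - G1 i j * G1 i j) * p UNIV s - (G1 i i * X j j - G1 i j * X j i) * p (UNIV - {j}) s
       - (G1 j j * X i i - G1 i j * X i j) * p (UNIV - {i}) s + (X i i * X j j - X i j * X j i) * p (UNIV - {i} - {j}) s)" for s
    unfolding D2_def t1 by (intro arg_cong2[where f = "(+)"] sum.cong refl t2) auto
  then have D2: "D2 = (\<lambda>s. (\<Sum>i\<in>UNIV. G2 i i * p UNIV s - (C2 i i - \<kappa> i * G2 i i) * p (UNIV - {i}) s)
     + (\<Sum>i\<in>UNIV. \<Sum>j\<in>UNIV - {i}. (G1 i i * G1 j j - G1 i j * G1 i j) * p UNIV s - (G1 i i * X j j - G1 i j * X j i) * p (UNIV - {j}) s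
       - (G1 j j * X i i - G1 i j * X i j) * p (UNIV - {i}) s + (X i i * X j j - X i j * X j i) * p (UNIV - {i} - {j}) s))" by auto
  define S where "S = (-1 :: real) ^ m"
  have S: "S * S = 1" by (simp add: S_def power_mult_distrib[symmetric])
  have "\<Phi> D2 = (\<Sum>i\<in>UNIV. S * (f i * (C2 i i - \<kappa> i * G2 i i)))
     + (\<Sum>i\<in>UNIV. \<Sum>j\<in>UNIV - {i}. S * (f j * (G1 i i * X j j - G1 i j * X j i))
       + S * (f i * (G1 j j * X i i - G1 i j * X i j)) + S * (ff i j * (X i i * X j j - X i j * X j i)))"
    unfolding D2 \<Phi>_lin \<Phi>_sum
    by (intro arg_cong2[where f = "(+)"] sum.cong refl) (simp_all add: \<Phi>0 \<Phi>(2,3) S_def mult_ac)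
  also have "\<dots> = S * ((\<Sum>i\<in>UNIV. f i * (C2 i i - \<kappa> i * G2 i i))
     + ((\<Sum>i\<in>UNIV. \<Sum>j\<in>UNIV - {i}. f j * (G1 i i * X j j - G1 i j * X j i))
       + (\<Sum>i\<in>UNIV. \<Sum>j\<in>UNIV - {i}. f i * (G1 j j * X i i - G1 i j * X i j))
       + (\<Sum>i\<in>UNIV. \<Sum>j\<in>UNIV - {i}. ff i j * (X i i * X j j - X i j * X j i))))"
    by (simp only: sum.distrib sum_distrib_left[symmetric] distrib_left)
  also have "(\<Sum>i\<in>UNIV. \<Sum>j\<in>UNIV - {i}. f j * (G1 i i * X j j - G1 i j * X j i))
      = (\<Sum>i\<in>UNIV. \<Sum>j\<in>UNIV - {i}. f i * (X i i * G1 j j - X i j * G1 i j))"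
  proof -
    have sw: "(\<Sum>i\<in>UNIV. \<Sum>j\<in>UNIV - {i}. h i j) = (\<Sum>i\<in>UNIV. \<Sum>j\<in>UNIV - {i}. h j i)" for h :: "'n \<Rightarrow> 'n \<Rightarrow> real"
    proof -
      have e: "(\<Sum>i\<in>UNIV. \<Sum>j\<in>UNIV - {i}. h i j) = (\<Sum>i\<in>UNIV. \<Sum>j\<in>UNIV. h i j) - (\<Sum>i\<in>UNIV. h i i)" for h :: "'n \<Rightarrow> 'n \<Rightarrow> real"
        by (simp add: sum_diff1 sum_subtractf)
      show ?thesis unfolding e by (subst sum.swap) simp
    qed
    show ?thesis by (subst sw) (simp add: symG mult_ac)
  qed
  also have "(\<Sum>i\<in>UNIV. \<Sum>j\<in>UNIV - {i}. f i * (G1 j j * X i i - G1 i j * X i j))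
      = (\<Sum>i\<in>UNIV. \<Sum>j\<in>UNIV - {i}. f i * (X i i * G1 j j - X i j * G1 i j))"
    by (simp add: mult_ac)
  finally have "S * ((\<Sum>a\<in>UNIV. f a * (C2 a a - \<kappa> a * G2 a a))
      + 2 * (\<Sum>a\<in>UNIV. \<Sum>b\<in>UNIV - {a}. f a * (X a a * G1 b b - X a b * G1 a b))
      + (\<Sum>a\<in>UNIV. \<Sum>b\<in>UNIV - {a}. ff a b * (X a a * X b b - X a b * X b a))) = 0"
    using z(2) by (simp add: add.assoc)
  moreover have "S \<noteq> 0" by (simp add: S_def)
  ultimately show "(\<Sum>a\<in>UNIV. f a * (C2 a a - \<kappa> a * G2 a a))
      + 2 * (\<Sum>a\<in>UNIV. \<Sum>b\<in>UNIV - {a}. f a * (X a a * G1 b b - X a b * G1 a b))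
      + (\<Sum>a\<in>UNIV. \<Sum>b\<in>UNIV - {a}. ff a b * (X a a * X b b - X a b * X b a)) = 0" by simp
qed


section \<open>The weighted sum of the second-order conditions\<close>

text \<open>Third-order data of a graph at a point, in a frame of principal directions normalized by the first
  fundamental form: \<open>q\<close> is the logarithmic gradient of the height, \<open>w\<close> and \<open>\<theta> = 1/w\<close> are the slope and
  its reciprocal, \<open>f\<close> the derivatives of the curvature function, and \<open>\<tau>\<close> the first derivatives of the
  second fundamental form with the slope and the scale kept at the base point; they are totally symmetric because
  third derivatives of the height commute.  The trace condition is the differentiated equation.\<close>

locale frame_data =
  fixes \<kappa> q f :: "'n::finite \<Rightarrow> real" and \<tau> :: "'n \<Rightarrow> 'n \<Rightarrow> 'n \<Rightarrow> real" and w \<theta> :: real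
  assumes w_theta: "w * \<theta> = 1"
    and norm_q: "(\<Sum>a\<in>UNIV. (q a)\<^sup>2) = 1 - \<theta>\<^sup>2"
    and tau_sym: "\<And>a b c. \<tau> a b c = \<tau> b a c" "\<And>a b c. \<tau> a b c = \<tau> a c b"
    and tau_trace: "\<And>c. (\<Sum>a\<in>UNIV. f a * \<tau> a a c)
      = - q c * (1 - w * \<kappa> c) * ((\<Sum>a\<in>UNIV. f a * \<kappa> a) + 2 * f c * \<kappa> c)"
begin

text \<open>Here \<open>- y a\<close> is the second derivative of the normalized height in the direction \<open>a\<close>, \<open>D\<close> and \<open>L\<close> are
  the first and second derivatives of \<open>ln w\<close>, and \<open>v3\<close> the third derivatives of the normalized height.\<close>

definition "y a = 1 - w * \<kappa> a"
definition "D c = - q c * y c"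
definition "v3 a b c = w * \<tau> a b c + (if a = c then y a * q b else 0)
  + (if b = c then y b * q a else 0) + (if a = b then y a * q c else 0)"
definition "L c = (y c)\<^sup>2 * (\<theta>\<^sup>2 - (q c)\<^sup>2) + (\<Sum>a\<in>UNIV. q a * v3 a c c)"
definition "S0 = (\<Sum>a\<in>UNIV. f a)"
definition "S1 = (\<Sum>a\<in>UNIV. f a * \<kappa> a)"
definition "S2 = (\<Sum>a\<in>UNIV. f a * (\<kappa> a)\<^sup>2)"

lemma tau_trace': "(\<Sum>c\<in>UNIV. f c * \<tau> a c c) = D a * (S1 + 2 * f a * \<kappa> a)"
proof -
  have "\<tau> a c c = \<tau> c c a" for c using tau_sym(1)[of a c c] tau_sym(2)[of c a c] by simp
  then show ?thesis using tau_trace[of a] by (simp add: D_def y_def S1_def)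
qed

lemma sum_fy: "(\<Sum>a\<in>UNIV. f a * y a) = S0 - w * S1"
  by (simp add: y_def S0_def S1_def right_diff_distrib sum_subtractf sum_distrib_left mult_ac)

lemma sum_fyy: "(\<Sum>a\<in>UNIV. f a * (y a)\<^sup>2) = S0 - 2 * w * S1 + w\<^sup>2 * S2"
  by (simp add: y_def S0_def S1_def S2_def power2_eq_square algebra_simps sum.distrib sum_subtractf sum_distrib_left)

lemma trace_v3: "(\<Sum>c\<in>UNIV. f c * v3 a c c) = q a * (S0 - w * S1 * (1 + y a) + 2 * f a * (y a)\<^sup>2)"
proof -
  have "f c * v3 a c c = w * (f c * \<tau> a c c) + q a * (f c * y c) + (if a = c then 2 * (f c * (y c * q c)) else 0)" for c
    by (simp add: v3_def algebra_simps)
  then have "(\<Sum>c\<in>UNIV. f c * v3 a c c) = w * (D a * (S1 + 2 * f a * \<kappa> a)) + q a * (S0 - w * S1) + 2 * (f a * (y a * q a))"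
    by (simp add: sum.distrib sum_distrib_left[symmetric] tau_trace' sum_fy)
  also have "w * (D a * (S1 + 2 * f a * \<kappa> a)) = - q a * y a * (w * S1 + 2 * f a * (w * \<kappa> a))"
    by (simp add: D_def algebra_simps)
  also have "w * \<kappa> a = 1 - y a" by (simp add: y_def)
  finally show ?thesis by (simp add: algebra_simps power2_eq_square)
qed

lemma trace_L: "(\<Sum>c\<in>UNIV. f c * L c) = S0 + S2 + (\<Sum>a\<in>UNIV. f a * ((q a)\<^sup>2 * (y a)\<^sup>2))
    - S1 * (w + \<theta>) - w * S1 * (\<Sum>a\<in>UNIV. (q a)\<^sup>2 * y a)"
proof -
  have "(\<Sum>c\<in>UNIV. f c * L c) = (\<Sum>c\<in>UNIV. \<theta>\<^sup>2 * (f c * (y c)\<^sup>2)) - (\<Sum>c\<in>UNIV. f c * ((q c)\<^sup>2 * (y c)\<^sup>2))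
      + (\<Sum>c\<in>UNIV. \<Sum>a\<in>UNIV. f c * (q a * v3 a c c))"
    unfolding L_def by (simp add: algebra_simps sum.distrib sum_subtractf sum_distrib_left)
  also have "(\<Sum>c\<in>UNIV. \<Sum>a\<in>UNIV. f c * (q a * v3 a c c)) = (\<Sum>a\<in>UNIV. q a * (\<Sum>c\<in>UNIV. f c * v3 a c c))"
    unfolding sum_distrib_left by (subst sum.swap) (simp add: mult_ac)
  also have "\<dots> = (\<Sum>a\<in>UNIV. (q a)\<^sup>2 * (S0 - w * S1) - w * S1 * ((q a)\<^sup>2 * y a) + 2 * (f a * ((q a)\<^sup>2 * (y a)\<^sup>2)))"
    unfolding trace_v3 by (intro sum.cong refl) (simp add: algebra_simps power2_eq_square)
  also have "\<dots> = (1 - \<theta>\<^sup>2) * (S0 - w * S1) - w * S1 * (\<Sum>a\<in>UNIV. (q a)\<^sup>2 * y a) + 2 * (\<Sum>a\<in>UNIV. f a * ((q a)\<^sup>2 * (y a)\<^sup>2))"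
    by (simp add: sum.distrib sum_subtractf sum_distrib_left[symmetric] sum_distrib_right[symmetric] norm_q)
  also have "(\<Sum>c\<in>UNIV. \<theta>\<^sup>2 * (f c * (y c)\<^sup>2)) = \<theta>\<^sup>2 * (S0 - 2 * w * S1 + w\<^sup>2 * S2)"
    by (simp add: sum_distrib_left[symmetric] sum_fyy)
  also have "\<dots> = \<theta>\<^sup>2 * S0 - 2 * (w * \<theta>) * \<theta> * S1 + (w * \<theta>)\<^sup>2 * S2"
    by (simp add: algebra_simps power2_eq_square)
  also have "(1 - \<theta>\<^sup>2) * (S0 - w * S1) = S0 - w * S1 - \<theta>\<^sup>2 * S0 + (w * \<theta>) * \<theta> * S1"
    by (simp add: algebra_simps power2_eq_square)
  finally show ?thesis unfolding w_theta by (simp add: algebra_simps)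
qed

end

lemma sum_split_at: "(\<Sum>a\<in>UNIV. g a) = g p + (\<Sum>a\<in>UNIV - {p}. g a)" for g :: "'n::finite \<Rightarrow> real"
  by (rule sum.remove) auto

text \<open>The quadratic in \<open>m\<close> is largest at \<open>p + h / x\<close>; since \<open>x\<close> may vanish, the denominator is shifted by
  \<open>\<delta>\<close>, which changes the value \<open>2 h^2 / x\<close> of the completed square to at least \<open>2 h^2 / (x + \<delta>)\<close>.\<close>

lemma complete_the_square:
  fixes x h p \<delta> :: real
  assumes "x \<ge> 0" "\<delta> > 0" "m = p + h / (x + \<delta>)"
  shows "2 * p\<^sup>2 * x + 4 * p * h + 2 * (h\<^sup>2 / (x + \<delta>)) \<le> 4 * m * (h + p * x) - 2 * m\<^sup>2 * x"
proof -
  define n where "n = h / (x + \<delta>)"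
  have h: "h = n * (x + \<delta>)" using assms by (simp add: n_def)
  have e: "h\<^sup>2 / (x + \<delta>) = n * h" by (simp add: n_def power2_eq_square)
  have "4 * (p + n) * (h + p * x) - 2 * (p + n)\<^sup>2 * x - (2 * p\<^sup>2 * x + 4 * p * h + 2 * (n * h)) = 2 * \<delta> * n\<^sup>2"
    unfolding h by (simp add: algebra_simps power2_eq_square)
  moreover have "2 * \<delta> * n\<^sup>2 \<ge> 0" using assms by simp
  ultimately show ?thesis unfolding e using assms(3) n_def by simp
qed

lemma clear_denominator: "K > 0 \<Longrightarrow> K * (A / K - B - C + E) = A + K * (E - B - C)"
  "K > 0 \<Longrightarrow> K * (A / K - B - C + E + F) = A + K * (E + F - B - C)" for A B C E F K :: real
  by (simp_all add: field_simps)

text \<open>Writing \<open>\<theta>\<close>-terms through \<open>w \<theta> = 1\<close> and \<open>K = \<theta> (1 - yo)\<close>, both sides are the same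
  polynomial.  The variables \<open>F0, F1, F2\<close> and \<open>P0, P1\<close> stand for the sums of \<open>f q^2 y^j\<close> and of \<open>q^2 y^j\<close>
  over the directions other than \<open>p\<close>.\<close>

lemma balance_identity:
  fixes w \<theta> b K fo qo S0 S1 S2 F0 F1 F2 P0 P1 P2 :: real
  assumes "w * \<theta> = 1"
  defines "yo \<equiv> 1 - w * K"
  defines "Do \<equiv> - qo * yo"
  assumes "qo\<^sup>2 + P0 = 1 - \<theta>\<^sup>2"
  defines "Q \<equiv> qo\<^sup>2 * yo + P1"
  defines "Lo \<equiv> yo\<^sup>2 * (\<theta>\<^sup>2 - qo\<^sup>2) + (w * K * (b - 1) * Q + yo * (qo\<^sup>2 + P0) + 2 * qo\<^sup>2 * yo\<^sup>2)"
  defines "kG \<equiv> S1 * (Lo + Do\<^sup>2) + 4 * Do\<^sup>2 * fo * K + 2 * fo * K * yo\<^sup>2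
     + 2 * (fo * K * qo\<^sup>2 * (w * K * (b - 1) * yo + yo + 2 * yo\<^sup>2) + \<theta> * (w * K * (b - 1) * (F1 - F2) + yo * (F0 - F1)))"
  defines "T2 \<equiv> - 4 * b * fo * K * Do\<^sup>2 - 2 * yo * ((b - 1) * K * F1 + \<theta> * yo * (F0 - F1) + fo * K * ((b - 1) * P1 + yo * P0))"
  defines "T3 \<equiv> - 2 * b * K * (F1 - fo * P1) * (1 + w * K) + 2 * K * ((F1 - yo * F0) - fo * (P1 - yo * P0))"
  defines "E \<equiv> - (b - 1)\<^sup>2 * (fo * Do\<^sup>2 + F2) + 4 * (b - 1) * fo * Do\<^sup>2"
  shows "kG + T2 + T3 + fo * (2 * w * K\<^sup>2 * (P1 - yo * P0) - 4 * w * b * K\<^sup>2 * P1)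
     + 2 * qo\<^sup>2 * (K * S0 - S1) + 4 * qo * fo * (b * K * Do)
     + K * (E - 2 * qo * (qo * (S0 - w * S1 * (1 + yo) + 2 * fo * yo\<^sup>2)) + (b - 1) * (S0 + S2 + (fo * (qo\<^sup>2 * yo\<^sup>2) + F2) - S1 * (w + \<theta>) - w * S1 * Q))
     - 2 * K * fo * yo\<^sup>2
    = S1 * (1 + K\<^sup>2) - K * (S0 + S2) + K * (- b\<^sup>2 * (fo * (qo\<^sup>2 * yo\<^sup>2) + F2) + b * (S0 + S2 - S1 * (w + \<theta>))
       + b * (fo * (qo\<^sup>2 * yo\<^sup>2) + F2) - 2 * b * (fo * (qo\<^sup>2 * yo) + F1))"
proof -
  have P0: "P0 = 1 - \<theta>\<^sup>2 - qo\<^sup>2" using assms by simp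
  have K: "K = \<theta> * (1 - yo)" using \<open>w * \<theta> = 1\<close> by (simp add: yo_def)
    (metis mult.assoc mult.commute mult_1)
  show ?thesis
    unfolding kG_def T2_def T3_def E_def Lo_def Q_def Do_def P0
    using \<open>w * \<theta> = 1\<close> K by algebra
qed

context frame_data
begin

text \<open>The second-order conditions at a maximum, weighted with \<open>f c\<close> and added.  The fourth derivatives \<open>C2\<close>
  are eliminated with the second variation of the equation.  The directions \<open>m\<close> are chosen so that they
  complete squares: \<open>max_p\<close> is used with the rotation \<open>- w K q a + h a / (x a + \<delta>)\<close>, and \<open>max_c\<close> with
  \<open>q p + \<xi> c / (x c + \<delta>)\<close>, where \<open>x a = \<kappa> p - \<kappa> a\<close>.  The third derivatives that survive are the
  \<open>\<xi> a\<close>, and they enter only through the quadratic form of \<open>top_entry_inequality\<close>; everything else is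
  explicit in \<open>\<kappa>\<close> and \<open>q\<close>.\<close>

lemma balance:
  fixes p :: 'n and b \<delta> :: real and ff :: "'n \<Rightarrow> 'n \<Rightarrow> real" and C2 :: "'n \<Rightarrow> real"
  assumes K: "\<kappa> p > 0" and top: "\<And>a. \<kappa> a \<le> \<kappa> p" and \<delta>: "\<delta> > 0"
    and f: "\<And>a. f a \<ge> 0" and ff: "\<And>a b. a \<noteq> b \<Longrightarrow> ff a b \<ge> 0" "\<And>a b. ff a b = ff b a"
    and fdiff: "\<And>a. a \<noteq> p \<Longrightarrow> f a - f p = (\<kappa> p - \<kappa> a) * ff p a"
    and first: "\<And>c. \<tau> p p c = \<kappa> p * ((if c = p then 2 * D p else 0) - (b - 1) * D c)"
  defines "G1 \<equiv> \<lambda>a c. (if a = c then D p else 0) - (if a = p then y p * q c else 0) - (if c = p then y p * q a else 0)"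
  defines "G2 \<equiv> \<lambda>c. (L p + (D p)\<^sup>2) + 2 * D p * (if c = p then 2 * D p else 0)
      + (if c = p then 2 * (y p)\<^sup>2 else 0) + 2 * q c * v3 c p p"
  defines "X \<equiv> \<lambda>a c. \<tau> a c p - \<kappa> a * G1 a c"
  assumes var1: "(\<Sum>a\<in>UNIV. f a * X a a) = 0"
    and var2: "(\<Sum>a\<in>UNIV. f a * (C2 a - \<kappa> a * G2 a))
      + 2 * (\<Sum>a\<in>UNIV. \<Sum>c\<in>UNIV - {a}. f a * (X a a * G1 c c - X a c * G1 a c))
      + (\<Sum>a\<in>UNIV. \<Sum>c\<in>UNIV - {a}. ff a c * (X a a * X c c - X a c * X c a)) = 0"
    and max_p: "\<And>m. (C2 p + 4 * (\<Sum>a\<in>UNIV - {p}. m a * \<tau> p a p) + 2 * (\<Sum>a\<in>UNIV - {p}. (m a)\<^sup>2 * \<kappa> a)) / \<kappa> p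
      - (\<tau> p p p / \<kappa> p)\<^sup>2 - (2 * (\<Sum>a\<in>UNIV - {p}. (m a)\<^sup>2) + 2 * (y p)\<^sup>2 - 4 * y p * (\<Sum>a\<in>UNIV - {p}. m a * q a) + 2 * q p * v3 p p p)
      + (2 * D p)\<^sup>2 + (b - 1) * L p \<le> 0"
    and max_c: "\<And>c M. c \<noteq> p \<Longrightarrow> (C2 c + 4 * M * \<tau> p c c + 2 * M\<^sup>2 * \<kappa> c) / \<kappa> p
      - (\<tau> p p c / \<kappa> p)\<^sup>2 - (2 * M\<^sup>2 - 4 * q p * M * y c + 2 * q p * v3 p c c) + (b - 1) * L c \<le> 0"
  defines "\<xi> \<equiv> \<lambda>a. X a a" and "h \<equiv> \<lambda>a. b * \<kappa> p * q a * y a"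
  shows "2 * (\<Sum>a\<in>UNIV - {p}. f a * ((\<xi> a)\<^sup>2 / (\<kappa> p - \<kappa> a + \<delta>))) - (\<Sum>a\<in>UNIV. \<Sum>c\<in>UNIV - {a}. ff a c * (\<xi> a * \<xi> c))
      + 2 * (\<Sum>a\<in>UNIV - {p}. f a * ((h a)\<^sup>2 / (\<kappa> p - \<kappa> a + \<delta>))) + S1 * (1 + (\<kappa> p)\<^sup>2) - \<kappa> p * (S0 + S2)
    + \<kappa> p * (- b\<^sup>2 * (\<Sum>a\<in>UNIV. f a * ((q a)\<^sup>2 * (y a)\<^sup>2)) + b * (S0 + S2 - S1 * (w + \<theta>))
       + (\<Sum>a\<in>UNIV. f a * ((q a)\<^sup>2 * (b * (y a)\<^sup>2 - 2 * b * y a)))) \<le> 0"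
    and "\<xi> p = b * \<kappa> p * q p * y p"
proof -
  let ?K = "\<kappa> p" and ?U = "UNIV - {p}"
  define x where "x a = \<kappa> p - \<kappa> a" for a
  have x0: "x a \<ge> 0" for a using top[of a] by (simp add: x_def)
  have xd: "x a + \<delta> > 0" for a using x0[of a] \<delta> by simp
  have kth: "\<kappa> a = \<theta> * (1 - y a)" for a
  proof -
    have "\<theta> * (1 - y a) = (w * \<theta>) * \<kappa> a" by (simp add: y_def algebra_simps)
    then show ?thesis using w_theta by simp
  qed
  have wx: "w * x a = y a - y p" for a by (simp add: x_def y_def algebra_simps)
  show xip: "\<xi> p = b * \<kappa> p * q p * y p"
    using first[of p] by (simp add: \<xi>_def X_def G1_def D_def algebra_simps)
  have tppa: "\<tau> p p a = (b - 1) * \<kappa> p * q a * y a" if "a \<noteq> p" for a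
    using first[of a] that by (simp add: D_def)
  have tapp: "\<tau> a p p = \<tau> p p a" "\<tau> p a p = \<tau> p p a" for a using tau_sym by metis+
  have xi: "\<tau> a a p = \<xi> a + \<kappa> a * D p" "\<tau> p a a = \<xi> a + \<kappa> a * D p" if "a \<noteq> p" for a
  proof -
    have "\<tau> p a a = \<tau> a a p" using tau_sym by metis
    then show "\<tau> a a p = \<xi> a + \<kappa> a * D p" "\<tau> p a a = \<xi> a + \<kappa> a * D p"
      using that by (simp_all add: \<xi>_def X_def G1_def)
  qed
  have Xpa: "X p a = h a - w * ?K * q a * x a" if "a \<noteq> p" for a
  proof -
    have "X p a = ?K * q a * ((b - 1) * y a + y p)" using that tppa[OF that]
      by (simp add: X_def G1_def tapp algebra_simps)
    also have "\<dots> = h a - ?K * q a * (y a - y p)" by (simp add: h_def algebra_simps)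
    finally show ?thesis by (simp add: wx[symmetric] mult_ac)
  qed
  have Xap: "X a p = q a * ((b - 1) * ?K * y a + \<kappa> a * y p)" if "a \<noteq> p" for a
    using that tppa[OF that] by (simp add: X_def G1_def tapp algebra_simps)
  have Xap': "X a p = h a - q a * x a" if "a \<noteq> p" for a
  proof -
    have "h a - q a * x a = q a * ((b - 1) * ?K * y a + (?K * y a - x a))" by (simp add: h_def algebra_simps)
    also have "?K * y a - x a = \<kappa> a * y p" by (simp add: y_def x_def algebra_simps)
    finally show ?thesis using Xap[OF that] by simp
  qed
  \<comment> \<open>Every term is a combination of these sums over the directions other than \<open>p\<close>, so that the final cancellation
    is the polynomial identity \<open>balance_identity\<close>.\<close>
  define F0 where "F0 = (\<Sum>a\<in>?U. f a * (q a)\<^sup>2)"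
  define F1 where "F1 = (\<Sum>a\<in>?U. f a * ((q a)\<^sup>2 * y a))"
  define F2 where "F2 = (\<Sum>a\<in>?U. f a * ((q a)\<^sup>2 * (y a)\<^sup>2))"
  define P0 where "P0 = (\<Sum>a\<in>?U. (q a)\<^sup>2)"
  define P1 where "P1 = (\<Sum>a\<in>?U. (q a)\<^sup>2 * y a)"
  define XX where "XX = (\<Sum>a\<in>?U. f a * ((\<xi> a)\<^sup>2 / (x a + \<delta>)))"
  define HH where "HH = (\<Sum>a\<in>?U. f a * ((h a)\<^sup>2 / (x a + \<delta>)))"
  define H1 where "H1 = (\<Sum>a\<in>?U. ff p a * (h a)\<^sup>2)"
  define H2 where "H2 = (\<Sum>a\<in>?U. f p * ((h a)\<^sup>2 / (x a + \<delta>)))"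
  define ffxx where "ffxx = (\<Sum>a\<in>UNIV. \<Sum>c\<in>UNIV - {a}. ff a c * (\<xi> a * \<xi> c))"
  define Q where "Q = (q p)\<^sup>2 * y p + P1"
  have qP0: "(q p)\<^sup>2 + P0 = 1 - \<theta>\<^sup>2" unfolding P0_def norm_q[symmetric] by (rule sum_split_at[symmetric])
  have Qs: "(\<Sum>a\<in>UNIV. (q a)\<^sup>2 * y a) = Q" unfolding Q_def P1_def by (rule sum_split_at)
  have q2y2: "(\<Sum>a\<in>UNIV. f a * ((q a)\<^sup>2 * (y a)\<^sup>2)) = f p * ((q p)\<^sup>2 * (y p)\<^sup>2) + F2"
    unfolding F2_def by (rule sum_split_at)
  have q2y: "(\<Sum>a\<in>UNIV. f a * ((q a)\<^sup>2 * y a)) = f p * ((q p)\<^sup>2 * y p) + F1"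
    unfolding F1_def by (rule sum_split_at)
  have sum_h: "HH \<le> H1 + H2"
  proof -
    have "f a * ((h a)\<^sup>2 / (x a + \<delta>)) \<le> ff p a * (h a)\<^sup>2 + f p * ((h a)\<^sup>2 / (x a + \<delta>))" if a: "a \<in> ?U" for a
    proof -
      have "f a - f p \<le> (x a + \<delta>) * ff p a"
        using fdiff[of a] ff(1)[of p a] a \<delta> by (auto simp: x_def algebra_simps)
      then have "(f a - f p) * ((h a)\<^sup>2 / (x a + \<delta>)) \<le> ((x a + \<delta>) * ff p a) * ((h a)\<^sup>2 / (x a + \<delta>))"
        using xd[of a] by (intro mult_right_mono) auto
      also have "\<dots> = ff p a * (h a)\<^sup>2" using xd[of a] by (simp add: field_simps)
      finally show ?thesis unfolding left_diff_distrib by linarith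
    qed
    then show ?thesis unfolding HH_def H1_def H2_def sum.distrib[symmetric] by (rule sum_mono)
  qed
  \<comment> \<open>The first-order condition determines \<open>\<tau> p p a\<close> and hence \<open>v3 a p p\<close>, so the trace of \<open>f \<kappa> G2\<close> contains no
    undetermined third derivatives.\<close>
  define Lo where "Lo = (y p)\<^sup>2 * (\<theta>\<^sup>2 - (q p)\<^sup>2) + (w * ?K * (b - 1) * Q + y p * ((q p)\<^sup>2 + P0) + 2 * (q p)\<^sup>2 * (y p)\<^sup>2)"
  have v3pp: "q a * v3 a p p = (q a)\<^sup>2 * (w * ?K * (b - 1) * y a + y p) + (if a = p then 2 * (q p)\<^sup>2 * (y p)\<^sup>2 else 0)" for a
  proof (cases "a = p")
    case True
    have wK: "w * ?K = 1 - y p" by (simp add: y_def)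
    have "w * \<tau> p p p = (w * ?K) * (- 2 * q p * y p + (b - 1) * (q p * y p))"
      unfolding first[of p] by (simp add: D_def algebra_simps)
    moreover have "q p * v3 p p p = q p * (w * \<tau> p p p) + 3 * y p * (q p)\<^sup>2"
      by (simp add: v3_def algebra_simps power2_eq_square)
    ultimately have "q p * v3 p p p = q p * ((1 - y p) * (- 2 * q p * y p + (b - 1) * (q p * y p))) + 3 * y p * (q p)\<^sup>2"
      by (simp only: wK)
    then show ?thesis unfolding True wK by (simp add: algebra_simps power2_eq_square)
  next
    case False
    then show ?thesis unfolding v3_def tapp(1)[of a] tppa[OF False] by (simp add: power2_eq_square algebra_simps)
  qed
  have Lp: "L p = Lo"
  proof -
    have "(\<Sum>a\<in>UNIV. q a * v3 a p p) = w * ?K * (b - 1) * (\<Sum>a\<in>UNIV. (q a)\<^sup>2 * y a) + y p * (\<Sum>a\<in>UNIV. (q a)\<^sup>2) + 2 * (q p)\<^sup>2 * (y p)\<^sup>2"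
    proof -
      have "q a * v3 a p p = w * ?K * (b - 1) * ((q a)\<^sup>2 * y a) + y p * (q a)\<^sup>2 + (if a = p then 2 * (q p)\<^sup>2 * (y p)\<^sup>2 else 0)" for a
        unfolding v3pp by (simp add: distrib_left mult_ac)
      then show ?thesis by (simp add: sum.distrib sum_distrib_left[symmetric])
    qed
    then show ?thesis unfolding L_def Lo_def Qs norm_q qP0 by simp
  qed
  have kG: "(\<Sum>a\<in>UNIV. f a * (\<kappa> a * G2 a)) = S1 * (Lo + (D p)\<^sup>2) + 4 * (D p)\<^sup>2 * f p * ?K + 2 * f p * ?K * (y p)\<^sup>2
     + 2 * (f p * ?K * (q p)\<^sup>2 * (w * ?K * (b - 1) * y p + y p + 2 * (y p)\<^sup>2) + \<theta> * (w * ?K * (b - 1) * (F1 - F2) + y p * (F0 - F1)))"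
  proof -
    have "f a * (\<kappa> a * G2 a) = f a * \<kappa> a * (L p + (D p)\<^sup>2) + (if a = p then 4 * (D p)\<^sup>2 * f p * ?K + 2 * f p * ?K * (y p)\<^sup>2 else 0)
      + 2 * (f a * \<kappa> a * (q a * v3 a p p))" for a
      by (simp add: G2_def algebra_simps power2_eq_square)
    then have "(\<Sum>a\<in>UNIV. f a * (\<kappa> a * G2 a)) = S1 * (L p + (D p)\<^sup>2) + (4 * (D p)\<^sup>2 * f p * ?K + 2 * f p * ?K * (y p)\<^sup>2)
      + 2 * (\<Sum>a\<in>UNIV. f a * \<kappa> a * (q a * v3 a p p))"
      by (simp add: sum.distrib S1_def sum_distrib_right[symmetric] sum_distrib_left[symmetric])
    also have "(\<Sum>a\<in>UNIV. f a * \<kappa> a * (q a * v3 a p p)) = f p * ?K * (q p * v3 p p p) + (\<Sum>a\<in>?U. f a * \<kappa> a * (q a * v3 a p p))"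
      by (rule sum_split_at)
    also have "(\<Sum>a\<in>?U. f a * \<kappa> a * (q a * v3 a p p)) = (\<Sum>a\<in>?U. \<theta> * (w * ?K * (b - 1) * (f a * ((q a)\<^sup>2 * y a) - f a * ((q a)\<^sup>2 * (y a)\<^sup>2))
       + y p * (f a * (q a)\<^sup>2 - f a * ((q a)\<^sup>2 * y a))))"
      unfolding v3pp by (intro sum.cong refl) (simp add: kth[of _] algebra_simps power2_eq_square)
    also have "\<dots> = \<theta> * (w * ?K * (b - 1) * (F1 - F2) + y p * (F0 - F1))"
      by (simp add: F0_def F1_def F2_def sum.distrib sum_subtractf sum_distrib_left[symmetric])
    finally show ?thesis unfolding v3pp Lp by (simp add: algebra_simps power2_eq_square)
  qed
  have T2: "(\<Sum>a\<in>UNIV. \<Sum>c\<in>UNIV - {a}. f a * (X a a * G1 c c - X a c * G1 a c))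
     = - (- 2 * b * f p * ?K * (D p)\<^sup>2 - y p * ((b - 1) * ?K * F1 + \<theta> * y p * (F0 - F1) + f p * ?K * ((b - 1) * P1 + y p * P0)))"
  proof -
    define tr where "tr = (\<Sum>c\<in>UNIV. G1 c c)"
    have "(\<Sum>a\<in>UNIV. \<Sum>c\<in>UNIV - {a}. f a * (X a a * G1 c c - X a c * G1 a c))
      = (\<Sum>a\<in>UNIV. f a * X a a * tr - (\<Sum>c\<in>UNIV. f a * (X a c * G1 a c)))"
      by (intro sum.cong refl) (simp add: sum_diff1 tr_def algebra_simps sum_subtractf sum_distrib_left)
    also have "\<dots> = - (\<Sum>a\<in>UNIV. \<Sum>c\<in>UNIV. f a * (X a c * G1 a c))"
      using var1 by (simp add: sum_subtractf sum_distrib_right[symmetric])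
    also have "(\<Sum>a\<in>UNIV. \<Sum>c\<in>UNIV. f a * (X a c * G1 a c))
       = (\<Sum>a\<in>UNIV. f a * X a a * D p - f a * X a p * (y p * q a) - (if a = p then f p * (y p * (\<Sum>c\<in>UNIV. X p c * q c)) else 0))"
    proof (intro sum.cong refl)
      fix a
      have "f a * (X a c * G1 a c) = (if a = c then f a * X a c * D p else 0) - (if c = p then f a * X a c * (y p * q a) else 0)
         - (if a = p then f p * (y p * (X p c * q c)) else 0)" for c
        by (auto simp: G1_def algebra_simps)
      then show "(\<Sum>c\<in>UNIV. f a * (X a c * G1 a c)) = f a * X a a * D p - f a * X a p * (y p * q a) - (if a = p then f p * (y p * (\<Sum>c\<in>UNIV. X p c * q c)) else 0)"
        by (simp add: sum_subtractf sum_distrib_left)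
    qed
    also have "\<dots> = (\<Sum>a\<in>UNIV. f a * X a a) * D p - y p * ((\<Sum>a\<in>UNIV. f a * X a p * q a) + f p * (\<Sum>c\<in>UNIV. X p c * q c))"
      by (simp add: sum_subtractf sum_distrib_right[symmetric]) (simp add: sum_distrib_left algebra_simps)
    also have "(\<Sum>a\<in>UNIV. f a * X a p * q a) = f p * X p p * q p + (\<Sum>a\<in>?U. f a * X a p * q a)"
      by (rule sum_split_at)
    also have "(\<Sum>c\<in>UNIV. X p c * q c) = X p p * q p + (\<Sum>c\<in>?U. X p c * q c)"
      by (rule sum_split_at)
    also have "(\<Sum>a\<in>?U. f a * X a p * q a) = (\<Sum>a\<in>?U. (b - 1) * ?K * (f a * ((q a)\<^sup>2 * y a)) + \<theta> * y p * (f a * (q a)\<^sup>2 - f a * ((q a)\<^sup>2 * y a)))"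
    proof (intro sum.cong refl)
      fix a assume "a \<in> ?U"
      then have e: "X a p = q a * ((b - 1) * ?K * y a + \<theta> * (1 - y a) * y p)" using Xap kth[of a] by simp
      show "f a * X a p * q a = (b - 1) * ?K * (f a * ((q a)\<^sup>2 * y a)) + \<theta> * y p * (f a * (q a)\<^sup>2 - f a * ((q a)\<^sup>2 * y a))"
        unfolding e by (simp add: algebra_simps power2_eq_square)
    qed
    also have "\<dots> = (b - 1) * ?K * F1 + \<theta> * y p * (F0 - F1)"
      by (simp add: F0_def F1_def sum.distrib sum_subtractf sum_distrib_left[symmetric])
    also have "(\<Sum>c\<in>?U. X p c * q c) = (\<Sum>c\<in>?U. ?K * ((b - 1) * ((q c)\<^sup>2 * y c) + y p * (q c)\<^sup>2))"
    proof (intro sum.cong refl)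
      fix c assume "c \<in> ?U"
      then have e: "X p c = h c - ?K * q c * (w * x c)" using Xpa by simp
      show "X p c * q c = ?K * ((b - 1) * ((q c)\<^sup>2 * y c) + y p * (q c)\<^sup>2)"
        unfolding e wx h_def by (simp add: algebra_simps power2_eq_square)
    qed
    also have "\<dots> = ?K * ((b - 1) * P1 + y p * P0)"
      by (simp add: P0_def P1_def sum.distrib sum_distrib_left[symmetric])
    also have "X p p = b * ?K * q p * y p" using xip by (simp add: \<xi>_def)
    finally show ?thesis unfolding var1 by (simp add: D_def algebra_simps power2_eq_square)
  qed
  have T3: "(\<Sum>a\<in>UNIV. \<Sum>c\<in>UNIV - {a}. ff a c * (X a a * X c c - X a c * X c a))
     \<le> ffxx - 2 * H1 - (- 2 * b * ?K * (F1 - f p * P1) * (1 + w * ?K) + 2 * ?K * ((F1 - y p * F0) - f p * (P1 - y p * P0)))"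
  proof -
    have sym: "X a c = X c a" if "a \<noteq> p" "c \<noteq> p" for a c
      using that tau_sym(1)[of a c p] by (cases "a = c") (simp_all add: X_def G1_def)
    have in_row: "(\<Sum>c\<in>UNIV - {a}. ff a c * (X a c * X c a)) \<ge> ff a p * (X a p * X p a)" if a: "a \<in> ?U" for a
    proof -
      have "(\<Sum>c\<in>UNIV - {a}. ff a c * (X a c * X c a)) = ff a p * (X a p * X p a) + (\<Sum>c\<in>UNIV - {a} - {p}. ff a c * (X a c * X c a))"
        using a by (intro sum.remove) auto
      moreover have "(\<Sum>c\<in>UNIV - {a} - {p}. ff a c * (X a c * X c a)) \<ge> 0"
      proof (rule sum_nonneg)
        fix c assume c: "c \<in> UNIV - {a} - {p}"
        then have "X a c * X c a = X a c * X a c" using sym[of c a] a by simp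
        then show "ff a c * (X a c * X c a) \<ge> 0" using ff(1)[of a c] c by auto
      qed
      ultimately show ?thesis by simp
    qed
    have "(\<Sum>a\<in>UNIV. \<Sum>c\<in>UNIV - {a}. ff a c * (X a c * X c a))
      = (\<Sum>c\<in>?U. ff p c * (X p c * X c p)) + (\<Sum>a\<in>?U. \<Sum>c\<in>UNIV - {a}. ff a c * (X a c * X c a))"
      by (rule sum_split_at)
    also have "\<dots> \<ge> (\<Sum>c\<in>?U. ff p c * (X p c * X c p)) + (\<Sum>a\<in>?U. ff a p * (X a p * X p a))"
      by (intro add_left_mono sum_mono in_row)
    also have "(\<Sum>a\<in>?U. ff a p * (X a p * X p a)) = (\<Sum>c\<in>?U. ff p c * (X p c * X c p))"
      by (intro sum.cong refl) (simp add: ff(2)[of _ p] mult_ac)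
    finally have A: "(\<Sum>a\<in>UNIV. \<Sum>c\<in>UNIV - {a}. ff a c * (X a c * X c a)) \<ge> 2 * (\<Sum>c\<in>?U. ff p c * (X p c * X c p))"
      by simp
    have "(\<Sum>c\<in>?U. ff p c * (X p c * X c p)) = (\<Sum>c\<in>?U. ff p c * (h c)\<^sup>2
       - b * ?K * (1 + w * ?K) * (f c * ((q c)\<^sup>2 * y c) - f p * ((q c)\<^sup>2 * y c))
       + ?K * ((f c * ((q c)\<^sup>2 * y c) - y p * (f c * (q c)\<^sup>2)) - f p * ((q c)\<^sup>2 * y c - y p * (q c)\<^sup>2)))"
    proof (intro sum.cong refl)
      fix c assume c: "c \<in> ?U"
      have fd: "f c - f p = x c * ff p c" using fdiff[of c] c by (simp add: x_def)
      have "ff p c * (X p c * X c p) = ff p c * ((h c - w * ?K * q c * x c) * (h c - q c * x c))"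
        using Xpa[of c] Xap'[of c] c by simp
      also have "\<dots> = ff p c * (h c)\<^sup>2 - (x c * ff p c) * (q c * h c) * (1 + w * ?K) + (x c * ff p c) * ?K * (q c)\<^sup>2 * (w * x c)"
        by (simp add: algebra_simps power2_eq_square)
      also have "\<dots> = ff p c * (h c)\<^sup>2
       - b * ?K * (1 + w * ?K) * (f c * ((q c)\<^sup>2 * y c) - f p * ((q c)\<^sup>2 * y c))
       + ?K * ((f c * ((q c)\<^sup>2 * y c) - y p * (f c * (q c)\<^sup>2)) - f p * ((q c)\<^sup>2 * y c - y p * (q c)\<^sup>2))"
        unfolding fd[symmetric] wx h_def by (simp add: algebra_simps power2_eq_square)
      finally show "ff p c * (X p c * X c p) = ff p c * (h c)\<^sup>2
       - b * ?K * (1 + w * ?K) * (f c * ((q c)\<^sup>2 * y c) - f p * ((q c)\<^sup>2 * y c))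
       + ?K * ((f c * ((q c)\<^sup>2 * y c) - y p * (f c * (q c)\<^sup>2)) - f p * ((q c)\<^sup>2 * y c - y p * (q c)\<^sup>2))" .
    qed
    also have "\<dots> = H1 - b * ?K * (1 + w * ?K) * (F1 - f p * P1) + ?K * ((F1 - y p * F0) - f p * (P1 - y p * P0))"
      by (simp add: H1_def F0_def F1_def P0_def P1_def sum.distrib sum_subtractf sum_distrib_left[symmetric])
    finally have B: "(\<Sum>c\<in>?U. ff p c * (X p c * X c p)) = H1 - b * ?K * (1 + w * ?K) * (F1 - f p * P1) + ?K * ((F1 - y p * F0) - f p * (P1 - y p * P0))" .
    have "(\<Sum>a\<in>UNIV. \<Sum>c\<in>UNIV - {a}. ff a c * (X a a * X c c - X a c * X c a)) = ffxx - (\<Sum>a\<in>UNIV. \<Sum>c\<in>UNIV - {a}. ff a c * (X a c * X c a))"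
      by (simp add: ffxx_def \<xi>_def right_diff_distrib sum_subtractf)
    then show ?thesis using A unfolding B by (simp add: algebra_simps)
  qed
  \<comment> \<open>Multiplied by \<open>\<kappa> p\<close>, each maximum condition is quadratic in the rotation; the terms of first order in it
    combine to \<open>h a - w * \<kappa> p * q a * x a\<close> and to \<open>\<xi> c + q p * x c\<close>.\<close>
  define e where "e c = ?K * (- (\<tau> p p c / ?K)\<^sup>2 - 2 * q p * v3 p c c + (b - 1) * L c)" for c
  have Mp: "C2 p + (2 * w * ?K\<^sup>2 * (P1 - y p * P0) - 4 * w * b * ?K\<^sup>2 * P1 + 2 * (\<Sum>a\<in>?U. (h a)\<^sup>2 / (x a + \<delta>)))
      + e p + 4 * ?K * (D p)\<^sup>2 - 2 * ?K * (y p)\<^sup>2 \<le> 0"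
  proof -
    \<comment> \<open>vertex of the quadratic in \<open>m a\<close>, up to the shift by \<open>\<delta>\<close>\<close>
    define m where "m a = - w * ?K * q a + h a / (x a + \<delta>)" for a
    have "C2 p + 4 * (\<Sum>a\<in>?U. m a * \<tau> p a p) + 2 * (\<Sum>a\<in>?U. (m a)\<^sup>2 * \<kappa> a)
        - ?K * (2 * (\<Sum>a\<in>?U. (m a)\<^sup>2) - 4 * y p * (\<Sum>a\<in>?U. m a * q a)) + e p + 4 * ?K * (D p)\<^sup>2 - 2 * ?K * (y p)\<^sup>2
       = ?K * ((C2 p + 4 * (\<Sum>a\<in>UNIV - {p}. m a * \<tau> p a p) + 2 * (\<Sum>a\<in>UNIV - {p}. (m a)\<^sup>2 * \<kappa> a)) / \<kappa> p
      - (\<tau> p p p / \<kappa> p)\<^sup>2 - (2 * (\<Sum>a\<in>UNIV - {p}. (m a)\<^sup>2) + 2 * (y p)\<^sup>2 - 4 * y p * (\<Sum>a\<in>UNIV - {p}. m a * q a) + 2 * q p * v3 p p p)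
      + (2 * D p)\<^sup>2 + (b - 1) * L p)" (is "?l = _ * ?r")
      unfolding e_def clear_denominator[OF K] by (simp add: ring_distribs power2_eq_square)
    also have "\<dots> \<le> 0" using max_p[of m] K by (simp add: mult_le_0_iff)
    finally have "?l \<le> 0" .
    moreover have "4 * (\<Sum>a\<in>?U. m a * \<tau> p a p) + 2 * (\<Sum>a\<in>?U. (m a)\<^sup>2 * \<kappa> a) - ?K * (2 * (\<Sum>a\<in>?U. (m a)\<^sup>2) - 4 * y p * (\<Sum>a\<in>?U. m a * q a))
      = (\<Sum>a\<in>?U. 4 * m a * (h a + (- w * ?K * q a) * x a) - 2 * (m a)\<^sup>2 * x a)"
    proof -
      have "4 * m a * (h a + (- w * ?K * q a) * x a) - 2 * (m a)\<^sup>2 * x a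
        = 4 * (m a * \<tau> p a p) + 2 * ((m a)\<^sup>2 * \<kappa> a) - ?K * (2 * (m a)\<^sup>2 - 4 * y p * (m a * q a))" if "a \<in> ?U" for a
      proof -
        have "\<tau> p a p = X p a - ?K * y p * q a" using that by (simp add: X_def G1_def)
        then have "\<tau> p a p + ?K * y p * q a = h a + (- w * ?K * q a) * x a" using Xpa[of a] that by simp
        then have "4 * m a * (h a + (- w * ?K * q a) * x a) = 4 * m a * (\<tau> p a p + ?K * y p * q a)" by simp
        then show ?thesis by (simp add: x_def algebra_simps)
      qed
      then have "(\<Sum>a\<in>?U. 4 * m a * (h a + (- w * ?K * q a) * x a) - 2 * (m a)\<^sup>2 * x a)
        = (\<Sum>a\<in>?U. 4 * (m a * \<tau> p a p) + 2 * ((m a)\<^sup>2 * \<kappa> a) - ?K * (2 * (m a)\<^sup>2 - 4 * y p * (m a * q a)))" by (intro sum.cong refl)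
      then show ?thesis by (simp add: sum.distrib sum_subtractf sum_distrib_left[symmetric])
    qed
    moreover have "(\<Sum>a\<in>?U. 2 * (- w * ?K * q a)\<^sup>2 * x a + 4 * (- w * ?K * q a) * h a + 2 * ((h a)\<^sup>2 / (x a + \<delta>)))
        \<le> (\<Sum>a\<in>?U. 4 * m a * (h a + (- w * ?K * q a) * x a) - 2 * (m a)\<^sup>2 * x a)"
      by (intro sum_mono complete_the_square x0 \<delta> m_def)
    moreover have "(\<Sum>a\<in>?U. 2 * (- w * ?K * q a)\<^sup>2 * x a + 4 * (- w * ?K * q a) * h a + 2 * ((h a)\<^sup>2 / (x a + \<delta>)))
      = 2 * w * ?K\<^sup>2 * (P1 - y p * P0) - 4 * w * b * ?K\<^sup>2 * P1 + 2 * (\<Sum>a\<in>?U. (h a)\<^sup>2 / (x a + \<delta>))"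
    proof -
      have "2 * (- w * ?K * q a)\<^sup>2 * x a + 4 * (- w * ?K * q a) * h a = 2 * w * ?K\<^sup>2 * ((q a)\<^sup>2 * y a - y p * (q a)\<^sup>2) - 4 * w * b * ?K\<^sup>2 * ((q a)\<^sup>2 * y a)" for a
      proof -
        have "2 * (- w * ?K * q a)\<^sup>2 * x a = 2 * w * ?K\<^sup>2 * (q a)\<^sup>2 * (w * x a)" by (simp add: power2_eq_square)
        then show ?thesis unfolding wx h_def by (simp add: algebra_simps power2_eq_square)
      qed
      then show ?thesis
        by (simp only: P0_def P1_def sum.distrib sum_subtractf sum_distrib_left[symmetric])
    qed
    ultimately show ?thesis by linarith
  qed
  have Mc: "C2 c + (2 * (q p)\<^sup>2 * x c + 4 * q p * \<xi> c + 2 * ((\<xi> c)\<^sup>2 / (x c + \<delta>))) + e c \<le> 0" if c: "c \<in> ?U" for c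
  proof -
    define m where "m = q p + \<xi> c / (x c + \<delta>)"
    have "C2 c + 4 * m * \<tau> p c c + 2 * m\<^sup>2 * \<kappa> c - ?K * (2 * m\<^sup>2 - 4 * q p * m * y c) + e c
       = ?K * ((C2 c + 4 * m * \<tau> p c c + 2 * m\<^sup>2 * \<kappa> c) / \<kappa> p
      - (\<tau> p p c / \<kappa> p)\<^sup>2 - (2 * m\<^sup>2 - 4 * q p * m * y c + 2 * q p * v3 p c c) + (b - 1) * L c)" (is "?l = _")
      unfolding e_def clear_denominator[OF K] by (simp add: ring_distribs)
    also have "\<dots> \<le> 0" using max_c[of c m] c K by (simp add: mult_le_0_iff)
    finally have "?l \<le> 0" .
    moreover have "4 * m * \<tau> p c c + 2 * m\<^sup>2 * \<kappa> c - ?K * (2 * m\<^sup>2 - 4 * q p * m * y c) = 4 * m * (\<xi> c + q p * x c) - 2 * m\<^sup>2 * x c"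
    proof -
      have "\<tau> p c c + ?K * q p * y c = \<xi> c + q p * x c"
        using xi(2)[of c] c by (simp add: D_def x_def y_def algebra_simps)
      then have "4 * m * (\<xi> c + q p * x c) = 4 * m * (\<tau> p c c + ?K * q p * y c)" by simp
      then show ?thesis by (simp add: x_def algebra_simps)
    qed
    moreover have "2 * (q p)\<^sup>2 * x c + 4 * q p * \<xi> c + 2 * ((\<xi> c)\<^sup>2 / (x c + \<delta>)) \<le> 4 * m * (\<xi> c + q p * x c) - 2 * m\<^sup>2 * x c"
      by (intro complete_the_square x0 \<delta> m_def)
    ultimately show ?thesis by linarith
  qed
  have "f p * (C2 p + (2 * w * ?K\<^sup>2 * (P1 - y p * P0) - 4 * w * b * ?K\<^sup>2 * P1 + 2 * (\<Sum>a\<in>?U. (h a)\<^sup>2 / (x a + \<delta>)))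
      + e p + 4 * ?K * (D p)\<^sup>2 - 2 * ?K * (y p)\<^sup>2)
     + (\<Sum>c\<in>?U. f c * (C2 c + (2 * (q p)\<^sup>2 * x c + 4 * q p * \<xi> c + 2 * ((\<xi> c)\<^sup>2 / (x c + \<delta>))) + e c)) \<le> 0"
    by (intro add_nonpos_nonpos sum_nonpos mult_nonneg_nonpos f Mp Mc)
  also have "f p * (C2 p + (2 * w * ?K\<^sup>2 * (P1 - y p * P0) - 4 * w * b * ?K\<^sup>2 * P1 + 2 * (\<Sum>a\<in>?U. (h a)\<^sup>2 / (x a + \<delta>)))
      + e p + 4 * ?K * (D p)\<^sup>2 - 2 * ?K * (y p)\<^sup>2) = f p * C2 p + f p * e p + f p * (2 * w * ?K\<^sup>2 * (P1 - y p * P0) - 4 * w * b * ?K\<^sup>2 * P1)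
      + 2 * H2 + 4 * ?K * f p * (D p)\<^sup>2 - 2 * ?K * f p * (y p)\<^sup>2"
    by (simp add: H2_def sum_distrib_left algebra_simps)
  also have "(\<Sum>c\<in>?U. f c * (C2 c + (2 * (q p)\<^sup>2 * x c + 4 * q p * \<xi> c + 2 * ((\<xi> c)\<^sup>2 / (x c + \<delta>))) + e c))
     = (\<Sum>c\<in>?U. f c * C2 c) + (\<Sum>c\<in>?U. f c * e c) + 2 * (q p)\<^sup>2 * (\<Sum>c\<in>?U. f c * x c) + 4 * q p * (\<Sum>c\<in>?U. f c * \<xi> c) + 2 * XX"
    by (simp add: XX_def distrib_left sum.distrib sum_distrib_left mult_ac)
  finally have *: "(\<Sum>c\<in>UNIV. f c * C2 c) + (\<Sum>c\<in>UNIV. f c * e c) + f p * (2 * w * ?K\<^sup>2 * (P1 - y p * P0) - 4 * w * b * ?K\<^sup>2 * P1)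
      + 2 * H2 + 4 * ?K * f p * (D p)\<^sup>2 - 2 * ?K * f p * (y p)\<^sup>2 + 2 * (q p)\<^sup>2 * (\<Sum>c\<in>?U. f c * x c) + 4 * q p * (\<Sum>c\<in>?U. f c * \<xi> c) + 2 * XX \<le> 0"
    unfolding sum_split_at[of "\<lambda>c. f c * C2 c" p] sum_split_at[of "\<lambda>c. f c * e c" p] by (simp add: algebra_simps)
  have fx: "(\<Sum>c\<in>?U. f c * x c) = ?K * S0 - S1"
  proof -
    have "(\<Sum>c\<in>UNIV. f c * x c) = ?K * S0 - S1"
      by (simp add: x_def S0_def S1_def algebra_simps sum_subtractf sum_distrib_left)
    then show ?thesis using sum_split_at[of "\<lambda>c. f c * x c" p] by (simp add: x_def)
  qed
  have fxi: "(\<Sum>c\<in>?U. f c * \<xi> c) = f p * (b * ?K * D p)"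
    using var1 sum_split_at[of "\<lambda>c. f c * \<xi> c" p] xip by (simp add: \<xi>_def D_def)
  have fe: "(\<Sum>c\<in>UNIV. f c * e c) = ?K * ((- (b - 1)\<^sup>2 * (f p * (D p)\<^sup>2 + F2) + 4 * (b - 1) * f p * (D p)\<^sup>2) - 4 * f p * (D p)\<^sup>2
     - 2 * q p * (q p * (S0 - w * S1 * (1 + y p) + 2 * f p * (y p)\<^sup>2))
     + (b - 1) * (S0 + S2 + (f p * ((q p)\<^sup>2 * (y p)\<^sup>2) + F2) - S1 * (w + \<theta>) - w * S1 * Q))"
  proof -
    have t: "(\<tau> p p c / ?K)\<^sup>2 = (b - 1)\<^sup>2 * ((q c)\<^sup>2 * (y c)\<^sup>2) + (if c = p then (4 - 4 * (b - 1)) * (D p)\<^sup>2 else 0)" for c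
    proof -
      have e: "\<tau> p p c / ?K = (if c = p then 2 * D p else 0) - (b - 1) * D c"
        unfolding first[of c] by (rule nonzero_mult_div_cancel_left) (use K in simp)
      show ?thesis unfolding e by (simp add: D_def power2_eq_square algebra_simps)
    qed
    have "(\<Sum>c\<in>UNIV. f c * e c) = ?K * (- (\<Sum>c\<in>UNIV. f c * (\<tau> p p c / ?K)\<^sup>2) - 2 * q p * (\<Sum>c\<in>UNIV. f c * v3 p c c) + (b - 1) * (\<Sum>c\<in>UNIV. f c * L c))"
      by (simp add: e_def algebra_simps sum.distrib sum_subtractf sum_negf sum_distrib_left)
    also have "(\<Sum>c\<in>UNIV. f c * (\<tau> p p c / ?K)\<^sup>2) = (b - 1)\<^sup>2 * (\<Sum>c\<in>UNIV. f c * ((q c)\<^sup>2 * (y c)\<^sup>2)) + f p * ((4 - 4 * (b - 1)) * (D p)\<^sup>2)"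
    proof -
      have "f c * (\<tau> p p c / ?K)\<^sup>2 = (b - 1)\<^sup>2 * (f c * ((q c)\<^sup>2 * (y c)\<^sup>2)) + (if c = p then f p * ((4 - 4 * (b - 1)) * (D p)\<^sup>2) else 0)" for c
        unfolding t by (simp add: algebra_simps)
      then show ?thesis by (simp add: sum.distrib sum_distrib_left)
    qed
    finally show ?thesis unfolding trace_v3 trace_L Qs q2y2 by (simp add: D_def algebra_simps power2_eq_square)
  qed
  have C2s: "(\<Sum>c\<in>UNIV. f c * C2 c) = (\<Sum>a\<in>UNIV. f a * (\<kappa> a * G2 a))
      - 2 * (\<Sum>a\<in>UNIV. \<Sum>c\<in>UNIV - {a}. f a * (X a a * G1 c c - X a c * G1 a c))
      - (\<Sum>a\<in>UNIV. \<Sum>c\<in>UNIV - {a}. ff a c * (X a a * X c c - X a c * X c a))"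
    using var2 by (simp add: right_diff_distrib sum_subtractf)
  have yK: "1 - w * ?K = y p" by (simp add: y_def)
  have Dq: "- q p * y p = D p" by (simp add: D_def)
  have bal: "S1 * (Lo + (D p)\<^sup>2) + 4 * (D p)\<^sup>2 * f p * ?K + 2 * f p * ?K * (y p)\<^sup>2
     + 2 * (f p * ?K * (q p)\<^sup>2 * (w * ?K * (b - 1) * y p + y p + 2 * (y p)\<^sup>2) + \<theta> * (w * ?K * (b - 1) * (F1 - F2) + y p * (F0 - F1)))
     + (- 4 * b * f p * ?K * (D p)\<^sup>2 - 2 * y p * ((b - 1) * ?K * F1 + \<theta> * y p * (F0 - F1) + f p * ?K * ((b - 1) * P1 + y p * P0)))
     + (- 2 * b * ?K * (F1 - f p * P1) * (1 + w * ?K) + 2 * ?K * ((F1 - y p * F0) - f p * (P1 - y p * P0)))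
     + f p * (2 * w * ?K\<^sup>2 * (P1 - y p * P0) - 4 * w * b * ?K\<^sup>2 * P1)
     + 2 * (q p)\<^sup>2 * (?K * S0 - S1) + 4 * q p * f p * (b * ?K * D p)
     + ?K * ((- (b - 1)\<^sup>2 * (f p * (D p)\<^sup>2 + F2) + 4 * (b - 1) * f p * (D p)\<^sup>2) - 2 * q p * (q p * (S0 - w * S1 * (1 + y p) + 2 * f p * (y p)\<^sup>2)) + (b - 1) * (S0 + S2 + (f p * ((q p)\<^sup>2 * (y p)\<^sup>2) + F2) - S1 * (w + \<theta>) - w * S1 * Q))
     - 2 * ?K * f p * (y p)\<^sup>2
    = S1 * (1 + ?K\<^sup>2) - ?K * (S0 + S2) + ?K * (- b\<^sup>2 * (f p * ((q p)\<^sup>2 * (y p)\<^sup>2) + F2) + b * (S0 + S2 - S1 * (w + \<theta>))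
       + b * (f p * ((q p)\<^sup>2 * (y p)\<^sup>2) + F2) - 2 * b * (f p * ((q p)\<^sup>2 * y p) + F1))"
    unfolding Lo_def Q_def
    by (rule balance_identity[OF w_theta qP0, where K = "?K" and ?S1.0 = S1 and fo = "f p" and b = b and ?F1.0 = F1 and ?F2.0 = F2
        and ?F0.0 = F0 and ?P1.0 = P1 and ?S0.0 = S0 and ?S2.0 = S2, unfolded yK Dq])
  have last: "(\<Sum>a\<in>UNIV. f a * ((q a)\<^sup>2 * (b * (y a)\<^sup>2 - 2 * b * y a)))
     = b * (f p * ((q p)\<^sup>2 * (y p)\<^sup>2) + F2) - 2 * b * (f p * ((q p)\<^sup>2 * y p) + F1)"
    unfolding q2y2[symmetric] q2y[symmetric]
    by (simp add: sum_distrib_left sum_subtractf[symmetric] algebra_simps)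
  have goal: "2 * XX - ffxx + 2 * HH + S1 * (1 + ?K\<^sup>2) - ?K * (S0 + S2) + ?K * (- b\<^sup>2 * (f p * ((q p)\<^sup>2 * (y p)\<^sup>2) + F2) + b * (S0 + S2 - S1 * (w + \<theta>))
       + (b * (f p * ((q p)\<^sup>2 * (y p)\<^sup>2) + F2) - 2 * b * (f p * ((q p)\<^sup>2 * y p) + F1))) \<le> 0"
    using * T3 sum_h bal unfolding fx fxi fe C2s kG T2 by (simp add: algebra_simps)
  then show "2 * (\<Sum>a\<in>UNIV - {p}. f a * ((\<xi> a)\<^sup>2 / (\<kappa> p - \<kappa> a + \<delta>))) - (\<Sum>a\<in>UNIV. \<Sum>c\<in>UNIV - {a}. ff a c * (\<xi> a * \<xi> c))
      + 2 * (\<Sum>a\<in>UNIV - {p}. f a * ((h a)\<^sup>2 / (\<kappa> p - \<kappa> a + \<delta>))) + S1 * (1 + (\<kappa> p)\<^sup>2) - \<kappa> p * (S0 + S2)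
    + \<kappa> p * (- b\<^sup>2 * (\<Sum>a\<in>UNIV. f a * ((q a)\<^sup>2 * (y a)\<^sup>2)) + b * (S0 + S2 - S1 * (w + \<theta>))
       + (\<Sum>a\<in>UNIV. f a * ((q a)\<^sup>2 * (b * (y a)\<^sup>2 - 2 * b * y a)))) \<le> 0"
    unfolding last q2y2 XX_def HH_def x_def ffxx_def .
qed

end


section \<open>Bounding the largest curvature at a critical configuration\<close>

text \<open>A negative entry \<open>x c\<close> forces \<open>es (k+1)\<close> of the others to be positive, so they lie in the cone of
  the same order, and Euler's identity bounds \<open>es (k+1) / es k\<close> of them by the largest entry.\<close>

lemma garding_entry_lower_bound:
  assumes I: "finite I" "c \<in> I" and g: "garding (Suc k) I x" and top: "\<And>i. i \<in> I \<Longrightarrow> x i \<le> K"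
    and K: "K \<ge> 0" and k: "Suc k \<le> card I"
  shows "x c \<ge> - ((real (card I) - real (Suc k)) / real (Suc k)) * K"
proof (cases "x c \<ge> 0")
  case True
  moreover have "((real (card I) - real (Suc k)) / real (Suc k)) * K \<ge> 0" using K k by simp
  ultimately show ?thesis by linarith
next
  case False
  define J where "J = I - {c}"
  have J: "finite J" "card J = card I - 1" using I by (auto simp: J_def)
  have gJ: "garding k J x" unfolding J_def by (rule garding_remove[OF I g])
  have pos: "es k J x > 0" using gJ by (simp add: garding_def)
  have rem: "es (Suc k) I x = x c * es k J x + es (Suc k) J x" unfolding J_def by (rule es_remove[OF I])
  have posS: "es (Suc k) I x > 0" using g by (simp add: garding_def)
  have "x c * es k J x \<le> 0" using False pos by (simp add: mult_nonpos_nonneg)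
  then have "es (Suc k) J x > 0" using rem posS by linarith
  then have gJ': "garding (Suc k) J x" using gJ by (auto simp: garding_def le_Suc_eq)
  have "real (Suc k) * es (Suc k) J x = (\<Sum>i\<in>J. x i * es k (J - {i}) x)" by (rule es_euler[OF J(1), symmetric])
  also have "\<dots> \<le> (\<Sum>i\<in>J. K * es k (J - {i}) x)"
  proof (intro sum_mono mult_right_mono)
    fix i assume i: "i \<in> J"
    show "x i \<le> K" using top i by (auto simp: J_def)
    show "es k (J - {i}) x \<ge> 0" using garding_remove[OF J(1) i gJ'] by (simp add: garding_def less_imp_le)
  qed
  also have "\<dots> = K * ((real (card J) - real k) * es k J x)"
    by (simp only: sum_distrib_left[symmetric] es_count[OF J(1)])
  also have "real (card J) - real k = real (card I) - real (Suc k)" using J I k by (simp add: of_nat_diff)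
  finally have u: "real (Suc k) * es (Suc k) J x \<le> K * ((real (card I) - real (Suc k)) * es k J x)" .
  have "- x c * es k J x < es (Suc k) J x" using rem posS by simp
  then have "real (Suc k) * (- x c * es k J x) \<le> real (Suc k) * es (Suc k) J x" by (intro mult_left_mono) auto
  then have "(real (Suc k) * - x c) * es k J x \<le> (K * (real (card I) - real (Suc k))) * es k J x"
    using u by (simp only: mult_ac)
  then have "real (Suc k) * - x c \<le> K * (real (card I) - real (Suc k))" using pos by (simp only: mult_le_cancel_right_pos)
  then have "- x c \<le> K * (real (card I) - real (Suc k)) / real (Suc k)"
    by (subst pos_le_divide_eq) (simp_all add: mult_ac del: of_nat_Suc)
  then show ?thesis by (simp add: mult_ac del: of_nat_Suc)
qed

lemma garding_top_positive:
  assumes "finite I" "garding (Suc k) I x" "\<And>i. i \<in> I \<Longrightarrow> x i \<le> K"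
  shows "K > 0"
proof (rule ccontr)
  assume "\<not> K > 0"
  then have "(\<Sum>i\<in>I. x i) \<le> 0" using assms(3) by (intro sum_nonpos) force
  moreover have "(\<Sum>i\<in>I. x i) = es 1 I x" using es_euler[OF assms(1), of x 0] assms(1) by simp
  moreover have "es 1 I x > 0" using assms(2) unfolding garding_def by (metis One_nat_def Suc_le_mono zero_le)
  ultimately show False by linarith
qed

text \<open>The minimum of \<open>\<alpha> y^2 - 2 y\<close> is \<open>- 1/\<alpha>\<close>.\<close>

lemma quadratic_lower_bound:
  fixes \<alpha> b y :: real
  assumes "\<alpha> \<ge> b" "b > 0"
  shows "b * (\<alpha> * y\<^sup>2 - 2 * y) \<ge> - 1"
proof -
  have "b * (\<alpha> * y\<^sup>2 - 2 * y) \<ge> b * (b * y\<^sup>2 - 2 * y)" using assms by (intro mult_left_mono diff_mono mult_right_mono) auto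
  moreover have "b * (b * y\<^sup>2 - 2 * y) = (b * y - 1)\<^sup>2 - 1" by (simp add: power2_eq_square algebra_simps)
  moreover have "(b * y - 1)\<^sup>2 \<ge> 0" by simp
  ultimately show ?thesis by linarith
qed

text \<open>The coefficient of \<open>f c * (q c)^2\<close> for a direction of curvature \<open>t\<close> other than the top one.  For
  \<open>t \<ge> 0\<close> the crude minimum suffices.  For \<open>t < 0\<close> the coefficient is \<open>(\<alpha> y - 2) y\<close> with \<open>y \<ge> 1\<close>:
  either \<open>t\<close> is small compared with \<open>K\<close> and \<open>\<alpha> \<ge> 2\<close>, or \<open>y\<close> is so large that the lower bound
  \<open>\<alpha> \<ge> 1/(N+1)\<close> is enough.\<close>

lemma side_coefficient:
  fixes K t w N b :: real
  assumes N: "N \<ge> 2" and b: "b = 1 + 1 / N" and K: "K \<ge> 2 * (2 * N + 1) * (N + 1)" and w: "w \<ge> 1"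
    and tK: "t \<le> K" and low: "t \<ge> - ((N - 1) / 2) * K"
  defines "\<alpha> \<equiv> 2 * b * K / (K - t + 1) - b + 1" and "y \<equiv> 1 - w * t"
  shows "b * (\<alpha> * y\<^sup>2 - 2 * y) \<ge> (if t \<ge> 0 then - 1 else 0)"
proof -
  have b1: "b > 1" "b \<le> 3 / 2" using N by (auto simp: b field_simps)
  have N1: "N + 1 \<ge> 3" "2 * (2 * N + 1) \<ge> 10" using N by auto
  then have "2 * (2 * N + 1) * (N + 1) \<ge> 10 * 3" by (intro mult_mono) auto
  then have K30: "K \<ge> 30" using K by linarith
  have den: "K - t + 1 > 0" using tK by simp
  show ?thesis
  proof (cases "t \<ge> 0")
    case True
    have "\<alpha> \<ge> b"
    proof -
      have "2 * b * K / (K - t + 1) \<ge> 2 * b - 1"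
      proof (subst pos_le_divide_eq[OF den])
        have "(2 * b - 1) * (K - t + 1) \<le> (2 * b - 1) * (K + 1)" using True b1 by (intro mult_left_mono) auto
        also have "\<dots> \<le> 2 * b * K" using b1 K30 by (simp add: algebra_simps)
        finally show "(2 * b - 1) * (K - t + 1) \<le> 2 * b * K" .
      qed
      then show ?thesis by (simp add: \<alpha>_def)
    qed
    then show ?thesis using True quadratic_lower_bound[of b \<alpha> y] b1 by simp
  next
    case False
    define s where "s = - t"
    have s: "s > 0" "s \<le> ((N - 1) / 2) * K" using False low by (auto simp: s_def)
    have y: "y \<ge> 1 + s"
    proof -
      have "w * s \<ge> 1 * s" using w s by (intro mult_right_mono) auto
      then show ?thesis by (simp add: y_def s_def)
    qed
    have ay: "\<alpha> * y \<ge> 2"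
    proof (cases "(2 * N + 1) * (s + 1) \<le> K")
      case True
      have "\<alpha> \<ge> 2"
      proof -
        have "2 * b * K / (K - t + 1) \<ge> 1 + b"
        proof (subst pos_le_divide_eq[OF den])
          have Nb: "N * b = N + 1" using N by (simp add: b field_simps)
          have "N * ((1 + b) * (K - t + 1)) = (N + N * b) * (K + s + 1)" by (simp add: s_def algebra_simps)
          also have "\<dots> = (2 * N + 1) * K + (2 * N + 1) * (s + 1)" unfolding Nb by (simp add: algebra_simps)
          also have "\<dots> \<le> (2 * N + 1) * K + K" using True by simp
          also have "\<dots> = 2 * (N * b) * K" unfolding Nb by (simp add: algebra_simps)
          finally have "N * ((1 + b) * (K - t + 1)) \<le> N * (2 * b * K)" by (simp add: mult_ac)
          then show "(1 + b) * (K - t + 1) \<le> 2 * b * K" using N by simp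
        qed
        then show ?thesis by (simp add: \<alpha>_def)
      qed
      moreover have "y \<ge> 1" using y s by simp
      ultimately show ?thesis using mult_mono[of 2 \<alpha> 1 y] by simp
    next
      case False
      have "\<alpha> \<ge> 1 / (N + 1)"
      proof -
        have "2 * b * K / (K - t + 1) \<ge> b - 1 + 1 / (N + 1)"
        proof (subst pos_le_divide_eq[OF den])
          have "K - t + 1 \<le> K + ((N - 1) / 2) * K + 1" using s by (simp add: s_def)
          also have "\<dots> \<le> K * (N + 1)"
          proof -
            have "K * (N + 1) - (K + ((N - 1) / 2) * K + 1) = (N + 1) / 2 * K - 1" by (simp add: field_simps)
            moreover have "(N + 1) / 2 * K \<ge> 1 * 30" using N K30 by (intro mult_mono) auto
            ultimately show ?thesis by linarith
          qed
          finally have l: "K - t + 1 \<le> K * (N + 1)" .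
          have l2: "K - t + 1 \<le> K * N"
          proof -
            have "K * N - (K + ((N - 1) / 2) * K + 1) = (N - 1) / 2 * K - 1" by (simp add: field_simps)
            moreover have "(N - 1) / 2 * K \<ge> (1 / 2) * 30" using N K30 by (intro mult_mono) auto
            ultimately have "K + ((N - 1) / 2) * K + 1 \<le> K * N" by linarith
            then show ?thesis using s by (simp add: s_def)
          qed
          have "(b - 1 + 1 / (N + 1)) * (K - t + 1) = (K - t + 1) / N + (K - t + 1) / (N + 1)"
            by (simp add: b distrib_right)
          also have "\<dots> \<le> K + K"
            using l l2 N by (intro add_mono) (simp_all add: pos_divide_le_eq)
          also have "\<dots> \<le> 2 * b * K" using b1 K30 by simp
          finally show "(b - 1 + 1 / (N + 1)) * (K - t + 1) \<le> 2 * b * K" .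
        qed
        then show ?thesis by (simp add: \<alpha>_def)
      qed
      moreover have "y \<ge> 2 * (N + 1)"
      proof -
        have "(2 * N + 1) * (s + 1) \<ge> (2 * N + 1) * (2 * (N + 1))"
        proof -
          have "(2 * N + 1) * (2 * (N + 1)) = 2 * (2 * N + 1) * (N + 1)" by (simp add: algebra_simps)
          then show ?thesis using False K by linarith
        qed
        then have "s + 1 \<ge> 2 * (N + 1)" using N by simp
        then show ?thesis using y by simp
      qed
      moreover have "0 \<le> \<alpha>"
      proof -
        have "0 < 1 / (N + 1)" using N by simp
        then show ?thesis using \<open>\<alpha> \<ge> 1 / (N + 1)\<close> by linarith
      qed
      ultimately have "\<alpha> * y \<ge> (1 / (N + 1)) * (2 * (N + 1))" using N by (intro mult_mono) simp_all
      moreover have "(1 / (N + 1)) * (2 * (N + 1)) = 2" using N by (simp add: field_simps)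
      ultimately show ?thesis by simp
    qed
    have "\<alpha> * y\<^sup>2 - 2 * y = (\<alpha> * y - 2) * y" by (simp add: power2_eq_square algebra_simps)
    moreover have "(\<alpha> * y - 2) * y \<ge> 0" using ay y s by (intro mult_nonneg_nonneg) auto
    ultimately show ?thesis using False b1 by simp
  qed
qed

text \<open>Suppose that \<open>\<kappa> p\<close> exceeds the bound.  By \<open>top_entry_inequality\<close> the third derivatives contribute at least
  \<open>f p b^2 \<kappa>_p q_p^2 y_p^2 / N\<close>, and \<open>b (1 - 1/N) \<le> 1\<close> makes the \<open>p\<close>-th coefficient nonnegative.  The
  directions with nonnegative curvature cost at most \<open>S0 / N = (b - 1) S0\<close>, because \<open>f a \<le> S0 / N\<close>
  there; this is exactly the gain from the weight \<open>w^(b-1)\<close> of the test function.  What is left is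
  \<open>S1 (\<kappa> p - b (w + \<theta>)) + S1 / \<kappa> p \<le> 0\<close> with \<open>S1 > 0\<close>, a contradiction.\<close>

lemma critical_bound:
  fixes \<kappa> q \<xi> :: "'n::finite \<Rightarrow> real" and w \<theta> \<sigma> :: real and p :: 'n
  assumes m: "Suc (Suc (Suc m)) \<le> CARD('n)" and g: "garding (Suc (Suc m)) UNIV \<kappa>"
    and top: "\<And>a. \<kappa> a \<le> \<kappa> p" and w: "w * \<theta> = 1" "0 < \<sigma>" "\<sigma> \<le> \<theta>" "\<theta> \<le> 1"
    and q: "(\<Sum>a\<in>UNIV. (q a)\<^sup>2) \<le> 1"
  defines "f \<equiv> \<lambda>a. es (Suc m) (UNIV - {a}) \<kappa>" and "y \<equiv> \<lambda>a. 1 - w * \<kappa> a"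
  defines "S0 \<equiv> \<Sum>a\<in>UNIV. f a" and "S1 \<equiv> \<Sum>a\<in>UNIV. f a * \<kappa> a" and "S2 \<equiv> \<Sum>a\<in>UNIV. f a * (\<kappa> a)\<^sup>2"
  defines "N \<equiv> real (CARD('n)) - real (Suc m)" and "b \<equiv> 1 + 1 / (real (CARD('n)) - real (Suc m))"
  defines "h \<equiv> \<lambda>a. b * \<kappa> p * q a * y a"
  assumes tang: "(\<Sum>a\<in>UNIV. f a * \<xi> a) = 0" and xip: "\<xi> p = b * \<kappa> p * q p * y p"
    and main: "2 * (\<Sum>a\<in>UNIV - {p}. f a * ((\<xi> a)\<^sup>2 / (\<kappa> p - \<kappa> a + 1)))
        - (\<Sum>a\<in>UNIV. \<Sum>c\<in>UNIV - {a}. es m (UNIV - {a} - {c}) \<kappa> * (\<xi> a * \<xi> c))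
      + 2 * (\<Sum>a\<in>UNIV - {p}. f a * ((h a)\<^sup>2 / (\<kappa> p - \<kappa> a + 1))) + S1 * (1 + (\<kappa> p)\<^sup>2) - \<kappa> p * (S0 + S2)
    + \<kappa> p * (- b\<^sup>2 * (\<Sum>a\<in>UNIV. f a * ((q a)\<^sup>2 * (y a)\<^sup>2)) + b * (S0 + S2 - S1 * (w + \<theta>))
       + (\<Sum>a\<in>UNIV. f a * ((q a)\<^sup>2 * (b * (y a)\<^sup>2 - 2 * b * y a)))) \<le> 0"
  shows "\<kappa> p \<le> max (2 * (2 * N + 1) * (N + 1)) (4 / \<sigma>)"
proof (rule ccontr)
  assume "\<not> ?thesis"
  then have K1: "\<kappa> p \<ge> 2 * (2 * N + 1) * (N + 1)" and K2: "\<kappa> p > 4 / \<sigma>" by auto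
  let ?K = "\<kappa> p" and ?U = "UNIV - {p}"
  have N: "N \<ge> 2" using m by (simp add: N_def)
  have bN: "b = 1 + 1 / N" by (simp add: b_def N_def)
  have b1: "b > 1" "b \<le> 3 / 2" using N by (auto simp: bN field_simps)
  have "N + 1 \<ge> 3" "2 * (2 * N + 1) \<ge> 10" using N by auto
  then have "2 * (2 * N + 1) * (N + 1) \<ge> 10 * 3" by (intro mult_mono) auto
  then have K30: "?K \<ge> 30" using K1 by linarith
  then have K0: "?K > 0" by simp
  have th: "\<theta> > 0" using w by simp
  have wth: "w = 1 / \<theta>" using w th by (simp add: field_simps)
  have w1: "w \<ge> 1" using w th by (simp add: wth)
  have ws: "w \<le> 1 / \<sigma>" using w by (simp add: wth frac_le)
  have fpos: "f a > 0" for a using garding_remove[OF _ _ g, of a] by (simp add: f_def garding_def)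
  have S1: "S1 > 0"
  proof -
    have "S1 = real (Suc (Suc m)) * es (Suc (Suc m)) UNIV \<kappa>"
      unfolding S1_def f_def using es_euler[of UNIV \<kappa> "Suc m"] by (simp add: mult.commute)
    then show ?thesis using g by (simp add: garding_def del: of_nat_Suc)
  qed
  have S2: "S2 \<ge> 0" unfolding S2_def using fpos by (intro sum_nonneg) (simp add: less_imp_le)
  have S0: "S0 = N * es (Suc m) UNIV \<kappa>"
    unfolding S0_def f_def N_def using es_count[of UNIV "Suc m" \<kappa>] by simp
  have S0p: "S0 \<ge> 0" unfolding S0_def using fpos by (intro sum_nonneg) (simp add: less_imp_le)
  have fS0: "f a \<le> S0 / N" if "\<kappa> a \<ge> 0" for a
  proof -
    have gm: "garding (Suc m) (UNIV - {a}) \<kappa>" by (rule garding_remove[OF _ _ g]) auto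
    then have "es m (UNIV - {a}) \<kappa> > 0" by (simp add: garding_def)
    then have "f a \<le> es (Suc m) UNIV \<kappa>" using es_remove[of UNIV a m \<kappa>] that by (simp add: f_def)
    then show ?thesis using N by (simp add: S0)
  qed
  have ins: "insert p ?U = UNIV" by auto
  have cardU: "real (card ?U) = real (CARD('n)) - 1" by (simp add: of_nat_diff card_gt_0_iff Suc_leI)
  \<comment> \<open>The gain from \<open>top_entry_inequality\<close>, with \<open>\<kappa> p + r\<close> replaced by the larger \<open>N * \<kappa> p\<close>.\<close>
  have "f p * (b\<^sup>2 * ?K * (q p)\<^sup>2 * (y p)\<^sup>2) / N
      \<le> 2 * (\<Sum>a\<in>?U. f a * ((\<xi> a)\<^sup>2 / (?K - \<kappa> a + 1))) - (\<Sum>a\<in>UNIV. \<Sum>c\<in>UNIV - {a}. es m (UNIV - {a} - {c}) \<kappa> * (\<xi> a * \<xi> c))"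
  proof -
    define r where "r = (?K + 1) * (real (card ?U) - real (Suc m)) / real (Suc (Suc m))"
    have tp: "es (Suc m) ?U \<kappa> * (\<xi> p)\<^sup>2 / (?K + r)
      \<le> 2 * (\<Sum>i\<in>?U. (\<xi> i)\<^sup>2 * es (Suc m) (insert p ?U - {i}) \<kappa> / (?K + 1 - \<kappa> i))
        - (\<Sum>i\<in>insert p ?U. \<Sum>l\<in>insert p ?U - {i}. \<xi> i * \<xi> l * es m (insert p ?U - {i} - {l}) \<kappa>)"
      unfolding r_def
    proof (rule top_entry_inequality)
      show "Suc (Suc m) \<le> card ?U" using m by simp
      show "garding (Suc (Suc m)) (insert p ?U) \<kappa>" using g by (simp only: ins)
      show "(\<Sum>i\<in>insert p ?U. \<xi> i * es (Suc m) (insert p ?U - {i}) \<kappa>) = 0"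
        using tang unfolding ins f_def by (simp add: mult.commute)
    qed (use top K0 in auto)
    have "0 \<le> r" unfolding r_def cardU using K0 m by (intro divide_nonneg_nonneg mult_nonneg_nonneg) auto
    have Kr: "?K + r \<le> N * ?K"
    proof -
      have "r = (?K + 1) / real (Suc (Suc m)) * (N - 1)"
        unfolding r_def cardU N_def by (simp add: algebra_simps)
      also have "\<dots> \<le> ?K * (N - 1)"
      proof (intro mult_right_mono)
        have "?K + 1 \<le> ?K * 2" using K30 by simp
        also have "\<dots> \<le> ?K * real (Suc (Suc m))" using K0 by (intro mult_left_mono) auto
        finally show "(?K + 1) / real (Suc (Suc m)) \<le> ?K" by (subst pos_divide_le_eq) auto
      qed (use N in auto)
      finally show ?thesis by (simp add: algebra_simps)
    qed
    have "f p * (b\<^sup>2 * ?K * (q p)\<^sup>2 * (y p)\<^sup>2) / N = f p * (\<xi> p)\<^sup>2 / (N * ?K)"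
      using K0 N by (simp add: xip power_mult_distrib field_simps power2_eq_square)
    also have "\<dots> \<le> f p * (\<xi> p)\<^sup>2 / (?K + r)"
      using Kr K0 N \<open>0 \<le> r\<close> fpos[of p] by (intro divide_left_mono mult_nonneg_nonneg mult_pos_pos) auto
    also have "\<dots> = es (Suc m) ?U \<kappa> * (\<xi> p)\<^sup>2 / (?K + r)" by (simp add: f_def)
    also note tp
    finally show ?thesis unfolding ins f_def
      by (simp only: mult.commute[of _ "es _ _ _"] times_divide_eq_right diff_add_eq)
  qed
  with main have le0: "f p * (b\<^sup>2 * ?K * (q p)\<^sup>2 * (y p)\<^sup>2) / N
      + 2 * (\<Sum>a\<in>UNIV - {p}. f a * ((h a)\<^sup>2 / (\<kappa> p - \<kappa> a + 1))) + S1 * (1 + (\<kappa> p)\<^sup>2) - \<kappa> p * (S0 + S2)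
    + \<kappa> p * (- b\<^sup>2 * (\<Sum>a\<in>UNIV. f a * ((q a)\<^sup>2 * (y a)\<^sup>2)) + b * (S0 + S2 - S1 * (w + \<theta>))
       + (\<Sum>a\<in>UNIV. f a * ((q a)\<^sup>2 * (b * (y a)\<^sup>2 - 2 * b * y a)))) \<le> 0"
    by linarith
  define \<alpha> where "\<alpha> a = 2 * b * ?K / (?K - \<kappa> a + 1) - b + 1" for a
  define g where "g a = f a * (q a)\<^sup>2 * (b * (\<alpha> a * (y a)\<^sup>2 - 2 * y a))" for a
  define A where "A = f p * (q p)\<^sup>2 * (b\<^sup>2 * (y p)\<^sup>2 / N - b\<^sup>2 * (y p)\<^sup>2 + b * (y p)\<^sup>2 - 2 * b * y p)"
  have "f p * (b\<^sup>2 * ?K * (q p)\<^sup>2 * (y p)\<^sup>2) / N + 2 * (\<Sum>a\<in>?U. f a * ((h a)\<^sup>2 / (?K - \<kappa> a + 1)))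
     + ?K * (- b\<^sup>2 * (\<Sum>a\<in>UNIV. f a * ((q a)\<^sup>2 * (y a)\<^sup>2)) + (\<Sum>a\<in>UNIV. f a * ((q a)\<^sup>2 * (b * (y a)\<^sup>2 - 2 * b * y a))))
    = ?K * (A + (\<Sum>a\<in>?U. g a))"
  proof -
    have "?K * g a = 2 * (f a * ((h a)\<^sup>2 / (?K - \<kappa> a + 1))) - ?K * b\<^sup>2 * (f a * ((q a)\<^sup>2 * (y a)\<^sup>2))
       + ?K * (f a * ((q a)\<^sup>2 * (b * (y a)\<^sup>2 - 2 * b * y a)))" for a
      by (simp add: g_def \<alpha>_def h_def power2_eq_square algebra_simps)
    then have "(\<Sum>a\<in>?U. ?K * g a) = 2 * (\<Sum>a\<in>?U. f a * ((h a)\<^sup>2 / (?K - \<kappa> a + 1)))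
       - ?K * b\<^sup>2 * (\<Sum>a\<in>?U. f a * ((q a)\<^sup>2 * (y a)\<^sup>2)) + ?K * (\<Sum>a\<in>?U. f a * ((q a)\<^sup>2 * (b * (y a)\<^sup>2 - 2 * b * y a)))"
      by (simp only: sum.distrib sum_subtractf sum_distrib_left[symmetric])
    moreover have "?K * A = f p * (b\<^sup>2 * ?K * (q p)\<^sup>2 * (y p)\<^sup>2) / N - ?K * b\<^sup>2 * (f p * ((q p)\<^sup>2 * (y p)\<^sup>2))
       + ?K * (f p * ((q p)\<^sup>2 * (b * (y p)\<^sup>2 - 2 * b * y p)))"
      by (simp add: A_def algebra_simps)
    ultimately show ?thesis
      unfolding sum_split_at[of "\<lambda>a. f a * ((q a)\<^sup>2 * (y a)\<^sup>2)" p] sum_split_at[of "\<lambda>a. f a * ((q a)\<^sup>2 * (b * (y a)\<^sup>2 - 2 * b * y a))" p]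
      by (simp add: distrib_left right_diff_distrib sum_distrib_left[symmetric] mult.assoc)
  qed
  then have "?K * (A + (\<Sum>a\<in>?U. g a)) + S1 * (1 + ?K\<^sup>2) - ?K * (S0 + S2) + ?K * (b * (S0 + S2 - S1 * (w + \<theta>))) \<le> 0"
  proof -
    have "k * (a + b + c) = k * (a + c) + k * b" for k a b c :: real by (simp add: distrib_left)
    from le0[unfolded this] show ?thesis using \<open>_ = ?K * (A + (\<Sum>a\<in>?U. g a))\<close> by linarith
  qed
  also have "?K * (A + (\<Sum>a\<in>?U. g a)) + S1 * (1 + ?K\<^sup>2) - ?K * (S0 + S2) + ?K * (b * (S0 + S2 - S1 * (w + \<theta>)))
     = ?K * (A + (\<Sum>a\<in>?U. g a) + (b - 1) * S0 + (b - 1) * S2 + S1 * (?K - b * (w + \<theta>))) + S1"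
    by (simp add: algebra_simps power2_eq_square)
  finally have fin: "?K * (A + (\<Sum>a\<in>?U. g a) + (b - 1) * S0 + (b - 1) * S2 + S1 * (?K - b * (w + \<theta>))) + S1 \<le> 0" .
  have "A \<ge> 0"
  proof -
    have "w * ?K \<ge> 1 * 1" using w1 K30 by (intro mult_mono) auto
    then have "y p \<le> 0" by (simp add: y_def)
    then have "b * y p \<le> 0" using b1 by (simp add: mult_nonneg_nonpos)
    moreover have "b\<^sup>2 * (y p)\<^sup>2 / N - b\<^sup>2 * (y p)\<^sup>2 + b * (y p)\<^sup>2 = b / N\<^sup>2 * (y p)\<^sup>2"
    proof -
      have "b\<^sup>2 / N - b\<^sup>2 + b = b / N\<^sup>2" using N unfolding bN by (simp add: field_simps power2_eq_square)
      then show ?thesis by (metis (no_types, opaque_lifting) distrib_right left_diff_distrib times_divide_eq_left)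
    qed
    moreover have "b / N\<^sup>2 * (y p)\<^sup>2 \<ge> 0" using b1 by simp
    ultimately have "b\<^sup>2 * (y p)\<^sup>2 / N - b\<^sup>2 * (y p)\<^sup>2 + b * (y p)\<^sup>2 - 2 * b * y p \<ge> 0" by simp
    then show ?thesis unfolding A_def using fpos[of p] by (intro mult_nonneg_nonneg) auto
  qed
  moreover have "(\<Sum>a\<in>?U. g a) \<ge> - (b - 1) * S0"
  proof -
    have ga: "g a \<ge> - (S0 / N) * (q a)\<^sup>2" for a
    proof -
      have low: "\<kappa> a \<ge> - ((N - 1) / 2) * ?K"
      proof -
        have "\<kappa> a \<ge> - ((real (card (UNIV :: 'n set)) - real (Suc (Suc m))) / real (Suc (Suc m))) * ?K"
          by (rule garding_entry_lower_bound[OF _ _ g]) (use top K0 m in auto)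
        moreover have "(real (card (UNIV :: 'n set)) - real (Suc (Suc m))) / real (Suc (Suc m)) \<le> (N - 1) / 2"
          using m by (intro frac_le) (auto simp: N_def)
        then have "(real (card (UNIV :: 'n set)) - real (Suc (Suc m))) / real (Suc (Suc m)) * ?K \<le> (N - 1) / 2 * ?K"
          using K0 by (intro mult_right_mono) auto
        ultimately show ?thesis by linarith
      qed
      have sc: "b * (\<alpha> a * (y a)\<^sup>2 - 2 * y a) \<ge> (if \<kappa> a \<ge> 0 then - 1 else 0)"
        unfolding \<alpha>_def y_def by (rule side_coefficient[OF N bN K1 w1 top low])
      have fq: "f a * (q a)\<^sup>2 \<ge> 0" using fpos[of a] by simp
      show ?thesis
      proof (cases "\<kappa> a \<ge> 0")
        case True
        then have "f a * (q a)\<^sup>2 * (b * (\<alpha> a * (y a)\<^sup>2 - 2 * y a)) \<ge> f a * (q a)\<^sup>2 * (- 1)"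
          using sc fq by (intro mult_left_mono) auto
        moreover have "f a * (q a)\<^sup>2 \<le> S0 / N * (q a)\<^sup>2" using fS0[OF True] by (intro mult_right_mono) auto
        ultimately show ?thesis by (simp add: g_def)
      next
        case False
        then have "g a \<ge> 0" unfolding g_def using sc fq mult_nonneg_nonneg[OF fq, of "b * (\<alpha> a * (y a)\<^sup>2 - 2 * y a)"] by simp
        moreover have "(S0 / N) * (q a)\<^sup>2 \<ge> 0" using S0p N by simp
        ultimately show ?thesis by linarith
      qed
    qed
    have "(\<Sum>a\<in>?U. (q a)\<^sup>2) \<le> 1" using q sum_split_at[of "\<lambda>a. (q a)\<^sup>2" p] by (smt (verit) zero_le_power2)
    then have "(S0 / N) * (\<Sum>a\<in>?U. (q a)\<^sup>2) \<le> (S0 / N) * 1" using S0p N by (intro mult_left_mono) auto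
    moreover have "(\<Sum>a\<in>?U. g a) \<ge> (\<Sum>a\<in>?U. - (S0 / N) * (q a)\<^sup>2)" by (intro sum_mono ga)
    moreover have "(\<Sum>a\<in>?U. - (S0 / N) * (q a)\<^sup>2) = - ((S0 / N) * (\<Sum>a\<in>?U. (q a)\<^sup>2))"
      by (simp only: sum_distrib_left[symmetric] mult_minus_left sum_negf)
    moreover have "(b - 1) * S0 = S0 / N" by (simp add: bN)
    ultimately show ?thesis by linarith
  qed
  moreover have "(b - 1) * S2 \<ge> 0" using b1 S2 by simp
  moreover have "S1 * (?K - b * (w + \<theta>)) \<ge> 0"
  proof -
    have "b * (w + \<theta>) \<le> (3 / 2) * (w + w)" using b1 w w1 th by (intro mult_mono) auto
    also have "\<dots> \<le> 4 / \<sigma>" using ws w(2) by (simp add: field_simps)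
    finally show ?thesis using K2 S1 by simp
  qed
  ultimately have "A + (\<Sum>a\<in>?U. g a) + (b - 1) * S0 + (b - 1) * S2 + S1 * (?K - b * (w + \<theta>)) \<ge> 0" by linarith
  then have "?K * (A + (\<Sum>a\<in>?U. g a) + (b - 1) * S0 + (b - 1) * S2 + S1 * (?K - b * (w + \<theta>))) \<ge> 0" using K0 by simp
  then show False using fin S1 by linarith
qed


section \<open>From jets along lines to the second-order conditions\<close>

text \<open>Since \<open>m\<close> has no component along \<open>e_p\<close>, a form that is diagonal at \<open>t = 0\<close> contributes nothing of
  first order in \<open>m\<close>; the cross term carries the factor \<open>4\<close> (two from symmetry, two from the product rule).\<close>

lemma jet2_quadratic_form:
  fixes F :: "'n::finite \<Rightarrow> 'n \<Rightarrow> real \<Rightarrow> real"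
  assumes jF: "\<And>a b. jet2 (F a b) (if a = b then F0 a else 0) (F1 a b) (F2 a b)"
    and sym: "\<And>a b. F1 a b = F1 b a" and mp: "m p = 0"
  shows "jet2 (\<lambda>t. \<Sum>a\<in>UNIV. \<Sum>b\<in>UNIV. ((if a = p then 1 else 0) + t * m a) * ((if b = p then 1 else 0) + t * m b) * F a b t)
    (F0 p) (F1 p p) (F2 p p + 4 * (\<Sum>a\<in>UNIV - {p}. m a * F1 p a) + 2 * (\<Sum>a\<in>UNIV - {p}. (m a)\<^sup>2 * F0 a))"
proof -
  have jV: "jet2 (\<lambda>t. (if a = p then 1 else 0) + t * m a) (if a = p then 1 else 0) (m a) 0" for a
    using jet2_add[OF jet2_const[of "if a = p then 1 else 0"] jet2_cmult[OF jet2_ident, of "m a"]]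
    by (simp add: mult.commute)
  let ?d = "\<lambda>a. if a = p then 1 else 0 :: real" and ?F0 = "\<lambda>a b. if a = b then F0 a else 0"
  have j: "jet2 (\<lambda>t. ((if a = p then 1 else 0) + t * m a) * ((if b = p then 1 else 0) + t * m b) * F a b t)
     (?d a * ?d b * ?F0 a b)
     (?d a * ?d b * F1 a b + (?d a * m b + m a * ?d b) * ?F0 a b)
     (?d a * ?d b * F2 a b + 2 * (?d a * m b + m a * ?d b) * F1 a b + (2 * m a * m b) * ?F0 a b)" for a b
    using jet2_mult[OF jet2_mult[OF jV[of a] jV[of b]] jF[of a b]] by simp
  have one: "(\<Sum>b\<in>UNIV. ?d b * g b) = g p" for g
  proof -
    have "?d b * g b = (if b = p then g b else 0)" for b by simp
    then show ?thesis by simp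
  qed
  have s0: "(\<Sum>a\<in>UNIV. \<Sum>b\<in>UNIV. ?d a * ?d b * ?F0 a b) = F0 p"
    by (simp only: mult.assoc sum_distrib_left[symmetric] one) simp
  have s1: "(\<Sum>a\<in>UNIV. \<Sum>b\<in>UNIV. ?d a * ?d b * F1 a b + (?d a * m b + m a * ?d b) * ?F0 a b) = F1 p p"
  proof -
    have "(\<Sum>b\<in>UNIV. ?d a * ?d b * F1 a b + (?d a * m b + m a * ?d b) * ?F0 a b) = ?d a * F1 a p + (?d a * m a * F0 a + m a * (?d a * F0 a))" for a
    proof -
      have "(?d a * m b + m a * ?d b) * ?F0 a b = (if a = b then ?d a * m a * F0 a + m a * (?d a * F0 a) else 0)" for b by simp
      then show ?thesis by (simp only: sum.distrib mult.assoc sum_distrib_left[symmetric] one) simp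
    qed
    then have "(\<Sum>a\<in>UNIV. \<Sum>b\<in>UNIV. ?d a * ?d b * F1 a b + (?d a * m b + m a * ?d b) * ?F0 a b)
      = (\<Sum>a\<in>UNIV. ?d a * (F1 a p + 2 * m a * F0 a))" by (simp add: algebra_simps)
    then show ?thesis unfolding one using mp by simp
  qed
  have s2: "(\<Sum>a\<in>UNIV. \<Sum>b\<in>UNIV. ?d a * ?d b * F2 a b + 2 * (?d a * m b + m a * ?d b) * F1 a b + (2 * m a * m b) * ?F0 a b)
     = F2 p p + 4 * (\<Sum>a\<in>UNIV. m a * F1 p a) + 2 * (\<Sum>a\<in>UNIV. (m a)\<^sup>2 * F0 a)"
  proof -
    have "(\<Sum>b\<in>UNIV. ?d a * ?d b * F2 a b + 2 * (?d a * m b + m a * ?d b) * F1 a b + (2 * m a * m b) * ?F0 a b)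
      = ?d a * (F2 a p + 2 * (\<Sum>b\<in>UNIV. m b * F1 a b)) + 2 * (m a * F1 a p) + 2 * ((m a)\<^sup>2 * F0 a)" for a
    proof -
      have "?d a * ?d b * F2 a b + 2 * (?d a * m b + m a * ?d b) * F1 a b + (2 * m a * m b) * ?F0 a b
        = ?d b * (?d a * F2 a b + 2 * m a * F1 a b) + 2 * ?d a * (m b * F1 a b) + (if a = b then 2 * ((m a)\<^sup>2 * F0 a) else 0)" for b
        by (simp add: power2_eq_square)
      then show ?thesis by (simp only: sum.distrib sum_distrib_left[symmetric] one) (simp add: sum_distrib_left)
    qed
    then have "(\<Sum>a\<in>UNIV. \<Sum>b\<in>UNIV. ?d a * ?d b * F2 a b + 2 * (?d a * m b + m a * ?d b) * F1 a b + (2 * m a * m b) * ?F0 a b)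
      = (\<Sum>a\<in>UNIV. ?d a * (F2 a p + 2 * (\<Sum>b\<in>UNIV. m b * F1 a b)) + 2 * (m a * F1 a p) + 2 * ((m a)\<^sup>2 * F0 a))" by simp
    also have "\<dots> = F2 p p + 2 * (\<Sum>b\<in>UNIV. m b * F1 p b) + 2 * (\<Sum>a\<in>UNIV. m a * F1 a p) + 2 * (\<Sum>a\<in>UNIV. (m a)\<^sup>2 * F0 a)"
      by (simp only: sum.distrib sum_distrib_left[symmetric] one)
    finally show ?thesis using sym by simp
  qed
  have t: "(\<Sum>a\<in>UNIV. m a * F1 p a) = (\<Sum>a\<in>UNIV - {p}. m a * F1 p a)" "(\<Sum>a\<in>UNIV. (m a)\<^sup>2 * F0 a) = (\<Sum>a\<in>UNIV - {p}. (m a)\<^sup>2 * F0 a)"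
    using mp by (simp_all add: sum_split_at[of _ p])
  have "jet2 (\<lambda>t. \<Sum>a\<in>UNIV. \<Sum>b\<in>UNIV. ((if a = p then 1 else 0) + t * m a) * ((if b = p then 1 else 0) + t * m b) * F a b t)
     (\<Sum>a\<in>UNIV. \<Sum>b\<in>UNIV. ?d a * ?d b * ?F0 a b)
     (\<Sum>a\<in>UNIV. \<Sum>b\<in>UNIV. ?d a * ?d b * F1 a b + (?d a * m b + m a * ?d b) * ?F0 a b)
     (\<Sum>a\<in>UNIV. \<Sum>b\<in>UNIV. ?d a * ?d b * F2 a b + 2 * (?d a * m b + m a * ?d b) * F1 a b + (2 * m a * m b) * ?F0 a b)"
    by (intro jet2_sum j)
  then show ?thesis unfolding s0 s1 s2 t .
qed

text \<open>In the frame of the base point the flat metric has the matrix \<open>\<delta> - q q\<close> with inverse \<open>\<delta> + w^2 q q\<close>, so the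
  expression under the root is \<open>1 + |Du|^2\<close> along the line.\<close>

lemma jet2_slope:
  fixes U1 :: "'n::finite \<Rightarrow> real \<Rightarrow> real"
  assumes j: "\<And>a. jet2 (U1 a) (q a) (if a = c then - yc else 0) (v3 a)"
    and w: "w * \<theta> = 1" "w > 0" and q: "(\<Sum>a\<in>UNIV. (q a)\<^sup>2) = 1 - \<theta>\<^sup>2"
  defines "D \<equiv> - q c * yc" and "L \<equiv> yc\<^sup>2 * (\<theta>\<^sup>2 - (q c)\<^sup>2) + (\<Sum>a\<in>UNIV. q a * v3 a)"
  shows "jet2 (\<lambda>t. sqrt (1 + (\<Sum>a\<in>UNIV. (U1 a t)\<^sup>2) + w\<^sup>2 * (\<Sum>a\<in>UNIV. q a * U1 a t)\<^sup>2))
     w (w * D) (w * (L + D\<^sup>2))"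
proof -
  define T where "T = (\<Sum>a\<in>UNIV. q a * v3 a)"
  have th: "w\<^sup>2 * \<theta>\<^sup>2 = 1" using w by (simp add: power_mult_distrib[symmetric])
  have j1: "jet2 (\<lambda>t. \<Sum>a\<in>UNIV. (U1 a t)\<^sup>2) (1 - \<theta>\<^sup>2) (2 * D) (2 * yc\<^sup>2 + 2 * T)"
  proof (rule jet2_eq[OF jet2_sum[OF jet2_square[OF j]]])
    show "(\<Sum>a\<in>UNIV. (q a)\<^sup>2) = 1 - \<theta>\<^sup>2" by (rule q)
    show "(\<Sum>a\<in>UNIV. 2 * q a * (if a = c then - yc else 0)) = 2 * D"
      by (simp add: D_def if_distrib cong: if_cong)
    show "(\<Sum>a\<in>UNIV. 2 * (if a = c then - yc else 0)\<^sup>2 + 2 * q a * v3 a) = 2 * yc\<^sup>2 + 2 * T"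
      by (simp add: sum.distrib T_def sum_distrib_left mult.assoc if_distrib[of "\<lambda>z. z\<^sup>2"] if_distrib[of "\<lambda>z. 2 * z"] cong: if_cong)
  qed
  have j2: "jet2 (\<lambda>t. \<Sum>a\<in>UNIV. q a * U1 a t) (1 - \<theta>\<^sup>2) D T"
  proof (rule jet2_eq[OF jet2_sum[OF jet2_cmult[OF j]]])
    show "(\<Sum>a\<in>UNIV. q a * q a) = 1 - \<theta>\<^sup>2" using q by (simp add: power2_eq_square)
    show "(\<Sum>a\<in>UNIV. q a * (if a = c then - yc else 0)) = D"
      by (simp add: D_def if_distrib cong: if_cong)
  qed (simp add: T_def)
  have j3: "jet2 (\<lambda>t. 1 + (\<Sum>a\<in>UNIV. (U1 a t)\<^sup>2) + w\<^sup>2 * (\<Sum>a\<in>UNIV. q a * U1 a t)\<^sup>2)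
     (w\<^sup>2) (2 * w\<^sup>2 * D) (2 * w\<^sup>2 * (L + 2 * D\<^sup>2))"
  proof (rule jet2_eq[OF jet2_add[OF jet2_add[OF jet2_const j1] jet2_cmult[OF jet2_square[OF j2], of "w\<^sup>2"]]])
    show "1 + (1 - \<theta>\<^sup>2) + w\<^sup>2 * (1 - \<theta>\<^sup>2)\<^sup>2 = w\<^sup>2" using th by algebra
    show "0 + 2 * D + w\<^sup>2 * (2 * (1 - \<theta>\<^sup>2) * D) = 2 * w\<^sup>2 * D" using th by algebra
    show "0 + (2 * yc\<^sup>2 + 2 * T) + w\<^sup>2 * (2 * D\<^sup>2 + 2 * (1 - \<theta>\<^sup>2) * T) = 2 * w\<^sup>2 * (L + 2 * D\<^sup>2)"
      unfolding L_def T_def[symmetric] D_def using th by algebra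
  qed
  have sq: "sqrt (w\<^sup>2) = w" using w by simp
  show ?thesis
  proof (rule jet2_eq[OF jet2_sqrt[OF j3]], goal_cases)
    case 1 then show ?case using w by simp
  next
    case 2 then show ?case using sq by simp
  next
    case 3 show ?case unfolding sq using w by (simp add: power2_eq_square)
  next
    case 4 show ?case unfolding sq using w by (simp add: field_simps power2_eq_square)
  qed
qed

text \<open>The hypotheses collect what a maximum of the test function provides in a principal frame: jets of the
  normalized height and of its derivatives along the lines \<open>x0 + t e_c\<close>, constancy of the curvature
  function, and the maximum property against simultaneous motion of the point and rotation of the direction.
  The condition on \<open>v4\<close> is the commutation of fourth derivatives, which turns the second derivative
  of the top curvature in the direction \<open>c\<close> into that of the \<open>c\<close>-th curvature in the top direction.\<close>

lemma critical_jets_bound: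
  fixes \<kappa> q :: "'n::finite \<Rightarrow> real" and w \<theta> \<sigma> :: real and p :: 'n
    and U :: "'n \<Rightarrow> real \<Rightarrow> real" and U1 :: "'n \<Rightarrow> 'n \<Rightarrow> real \<Rightarrow> real" and U2 :: "'n \<Rightarrow> 'n \<Rightarrow> 'n \<Rightarrow> real \<Rightarrow> real"
  assumes m: "Suc (Suc (Suc m)) \<le> CARD('n)" and g: "garding (Suc (Suc m)) UNIV \<kappa>"
    and top: "\<And>a. \<kappa> a \<le> \<kappa> p" and w: "w * \<theta> = 1" "0 < \<sigma>" "\<sigma> \<le> \<theta>" "\<theta> \<le> 1"
    and q: "(\<Sum>a\<in>UNIV. (q a)\<^sup>2) = 1 - \<theta>\<^sup>2"
  defines "N \<equiv> real (CARD('n)) - real (Suc m)" and "b \<equiv> 1 + 1 / (real (CARD('n)) - real (Suc m))"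
  defines "y \<equiv> \<lambda>a. 1 - w * \<kappa> a"
  defines "v2 \<equiv> \<lambda>a c. if a = c then - y a else 0"
  assumes jU: "\<And>c. jet2 (U c) 1 (q c) (v2 c c)"
    and jU1: "\<And>c a. jet2 (U1 c a) (q a) (v2 a c) (v3 a c c)"
    and jU2: "\<And>c a d. jet2 (U2 c a d) (v2 a d) (v3 a d c) (v4 a d c)"
    and v3: "\<And>a d c. v3 a d c = v3 d a c" "\<And>a d c. v3 a d c = v3 a c d"
    and v4: "\<And>c. v4 p p c = v4 c c p"
  defines "gg \<equiv> \<lambda>c a d t. (if a = d then 1 else 0) - q a * q d + U1 c a t * U1 c d t"
  defines "CC \<equiv> \<lambda>c a d t. gg c a d t + U c t * U2 c a d t"
  defines "ww \<equiv> \<lambda>c t. sqrt (1 + (\<Sum>a\<in>UNIV. (U1 c a t)\<^sup>2) + w\<^sup>2 * (\<Sum>a\<in>UNIV. q a * U1 c a t)\<^sup>2)"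
  assumes level: "\<And>c. \<forall>\<^sub>F t in nhds 0. \<exists>\<Lambda> (\<mu> :: 'n \<Rightarrow> real).
      (\<forall>s. det (s *\<^sub>R (\<chi> i j. ww c t / w * gg c i j t) - (\<chi> i j. CC c i j t / w)) = \<Lambda> * (\<Prod>i\<in>UNIV. s - \<mu> i))
        \<and> es (Suc (Suc m)) UNIV \<mu> = es (Suc (Suc m)) UNIV \<kappa>"
    and max: "\<And>c m. m p = 0 \<Longrightarrow> \<forall>\<^sub>F t in nhds 0.
      (\<Sum>a\<in>UNIV. \<Sum>d\<in>UNIV. ((if a = p then 1 else 0) + t * m a) * ((if d = p then 1 else 0) + t * m d) * CC c a d t) * ww c t powr (b - 1)
      \<le> w * \<kappa> p * w powr (b - 1) *
       (\<Sum>a\<in>UNIV. \<Sum>d\<in>UNIV. ((if a = p then 1 else 0) + t * m a) * ((if d = p then 1 else 0) + t * m d) * gg c a d t)"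
  shows "\<kappa> p \<le> max (2 * (2 * N + 1) * (N + 1)) (4 / \<sigma>)"
proof -
  have th: "\<theta> > 0" using w by simp
  have wth: "w = 1 / \<theta>" using w th by (simp add: field_simps)
  have w0: "w > 0" "w \<noteq> 0" using th by (simp_all add: wth)
  have K0: "\<kappa> p > 0" by (rule garding_top_positive[OF _ g]) (use top in auto)
  define f where "f a = es (Suc m) (UNIV - {a}) \<kappa>" for a
  define ff where "ff a d = es m (UNIV - {a} - {d}) \<kappa>" for a d
  define \<tau> where "\<tau> a d c = (v3 a d c - (if a = c then y a * q d else 0) - (if d = c then y d * q a else 0)
     - (if a = d then y a * q c else 0)) / w" for a d c
  define D where "D c = - q c * y c" for c
  define L where "L c = (y c)\<^sup>2 * (\<theta>\<^sup>2 - (q c)\<^sup>2) + (\<Sum>a\<in>UNIV. q a * v3 a c c)" for c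
  have jw: "jet2 (ww c) w (w * D c) (w * (L c + (D c)\<^sup>2))" for c
  proof -
    have "jet2 (U1 c a) (q a) (if a = c then - y c else 0) (v3 a c c)" for a
      using jU1[of c a] by (cases "a = c") (simp_all add: v2_def)
    from jet2_slope[OF this w(1) w0(1) q] show ?thesis unfolding ww_def D_def L_def .
  qed
  define g1 where "g1 c a d = - (if a = c then y a * q d else 0) - (if d = c then y d * q a else 0)" for c a d
  define g2 where "g2 c a d = q a * v3 d c c + 2 * v2 a c * v2 d c + v3 a c c * q d" for c a d
  have jg: "jet2 (gg c a d) (if a = d then 1 else 0) (g1 c a d) (g2 c a d)" for c a d
    unfolding gg_def
  proof (rule jet2_eq[OF jet2_add[OF jet2_const jet2_mult[OF jU1 jU1]]])
    show "0 + (q a * v2 d c + v2 a c * q d) = g1 c a d" by (auto simp: g1_def v2_def)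
  qed (simp_all add: g2_def)
  have Cv: "g1 c a d + (q c * v2 a d + v3 a d c) = w * \<tau> a d c" for c a d
    using w0 by (auto simp: g1_def v2_def \<tau>_def)
  define c2 where "c2 c a d = (g2 c a d + (v4 a d c + 2 * q c * v3 a d c + v2 c c * v2 a d)) / w" for c a d
  have jC: "jet2 (CC c a d) (if a = d then w * \<kappa> a else 0) (w * \<tau> a d c) (w * c2 c a d)" for c a d
    unfolding CC_def
  proof (rule jet2_eq[OF jet2_add[OF jg jet2_mult[OF jU jU2]]])
    show "(if a = d then 1 else 0) + 1 * v2 a d = (if a = d then w * \<kappa> a else 0)" by (auto simp: v2_def y_def)
    show "g1 c a d + (1 * v3 a d c + q c * v2 a d) = w * \<tau> a d c" unfolding Cv[symmetric] by simp
    show "g2 c a d + (1 * v4 a d c + 2 * q c * v3 a d c + v2 c c * v2 a d) = w * c2 c a d"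
      using w0 by (simp add: c2_def)
  qed
  define G where "G c t = (\<chi> i j. ww c t / w * gg c i j t)" for c t
  define C where "C c t = (\<chi> i j. CC c i j t / w)" for c t
  define G1 where "G1 c a d = (if a = d then D c else 0) + g1 c a d" for c a d
  define G2 where "G2 c a d = (if a = d then L c + (D c)\<^sup>2 else 0) + 2 * D c * g1 c a d + g2 c a d" for c a d
  have jG': "jet2 (\<lambda>t. G c t $ i $ j) (if i = j then 1 else 0) (G1 c i j) (G2 c i j)" for c i j
  proof -
    have "(\<lambda>t. G c t $ i $ j) = (\<lambda>t. (1 / w) * (ww c t * gg c i j t))" by (simp add: G_def)
    moreover have "jet2 (\<lambda>t. (1 / w) * (ww c t * gg c i j t)) (if i = j then 1 else 0) (G1 c i j) (G2 c i j)"
      by (rule jet2_eq[OF jet2_cmult[OF jet2_mult[OF jw jg]]]) (use w0 in \<open>auto simp: G1_def G2_def field_simps\<close>)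
    ultimately show ?thesis by simp
  qed
  have jC': "jet2 (\<lambda>t. C c t $ i $ j) (if i = j then \<kappa> i else 0) (\<tau> i j c) (c2 c i j)" for c i j
  proof -
    have "(\<lambda>t. C c t $ i $ j) = (\<lambda>t. (1 / w) * CC c i j t)" by (simp add: C_def)
    moreover have "jet2 (\<lambda>t. (1 / w) * CC c i j t) (if i = j then \<kappa> i else 0) (\<tau> i j c) (c2 c i j)"
      by (rule jet2_eq[OF jet2_cmult[OF jC]]) (use w0 in auto)
    ultimately show ?thesis by simp
  qed
  have tsym: "\<tau> a d c = \<tau> d a c" "\<tau> a d c = \<tau> a c d" for a d c
    using v3(1)[of a d c] v3(2)[of a d c] by (auto simp: \<tau>_def)
  have Gsym: "G1 c i j = G1 c j i" for c i j by (simp add: G1_def g1_def)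
  have m': "Suc (Suc m) \<le> CARD('n)" using m by simp
  note variation = sigma_variation[OF m' jG' jC' Gsym tsym(1) level[folded G_def C_def], folded f_def ff_def]
  interpret fd: frame_data \<kappa> q f \<tau> w \<theta>
  proof
    fix c
    have "f a * (\<tau> a a c - \<kappa> a * G1 c a a) = f a * \<tau> a a c - D c * (f a * \<kappa> a) - (if a = c then 2 * f c * \<kappa> c * D c else 0)" for a
      by (auto simp: G1_def g1_def D_def algebra_simps)
    then have "(\<Sum>a\<in>UNIV. f a * \<tau> a a c) - D c * (\<Sum>a\<in>UNIV. f a * \<kappa> a) - 2 * f c * \<kappa> c * D c = 0"
      using variation(1)[of c] by (simp add: sum_subtractf sum_distrib_left)
    then show "(\<Sum>a\<in>UNIV. f a * \<tau> a a c) = - q c * (1 - w * \<kappa> c) * ((\<Sum>a\<in>UNIV. f a * \<kappa> a) + 2 * f c * \<kappa> c)"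
      by (simp add: D_def y_def algebra_simps)
  qed (use w q tsym in auto)
  have fdy: "fd.y = y" by (rule ext) (simp add: fd.y_def y_def)
  have fdD: "fd.D = D" by (rule ext) (simp add: fd.D_def D_def fdy)
  have fdv3: "fd.v3 a d c = v3 a d c" for a d c
    using w0 unfolding fd.v3_def fdy \<tau>_def by (simp add: mult.commute)
  have fdL: "fd.L = L" by (rule ext) (simp add: fd.L_def L_def fdy fdv3)
  \<comment> \<open>The logarithm of the test function along \<open>x0 + t e_c\<close> in the direction \<open>e_p + t \<mu>\<close> has a local maximum at
    \<open>t = 0\<close>; its first and second derivatives are read off from the jets.\<close>
  have crit: "(w * \<tau> p p c) / (w * \<kappa> p) - g1 c p p + (b - 1) * D c = 0
    \<and> (w * c2 c p p + 4 * (\<Sum>a\<in>UNIV - {p}. \<mu> a * (w * \<tau> p a c)) + 2 * (\<Sum>a\<in>UNIV - {p}. (\<mu> a)\<^sup>2 * (w * \<kappa> a))) / (w * \<kappa> p)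
      - ((w * \<tau> p p c) / (w * \<kappa> p))\<^sup>2
      - (g2 c p p + 4 * (\<Sum>a\<in>UNIV - {p}. \<mu> a * g1 c p a) + 2 * (\<Sum>a\<in>UNIV - {p}. (\<mu> a)\<^sup>2) - (g1 c p p)\<^sup>2) + (b - 1) * L c \<le> 0"
    if mp: "\<mu> p = 0" for \<mu> c
  proof -
    define A where "A t = (\<Sum>a\<in>UNIV. \<Sum>d\<in>UNIV. ((if a = p then 1 else 0) + t * \<mu> a) * ((if d = p then 1 else 0) + t * \<mu> d) * CC c a d t)" for t
    define B where "B t = (\<Sum>a\<in>UNIV. \<Sum>d\<in>UNIV. ((if a = p then 1 else 0) + t * \<mu> a) * ((if d = p then 1 else 0) + t * \<mu> d) * gg c a d t)" for t
    have wk: "w * \<kappa> p > 0" using w0 K0 by simp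
    have jA: "jet2 A (w * \<kappa> p) (w * \<tau> p p c) (w * c2 c p p + 4 * (\<Sum>a\<in>UNIV - {p}. \<mu> a * (w * \<tau> p a c)) + 2 * (\<Sum>a\<in>UNIV - {p}. (\<mu> a)\<^sup>2 * (w * \<kappa> a)))"
      unfolding A_def by (rule jet2_quadratic_form[where F = "CC c" and ?F0.0 = "\<lambda>a. w * \<kappa> a" and ?F1.0 = "\<lambda>a d. w * \<tau> a d c"
          and ?F2.0 = "\<lambda>a d. w * c2 c a d", OF jC]) (rule arg_cong[OF tsym(1)] mp)+
    have "jet2 B 1 (g1 c p p) (g2 c p p + 4 * (\<Sum>a\<in>UNIV - {p}. \<mu> a * g1 c p a) + 2 * (\<Sum>a\<in>UNIV - {p}. (\<mu> a)\<^sup>2 * 1))"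
      unfolding B_def by (rule jet2_quadratic_form[where F = "gg c" and ?F0.0 = "\<lambda>a. 1" and ?F1.0 = "g1 c" and ?F2.0 = "g2 c", OF jg])
        (simp_all add: g1_def mp)
    then have jB: "jet2 B 1 (g1 c p p) (g2 c p p + 4 * (\<Sum>a\<in>UNIV - {p}. \<mu> a * g1 c p a) + 2 * (\<Sum>a\<in>UNIV - {p}. (\<mu> a)\<^sup>2))" by simp
    have jlnw: "jet2 (\<lambda>t. ln (ww c t)) (ln w) (D c) (L c)"
      by (rule jet2_eq[OF jet2_ln[OF jw]]) (use w0 in auto)
    have jZ: "jet2 (\<lambda>t. ln (A t) - ln (B t) + (b - 1) * ln (ww c t)) (ln (w * \<kappa> p) - ln 1 + (b - 1) * ln w)
      ((w * \<tau> p p c) / (w * \<kappa> p) - g1 c p p / 1 + (b - 1) * D c)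
      ((w * c2 c p p + 4 * (\<Sum>a\<in>UNIV - {p}. \<mu> a * (w * \<tau> p a c)) + 2 * (\<Sum>a\<in>UNIV - {p}. (\<mu> a)\<^sup>2 * (w * \<kappa> a))) / (w * \<kappa> p)
      - ((w * \<tau> p p c) / (w * \<kappa> p))\<^sup>2
      - ((g2 c p p + 4 * (\<Sum>a\<in>UNIV - {p}. \<mu> a * g1 c p a) + 2 * (\<Sum>a\<in>UNIV - {p}. (\<mu> a)\<^sup>2)) / 1 - (g1 c p p / 1)\<^sup>2) + (b - 1) * L c)"
      by (intro jet2_add jet2_diff jet2_ln jA jB jet2_cmult jlnw wk) simp
    have ev: "\<forall>\<^sub>F t in nhds 0. A t > 0 \<and> B t > 0 \<and> ww c t > 0"
      using order_tendstoD(1)[OF jet2_tendsto[OF jA] wk] order_tendstoD(1)[OF jet2_tendsto[OF jB], of 0] order_tendstoD(1)[OF jet2_tendsto[OF jw[of c]] w0(1)]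
      by (simp add: eventually_conj)
    have "\<forall>\<^sub>F t in nhds 0. ln (A t) - ln (B t) + (b - 1) * ln (ww c t) \<le> ln (A 0) - ln (B 0) + (b - 1) * ln (ww c 0)"
      using ev max[of \<mu> c, OF mp, folded A_def B_def]
    proof eventually_elim
      case (elim t)
      have "ln (A t * ww c t powr (b - 1)) \<le> ln (w * \<kappa> p * w powr (b - 1) * B t)"
        using elim wk w0 by (subst ln_le_cancel_iff) auto
      then have "ln (A t) + (b - 1) * ln (ww c t) \<le> ln (w * \<kappa> p) + (b - 1) * ln w + ln (B t)"
        using elim K0 w0 by (simp add: ln_mult ln_powr)
      then show ?case using jet2_value[OF jA] jet2_value[OF jB] jet2_value[OF jw[of c]] by simp
    qed
    from jet2_local_max[OF jZ this] show ?thesis by simp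
  qed
  have g1pp: "g1 c p p = (if c = p then 2 * D p else 0)" for c by (auto simp: g1_def D_def)
  have first: "\<tau> p p c = \<kappa> p * ((if c = p then 2 * D p else 0) - (b - 1) * D c)" for c
  proof -
    have "\<tau> p p c / \<kappa> p = (if c = p then 2 * D p else 0) - (b - 1) * D c"
      using crit[of "\<lambda>a. 0" c] w0 by (simp add: g1pp)
    then show ?thesis using K0 by (simp add: field_simps)
  qed
  \<comment> \<open>second derivative of the top entry in the direction \<open>c\<close>, traded for that of the \<open>c\<close>-th entry in the top direction\<close>
  have c2sym: "c2 c p p = c2 p c c" for c
  proof -
    have "v3 p p c = v3 c p p" "v3 c c p = v3 p c c" using v3 by metis+
    then show ?thesis by (auto simp: c2_def g2_def v4[of c] v2_def)
  qed
  have second: "(c2 p c c + 4 * (\<Sum>a\<in>UNIV - {p}. \<mu> a * \<tau> p a c) + 2 * (\<Sum>a\<in>UNIV - {p}. (\<mu> a)\<^sup>2 * \<kappa> a)) / \<kappa> p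
      - (\<tau> p p c / \<kappa> p)\<^sup>2
      - (g2 c p p + 4 * (\<Sum>a\<in>UNIV - {p}. \<mu> a * g1 c p a) + 2 * (\<Sum>a\<in>UNIV - {p}. (\<mu> a)\<^sup>2) - (g1 c p p)\<^sup>2) + (b - 1) * L c \<le> 0"
    if mp: "\<mu> p = 0" for \<mu> c
  proof -
    have "w * c2 c p p + 4 * (\<Sum>a\<in>UNIV - {p}. \<mu> a * (w * \<tau> p a c)) + 2 * (\<Sum>a\<in>UNIV - {p}. (\<mu> a)\<^sup>2 * (w * \<kappa> a))
      = w * (c2 p c c + 4 * (\<Sum>a\<in>UNIV - {p}. \<mu> a * \<tau> p a c) + 2 * (\<Sum>a\<in>UNIV - {p}. (\<mu> a)\<^sup>2 * \<kappa> a))"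
      unfolding c2sym by (simp add: distrib_left sum_distrib_left mult_ac)
    then show ?thesis using crit[of \<mu> c, OF mp] w0 by simp
  qed
  have fpos: "f a > 0" for a using garding_remove[OF _ _ g, of a] by (simp add: f_def garding_def)
  have ffpos: "ff a d \<ge> 0" if "a \<noteq> d" for a d
  proof -
    have "garding (Suc m) (UNIV - {a}) \<kappa>" by (rule garding_remove[OF _ _ g]) auto
    then have "garding m (UNIV - {a} - {d}) \<kappa>" by (rule garding_remove[rotated 2]) (use that in auto)
    then show ?thesis by (simp add: ff_def garding_def less_imp_le)
  qed
  have ffsym: "ff a d = ff d a" for a d
  proof -
    have "UNIV - {a} - {d} = UNIV - {d} - {a}" by auto
    then show ?thesis by (simp add: ff_def)
  qed
  have fdiff: "f a - f p = (\<kappa> p - \<kappa> a) * ff p a" if "a \<noteq> p" for a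
  proof -
    have "f a = \<kappa> p * ff a p + es (Suc m) (UNIV - {a} - {p}) \<kappa>"
      unfolding f_def ff_def using that by (intro es_remove) auto
    moreover have "f p = \<kappa> a * ff p a + es (Suc m) (UNIV - {p} - {a}) \<kappa>"
      unfolding f_def ff_def using that by (intro es_remove) auto
    moreover have "UNIV - {p} - {a} = UNIV - {a} - {p}" by auto
    ultimately show ?thesis using ffsym[of p a] by (simp add: algebra_simps)
  qed
  have G1eq: "G1 p a c = (if a = c then D p else 0) - (if a = p then y p * q c else 0) - (if c = p then y p * q a else 0)" for a c
    by (auto simp: G1_def g1_def)
  have G2eq: "G2 p c c = (L p + (D p)\<^sup>2) + 2 * D p * (if c = p then 2 * D p else 0)
      + (if c = p then 2 * (y p)\<^sup>2 else 0) + 2 * q c * v3 c p p" for c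
    by (auto simp: G2_def g1_def g2_def v2_def D_def power2_eq_square)
  have max_p: "(c2 p p p + 4 * (\<Sum>a\<in>UNIV - {p}. \<mu> a * \<tau> p a p) + 2 * (\<Sum>a\<in>UNIV - {p}. (\<mu> a)\<^sup>2 * \<kappa> a)) / \<kappa> p
      - (\<tau> p p p / \<kappa> p)\<^sup>2 - (2 * (\<Sum>a\<in>UNIV - {p}. (\<mu> a)\<^sup>2) + 2 * (y p)\<^sup>2 - 4 * y p * (\<Sum>a\<in>UNIV - {p}. \<mu> a * q a) + 2 * q p * v3 p p p)
      + (2 * D p)\<^sup>2 + (b - 1) * L p \<le> 0" for \<mu>
  proof -
    let ?\<mu> = "\<lambda>a. if a = p then 0 else \<mu> a"
    have off: "(\<Sum>a\<in>UNIV - {p}. ?\<mu> a * h a) = (\<Sum>a\<in>UNIV - {p}. \<mu> a * h a)" "(\<Sum>a\<in>UNIV - {p}. (?\<mu> a)\<^sup>2 * h a) = (\<Sum>a\<in>UNIV - {p}. (\<mu> a)\<^sup>2 * h a)"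
      "(\<Sum>a\<in>UNIV - {p}. (?\<mu> a)\<^sup>2) = (\<Sum>a\<in>UNIV - {p}. (\<mu> a)\<^sup>2)" for h
      by (intro sum.cong; simp)+
    have "(\<Sum>a\<in>UNIV - {p}. \<mu> a * g1 p p a) = - y p * (\<Sum>a\<in>UNIV - {p}. \<mu> a * q a)"
      unfolding sum_distrib_left by (intro sum.cong refl) (simp add: g1_def)
    moreover have "g2 p p p = 2 * (y p)\<^sup>2 + 2 * q p * v3 p p p" by (simp add: g2_def v2_def power2_eq_square)
    ultimately show ?thesis using second[of ?\<mu> p] unfolding off g1pp by simp
  qed
  have max_c: "(c2 p c c + 4 * M * \<tau> p c c + 2 * M\<^sup>2 * \<kappa> c) / \<kappa> p
      - (\<tau> p p c / \<kappa> p)\<^sup>2 - (2 * M\<^sup>2 - 4 * q p * M * y c + 2 * q p * v3 p c c) + (b - 1) * L c \<le> 0" if c: "c \<noteq> p" for c M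
  proof -
    let ?\<mu> = "\<lambda>a. if a = c then M else 0"
    have one: "(\<Sum>a\<in>UNIV - {p}. ?\<mu> a * h a) = M * h c" "(\<Sum>a\<in>UNIV - {p}. (?\<mu> a)\<^sup>2 * h a) = M\<^sup>2 * h c" "(\<Sum>a\<in>UNIV - {p}. (?\<mu> a)\<^sup>2) = M\<^sup>2" for h
      using c by (simp_all add: if_distrib[of "\<lambda>z. z\<^sup>2"] if_distrib[of "\<lambda>z. z * _"] cong: if_cong)
    have "g1 c p c = - y c * q p" using c by (simp add: g1_def)
    moreover have "g2 c p p = 2 * q p * v3 p c c" using c by (simp add: g2_def v2_def)
    moreover have "?\<mu> p = 0" using c by simp
    ultimately show ?thesis using second[of ?\<mu> c] c unfolding one g1pp by (simp add: mult_ac)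
  qed
  let ?\<xi> = "\<lambda>a. \<tau> a a p - \<kappa> a * G1 p a a"
  have bal: "2 * (\<Sum>a\<in>UNIV - {p}. f a * ((?\<xi> a)\<^sup>2 / (\<kappa> p - \<kappa> a + 1))) - (\<Sum>a\<in>UNIV. \<Sum>c\<in>UNIV - {a}. ff a c * (?\<xi> a * ?\<xi> c))
      + 2 * (\<Sum>a\<in>UNIV - {p}. f a * ((b * \<kappa> p * q a * y a)\<^sup>2 / (\<kappa> p - \<kappa> a + 1))) + fd.S1 * (1 + (\<kappa> p)\<^sup>2) - \<kappa> p * (fd.S0 + fd.S2)
    + \<kappa> p * (- b\<^sup>2 * (\<Sum>a\<in>UNIV. f a * ((q a)\<^sup>2 * (y a)\<^sup>2)) + b * (fd.S0 + fd.S2 - fd.S1 * (w + \<theta>))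
       + (\<Sum>a\<in>UNIV. f a * ((q a)\<^sup>2 * (b * (y a)\<^sup>2 - 2 * b * y a)))) \<le> 0"
    "?\<xi> p = b * \<kappa> p * q p * y p"
    unfolding G1eq
    by (rule fd.balance[where \<delta> = 1 and ff = ff and ?C2.0 = "\<lambda>a. c2 p a a", unfolded fdy fdD fdL fdv3];
        (rule K0 top first[unfolded fdD] | use ffpos ffsym fpos fdiff max_p max_c variation(1)[of p] variation(2)[of p] in
        \<open>simp add: G1eq G2eq less_imp_le\<close>))+
  show ?thesis
    unfolding N_def
    by (rule critical_bound[OF m g top w, where \<xi> = ?\<xi> and q = q])
      (use bal variation(1)[of p] q th in \<open>simp_all add: b_def y_def f_def ff_def fd.S0_def fd.S1_def fd.S2_def\<close>)
qed


section \<open>Principal frames of a graph\<close>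

definition diag :: "('n \<Rightarrow> real) \<Rightarrow> real^'n^'n::finite" where
  "diag l = (\<chi> i j. if i = j then l i else 0)"

text \<open>This is \<open>slope_w q * z^2\<close> times the second fundamental form of the graph at height \<open>z\<close>; \<open>rank1 1 q\<close> is
  \<open>z^2\<close> times the first one.  Both are polynomial in the derivatives of the height.\<close>

definition cmat :: "real \<Rightarrow> real^'n::finite \<Rightarrow> real^'n^'n \<Rightarrow> real^'n^'n" where
  "cmat z q r = rank1 1 q + z *\<^sub>R r"

lemma spectral_decomposition:
  fixes A :: "real^'n^'n::finite"
  assumes "transpose A = A"
  obtains Q :: "real^'n^'n" and l :: "'n \<Rightarrow> real" where "orthogonal_matrix Q" "transpose Q ** A ** Q = diag l"
proof -
  obtain B where B: "pairwise orthogonal B" "\<forall>v\<in>B. norm v = 1 \<and> (\<exists>c. A *v v = c *\<^sub>R v)"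
    "card B = CARD('n)" "finite B"
    using symmetric_eigenbasis[OF assms] by blast
  then obtain f :: "'n \<Rightarrow> real^'n" where f: "bij_betw f UNIV B"
    by (metis finite_same_card_bij finite_class.finite_UNIV)
  define Q :: "real^'n^'n" where "Q = (\<chi> i j. f j $ i)"
  have fB: "f j \<in> B" for j using f by (auto simp: bij_betw_def)
  then have "\<forall>j. \<exists>c. A *v f j = c *\<^sub>R f j" using B(2) by blast
  then obtain l where l: "\<And>j. A *v f j = l j *\<^sub>R f j" by metis
  have "orthogonal_matrix Q"
    unfolding orthogonal_matrix_orthonormal_columns
  proof (intro conjI allI impI)
    show "norm (column i Q) = 1" for i using B(2) fB by (simp add: Q_def column_def)
    show "orthogonal (column i Q) (column j Q)" if "i \<noteq> j" for i j
    proof -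
      have "f i \<noteq> f j" using f that by (auto simp: bij_betw_def inj_eq)
      then show ?thesis using B(1) fB by (simp add: Q_def column_def pairwise_def)
    qed
  qed
  moreover have "A ** Q = Q ** diag l"
  proof -
    have "(A ** Q) $ i $ j = (A *v f j) $ i" for i j
      by (simp add: matrix_matrix_mult_def matrix_vector_mult_def Q_def)
    moreover have "(Q ** diag l) $ i $ j = l j * f j $ i" for i j
      by (simp add: matrix_matrix_mult_def Q_def diag_def if_distrib cong: if_cong)
    ultimately show ?thesis by (simp add: vec_eq_iff l)
  qed
  ultimately have "transpose Q ** A ** Q = diag l"
    by (simp add: matrix_mul_assoc[symmetric]) (simp add: matrix_mul_assoc orthogonal_matrix_def)
  with \<open>orthogonal_matrix Q\<close> show ?thesis by (rule that)
qed

lemma es_eq_of_root_products: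
  fixes l \<mu> :: "'n::finite \<Rightarrow> real"
  assumes "\<And>t. (\<Prod>i\<in>UNIV. t - l i) = (\<Prod>i\<in>UNIV. t - \<mu> i)"
  shows "es k UNIV l = es k UNIV \<mu>"
proof (cases "k \<le> CARD('n)")
  case True
  have p: "poly (rootpoly UNIV (\<lambda>i. - x i)) t = (\<Prod>i\<in>UNIV. t - x i)" for x :: "'n \<Rightarrow> real" and t
    by (simp add: rootpoly_def poly_prod)
  have "poly (rootpoly UNIV (\<lambda>i. - l i)) = poly (rootpoly UNIV (\<lambda>i. - \<mu> i))"
    using assms by (simp add: fun_eq_iff p)
  then have "rootpoly UNIV (\<lambda>i. - l i) = rootpoly UNIV (\<lambda>i. - \<mu> i)" by (simp add: poly_eq_poly_eq_iff)
  then have "es k UNIV (\<lambda>i. - l i) = es k UNIV (\<lambda>i. - \<mu> i)"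
    using coeff_rootpoly[OF _ True, of "\<lambda>i. - l i"] coeff_rootpoly[OF _ True, of "\<lambda>i. - \<mu> i"] by simp
  then show ?thesis by (simp add: es_uminus)
qed (simp add: es_too_large)

lemma esym_eq_es: "esym j v = es j UNIV (\<lambda>i. v $ i)"
  by (simp add: esym_def es_def)

text \<open>Newton's power sum identity.  It makes the norm of the curvature vector independent of the order of the
  curvatures.\<close>

lemma sum_squares_es:
  fixes x :: "'n::finite \<Rightarrow> real"
  shows "(\<Sum>i\<in>UNIV. (x i)\<^sup>2) = (es 1 UNIV x)\<^sup>2 - 2 * es 2 UNIV x"
proof -
  have e1: "es 1 UNIV x = x i + es 1 (UNIV - {i}) x" for i using es_remove[of UNIV i 0 x] by simp
  have "2 * es 2 UNIV x = (\<Sum>i\<in>UNIV. x i * es 1 (UNIV - {i}) x)"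
    using es_euler[of UNIV x 1] by (simp add: numeral_2_eq_2)
  also have "\<dots> = (\<Sum>i\<in>UNIV. es 1 UNIV x * x i - (x i)\<^sup>2)"
  proof (intro sum.cong refl)
    fix i show "x i * es 1 (UNIV - {i}) x = es 1 UNIV x * x i - (x i)\<^sup>2"
      unfolding e1[of i] by (simp add: algebra_simps power2_eq_square)
  qed
  also have "\<dots> = es 1 UNIV x * (\<Sum>i\<in>UNIV. x i) - (\<Sum>i\<in>UNIV. (x i)\<^sup>2)"
    by (simp add: sum_subtractf sum_distrib_left)
  also have "(\<Sum>i\<in>UNIV. x i) = es 1 UNIV x" using es_euler[of UNIV x 0] by simp
  finally show ?thesis by (simp add: power2_eq_square)
qed

lemma transpose_rank1: "transpose (rank1 a q) = rank1 a q"
  by (simp add: rank1_def transpose_def vec_eq_iff mult_ac)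

lemma transpose_gamma: "transpose (gamma_mat q) = gamma_mat q"
  by (simp add: gamma_rank1 transpose_rank1)

lemma gamma_gamma: "gamma_mat q ** gamma_mat q = rank1 (- 1 / (slope_w q)\<^sup>2) q"
proof -
  define w where "w = slope_w q"
  have w: "w \<ge> 1" "(norm q)\<^sup>2 = w\<^sup>2 - 1"
    using slope_w_ge_1[of q] slope_w_sq[of q] by (auto simp: w_def)
  have nz: "w \<noteq> 0" "1 + w \<noteq> 0" using w(1) by auto
  define c where "c = - 1 / (w * (1 + w))"
  have c: "c * (w * (1 + w)) = - 1" using nz by (simp add: c_def)
  have "(c + c + c * c * (w\<^sup>2 - 1)) * w\<^sup>2 * (1 + w) = - 1 * (1 + w)"
    using c by algebra
  then have "(c + c + c * c * (w\<^sup>2 - 1)) * w\<^sup>2 = - 1"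
    using nz(2) by (metis mult_right_cancel)
  then have "c + c + c * c * (w\<^sup>2 - 1) = - 1 / w\<^sup>2"
    using nz(1) by (simp add: field_simps)
  then have "- 1 / (w * (1 + w)) + - 1 / (w * (1 + w)) + - 1 / (w * (1 + w)) * (- 1 / (w * (1 + w))) * (w\<^sup>2 - 1) = - 1 / w\<^sup>2"
    unfolding c_def .
  then show ?thesis unfolding gamma_rank1 rank1_mult w_def[symmetric] w(2) by simp
qed

lemma gamma_metric_gamma: "gamma_mat q ** rank1 1 q ** gamma_mat q = mat 1"
proof -
  have "rank1 1 q ** gamma_mat q = gamma_mat q ** rank1 1 q"
    unfolding gamma_rank1 rank1_mult by (simp add: algebra_simps)
  then have "gamma_mat q ** rank1 1 q ** gamma_mat q = gamma_mat q ** gamma_mat q ** rank1 1 q"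
    by (metis matrix_mul_assoc)
  then show ?thesis by (simp add: gamma_gamma_metric)
qed

lemma gamma_cmat_gamma: "gamma_mat q ** cmat z q r ** gamma_mat q = slope_w q *\<^sub>R curv_mat z q r"
proof -
  have w: "slope_w q \<noteq> 0" using slope_w_ge_1[of q] by linarith
  have "gamma_mat q ** cmat z q r ** gamma_mat q
    = gamma_mat q ** rank1 1 q ** gamma_mat q + z *\<^sub>R (gamma_mat q ** r ** gamma_mat q)"
    by (simp add: cmat_def matrix_add_ldistrib matrix_add_left matrix_scaleR_left matrix_scaleR_right)
  then show ?thesis using w by (simp add: gamma_metric_gamma curv_mat_eq)
qed

lemma det_gamma_nonzero: "det (gamma_mat q) \<noteq> 0"
  using arg_cong[OF gamma_metric_gamma[of q], of det] by (auto simp: det_mul)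

lemma det_scaleR: "det (c *\<^sub>R A) = c ^ CARD('n) * det A" for A :: "real^'n^'n::finite"
proof -
  have "c *\<^sub>R A = (c *\<^sub>R mat 1) ** A" by (simp add: matrix_scaleR_left)
  moreover have "det (c *\<^sub>R mat 1 :: real^'n^'n) = c ^ CARD('n)"
    by (subst det_diagonal) (auto simp: mat_def)
  ultimately show ?thesis by (simp add: det_mul)
qed

text \<open>Conjugation with \<open>gamma_mat\<close>, the inverse square root of the metric, turns the pencil of the two
  fundamental forms into the characteristic matrix of \<open>curv_mat\<close>.\<close>

lemma pencil_charpoly:
  fixes r :: "real^'n^'n::finite"
  assumes r: "transpose r = r"
  obtains \<Lambda> where "\<And>s. det ((s * slope_w q) *\<^sub>R rank1 1 q - cmat z q r) = \<Lambda> * (\<Prod>i\<in>UNIV. s - eigvals (curv_mat z q r) $ i)"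
proof -
  define w where "w = slope_w q"
  define \<gamma> where "\<gamma> = gamma_mat q"
  have "det \<gamma> * det ((s * w) *\<^sub>R rank1 1 q - cmat z q r) * det \<gamma>
      = w ^ CARD('n) * (\<Prod>i\<in>UNIV. s - eigvals (curv_mat z q r) $ i)" for s
  proof -
    have "\<gamma> ** ((s * w) *\<^sub>R rank1 1 q - cmat z q r) ** \<gamma> = (s * w) *\<^sub>R (\<gamma> ** rank1 1 q ** \<gamma>) - \<gamma> ** cmat z q r ** \<gamma>"
      by (simp add: matrix_diff_left matrix_diff_right matrix_scaleR_left matrix_scaleR_right)
    also have "\<dots> = w *\<^sub>R (mat s - curv_mat z q r)"
      unfolding \<gamma>_def gamma_metric_gamma gamma_cmat_gamma w_def[symmetric]
      by (simp add: mat_scaleR[of s] scaleR_diff_right mult.commute)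
    finally have "det (\<gamma> ** ((s * w) *\<^sub>R rank1 1 q - cmat z q r) ** \<gamma>) = w ^ CARD('n) * det (mat s - curv_mat z q r)"
      by (simp only: det_scaleR)
    then show ?thesis by (simp add: det_mul eigvals_symmetric[OF curv_mat_symmetric[OF r]])
  qed
  then have "det ((s * w) *\<^sub>R rank1 1 q - cmat z q r) = w ^ CARD('n) / (det \<gamma>)\<^sup>2 * (\<Prod>i\<in>UNIV. s - eigvals (curv_mat z q r) $ i)" for s
    using det_gamma_nonzero[of q] unfolding \<gamma>_def by (simp add: field_simps power2_eq_square)
  then show ?thesis unfolding w_def by (rule that)
qed

text \<open>The columns of \<open>P = z * gamma Q\<close>, with \<open>Q\<close> an orthonormal eigenbasis of \<open>curv_mat\<close>, are principal
  directions of hyperbolic length one.  The curvatures \<open>l\<close> are ordered like the frame and need not be ordered like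
  \<open>eigvals\<close>, so they are compared through symmetric functions only.\<close>

lemma eigenframe:
  fixes r :: "real^'n^'n::finite"
  assumes r: "transpose r = r" and z: "z > 0"
  shows "\<exists>(P :: real^'n^'n) (l :: 'n \<Rightarrow> real). transpose P ** rank1 1 q ** P = z\<^sup>2 *\<^sub>R mat 1
    \<and> transpose P ** cmat z q r ** P = (slope_w q * z\<^sup>2) *\<^sub>R diag l
    \<and> P ** transpose P = z\<^sup>2 *\<^sub>R rank1 (- 1 / (slope_w q)\<^sup>2) q
    \<and> (\<forall>k. es k UNIV l = esym k (eigvals (curv_mat z q r)))
    \<and> (\<Sum>i\<in>UNIV. (l i)\<^sup>2) = (\<Sum>i\<in>UNIV. \<Sum>j\<in>UNIV. (curv_mat z q r $ i $ j)\<^sup>2)"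
proof -
  define A where "A = curv_mat z q r"
  have A: "transpose A = A" unfolding A_def by (rule curv_mat_symmetric[OF r])
  obtain Q l where Q: "orthogonal_matrix Q" "transpose Q ** A ** Q = diag l"
    using spectral_decomposition[OF A] by blast
  have QQ: "transpose Q ** Q = mat 1" "Q ** transpose Q = mat 1" using Q(1) by (auto simp: orthogonal_matrix_def)
  define P where "P = z *\<^sub>R (gamma_mat q ** Q)"
  have tP: "transpose P = z *\<^sub>R (transpose Q ** gamma_mat q)"
    by (simp add: P_def transpose_scalar matrix_transpose_mul transpose_gamma)
  have conj: "transpose P ** M ** P = z\<^sup>2 *\<^sub>R (transpose Q ** (gamma_mat q ** M ** gamma_mat q) ** Q)" for M
    unfolding tP unfolding P_def matrix_scaleR_left matrix_scaleR_right scaleR_scaleR matrix_mul_assoc power2_eq_square ..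
  show ?thesis
  proof (intro exI conjI allI)
    show "transpose P ** rank1 1 q ** P = z\<^sup>2 *\<^sub>R mat 1" by (simp add: conj gamma_metric_gamma QQ)
    show "transpose P ** cmat z q r ** P = (slope_w q * z\<^sup>2) *\<^sub>R diag l"
      by (simp add: conj gamma_cmat_gamma Q(2)[symmetric] A_def matrix_scaleR_left matrix_scaleR_right mult.commute)
    have "P ** transpose P = z\<^sup>2 *\<^sub>R (gamma_mat q ** (Q ** transpose Q) ** gamma_mat q)"
      unfolding tP unfolding P_def by (simp add: matrix_scaleR_left matrix_scaleR_right matrix_mul_assoc power2_eq_square)
    then show "P ** transpose P = z\<^sup>2 *\<^sub>R rank1 (- 1 / (slope_w q)\<^sup>2) q"
      by (simp add: QQ gamma_gamma)
    have AQ: "A ** Q = Q ** diag l"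
      unfolding Q(2)[symmetric] by (simp add: matrix_mul_assoc QQ)
    have cp: "(\<Prod>i\<in>UNIV. t - l i) = (\<Prod>i\<in>UNIV. t - eigvals A $ i)" for t
    proof -
      have "det Q \<noteq> 0" using det_orthogonal_matrix[OF Q(1)] by auto
      from charpoly_similar[OF this AQ, of t] have "(\<Prod>i\<in>UNIV. t - eigvals A $ i) = det (mat t - diag l)"
        by (simp add: eigvals_symmetric[OF A])
      also have "\<dots> = (\<Prod>i\<in>UNIV. t - l i)"
        by (subst det_diagonal) (auto simp: diag_def mat_def)
      finally show ?thesis by simp
    qed
    show "es k UNIV l = esym k (eigvals (curv_mat z q r))" for k
      unfolding esym_eq_es A_def[symmetric] by (rule es_eq_of_root_products[OF cp])
    have "(\<Sum>i\<in>UNIV. (l i)\<^sup>2) = trace (diag l ** diag l)"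
      by (simp add: trace_def matrix_matrix_mult_def diag_def power2_eq_square if_distrib cong: if_cong)
    also have "diag l ** diag l = transpose Q ** (A ** A ** Q)"
    proof -
      have "diag l ** diag l = transpose Q ** A ** (Q ** transpose Q) ** A ** Q"
        unfolding Q(2)[symmetric] matrix_mul_assoc ..
      then show ?thesis unfolding QQ(2) by (simp add: matrix_mul_assoc)
    qed
    also have "trace \<dots> = trace ((A ** A ** Q) ** transpose Q)" by (rule trace_mul_sym)
    also have "(A ** A ** Q) ** transpose Q = A ** transpose A"
      by (simp add: matrix_mul_assoc[symmetric] QQ A)
    also have "trace (A ** transpose A) = (\<Sum>i\<in>UNIV. \<Sum>j\<in>UNIV. (A $ i $ j)\<^sup>2)"
      by (simp add: trace_def matrix_matrix_mult_def transpose_def power2_eq_square)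
    finally show "(\<Sum>i\<in>UNIV. (l i)\<^sup>2) = (\<Sum>i\<in>UNIV. \<Sum>j\<in>UNIV. (curv_mat z q r $ i $ j)\<^sup>2)" unfolding A_def .
  qed
qed

lemma norm_kappa:
  fixes r :: "real^'n^'n::finite"
  assumes "transpose r = r" "z > 0"
  shows "(norm (eigvals (curv_mat z q r)))\<^sup>2 = (\<Sum>i\<in>UNIV. \<Sum>j\<in>UNIV. (curv_mat z q r $ i $ j)\<^sup>2)"
proof -
  obtain l :: "'n \<Rightarrow> real" where l: "\<forall>k. es k UNIV l = esym k (eigvals (curv_mat z q r))"
    "(\<Sum>i\<in>UNIV. (l i)\<^sup>2) = (\<Sum>i\<in>UNIV. \<Sum>j\<in>UNIV. (curv_mat z q r $ i $ j)\<^sup>2)"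
    using eigenframe[OF assms, of q] by blast
  have "(norm (eigvals (curv_mat z q r)))\<^sup>2 = (\<Sum>i\<in>UNIV. (eigvals (curv_mat z q r) $ i)\<^sup>2)"
    unfolding power2_norm_eq_inner inner_vec_def by (simp add: power2_eq_square)
  also have "\<dots> = (\<Sum>i\<in>UNIV. (l i)\<^sup>2)" unfolding sum_squares_es using l(1) by (simp add: esym_eq_es)
  finally show ?thesis using l(2) by simp
qed

lemma frame_entry: "(transpose P ** M ** P) $ a $ d = column a P \<bullet> (M *v column d P)"
  for M P :: "real^'n^'n::finite"
proof -
  have "(transpose P ** M ** P) $ a $ d = (\<Sum>k\<in>UNIV. \<Sum>j\<in>UNIV. P $ j $ a * (M $ j $ k * P $ k $ d))"
    by (simp add: matrix_matrix_mult_def transpose_def sum_distrib_right mult.assoc)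
  also have "\<dots> = (\<Sum>j\<in>UNIV. \<Sum>k\<in>UNIV. P $ j $ a * (M $ j $ k * P $ k $ d))" by (rule sum.swap)
  also have "\<dots> = column a P \<bullet> (M *v column d P)"
    by (simp add: inner_vec_def matrix_vector_mult_def column_def sum_distrib_left)
  finally show ?thesis .
qed

lemma rank1_form: "v \<bullet> (rank1 a q *v x) = v \<bullet> x + a * ((q \<bullet> v) * (q \<bullet> x))"
proof -
  have "rank1 a q *v x = x + (a * (q \<bullet> x)) *\<^sub>R q"
  proof (simp add: vec_eq_iff, rule allI)
    fix i
    have "(rank1 a q *v x) $ i = (\<Sum>j\<in>UNIV. (if i = j then x $ j else 0) + a * q $ i * (q $ j * x $ j))"
      unfolding matrix_vector_mult_def rank1_def by (simp, intro sum.cong refl) (simp add: algebra_simps)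
    also have "\<dots> = x $ i + a * q $ i * (\<Sum>j\<in>UNIV. q $ j * x $ j)"
      by (simp only: sum.distrib sum_distrib_left[symmetric]) simp
    also have "(\<Sum>j\<in>UNIV. q $ j * x $ j) = q \<bullet> x" by (simp add: inner_vec_def)
    finally show "(rank1 a q *v x) $ i = x $ i + a * (q \<bullet> x) * q $ i" by (simp only: mult_ac)
  qed
  then show ?thesis by (simp add: inner_add_right inner_commute)
qed


section \<open>Interior maxima of the test function\<close>

definition grad :: "(real^'n::finite \<Rightarrow> real) \<Rightarrow> real^'n \<Rightarrow> real^'n" where
  "grad f x = (\<chi> i. pd i f x)"

definition hess :: "(real^'n::finite \<Rightarrow> real) \<Rightarrow> real^'n \<Rightarrow> real^'n^'n" where
  "hess f x = (\<chi> i j. pd i (pd j f) x)"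

lemma dd_grad: "dd v f x = grad f x \<bullet> v"
  by (simp add: dd_def grad_def inner_vec_def mult.commute)

lemma pd_sum:
  assumes "\<And>j. j \<in> J \<Longrightarrow> f j differentiable (at x)" "finite J"
  shows "pd i (\<lambda>y. \<Sum>j\<in>J. f j y) x = (\<Sum>j\<in>J. pd i (f j) x)"
  using assms(2,1)
proof (induction J rule: finite_induct)
  case empty
  then show ?case by (simp add: pd_def)
next
  case (insert j J)
  have "(\<lambda>y. \<Sum>j\<in>J. f j y) differentiable (at x)" using insert by (intro differentiable_sum) auto
  then show ?case using insert by (simp add: pd_add)
qed

lemma dd_hess:
  assumes f: "Ck 2 S f" and S: "open S" "x \<in> S"
  shows "dd v (dd w f) x = v \<bullet> (hess f x *v w)"
proof -
  have "pd i (dd w f) x = (\<Sum>j\<in>UNIV. w $ j * pd i (pd j f) x)" for i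
  proof -
    have d: "pd j f differentiable (at x)" for j using f S by (simp add: numeral_2_eq_2)
    have "pd i (dd w f) x = (\<Sum>j\<in>UNIV. pd i (\<lambda>y. w $ j * pd j f y) x)"
      unfolding dd_def[abs_def] using d by (intro pd_sum) auto
    then show ?thesis using d by (simp add: pd_cmult)
  qed
  then show ?thesis
    by (simp add: dd_def[of v] inner_vec_def matrix_vector_mult_def hess_def mult.commute)
qed

lemma hess_symmetric:
  assumes "Ck 2 S f" "open S" "x \<in> S"
  shows "transpose (hess f x) = hess f x"
proof -
  have "pd i (pd j f) x = pd j (pd i f) x" for i j
  proof -
    have e: "dd (axis i 1) g = pd i g" for i and g :: "real^'a \<Rightarrow> real"
      by (rule ext) (simp add: dd_def axis_def if_distrib[of "\<lambda>z. z * _"] cong: if_cong)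
    show ?thesis using dd_commute[OF assms, of "axis i 1" "axis j 1"] by (simp add: e)
  qed
  then show ?thesis by (simp add: hess_def transpose_def vec_eq_iff)
qed

lemma frame_quadratic:
  fixes P M :: "real^'n^'n::finite"
  shows "(\<Sum>a\<in>UNIV. \<Sum>d\<in>UNIV. c a * c d * (transpose P ** M ** P) $ a $ d)
    = (P *v (\<chi> a. c a)) \<bullet> (M *v (P *v (\<chi> a. c a)))"
proof -
  let ?c = "\<chi> a. c a"
  have "(P *v ?c) \<bullet> (M *v (P *v ?c)) = (\<chi> a. c a) \<bullet> ((transpose P ** M ** P) *v ?c)"
    by (metis dot_lmul_matrix matrix_vector_mul_assoc vector_transpose_matrix inner_commute transpose_matrix_vector)
  then show ?thesis
    by (simp add: inner_vec_def matrix_vector_mult_def sum_distrib_left mult_ac)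
qed

text \<open>\<open>critical_jets_bound\<close> is applied to the frame formed by the columns \<open>e a\<close> of \<open>P\<close>, with the height and its directional
  derivatives divided by the height at \<open>x0\<close>.  The frame is constant in the ambient space, so that only
  derivatives of \<open>u\<close> along straight lines occur.\<close>

lemma interior_maximum_bound:
  fixes u :: "real^'n::finite \<Rightarrow> real" and P :: "real^'n^'n" and l :: "'n \<Rightarrow> real"
  assumes m: "Suc (Suc (Suc m)) \<le> CARD('n)" and S: "open S" "x0 \<in> S" and u: "Ck 4 S u" "\<And>x. x \<in> S \<Longrightarrow> u x > 0"
    and F1: "transpose P ** rank1 1 (grad u x0) ** P = (u x0)\<^sup>2 *\<^sub>R mat 1"
    and F2: "transpose P ** cmat (u x0) (grad u x0) (hess u x0) ** P = (slope_w (grad u x0) * (u x0)\<^sup>2) *\<^sub>R diag l"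
    and F3: "P ** transpose P = (u x0)\<^sup>2 *\<^sub>R rank1 (- 1 / (slope_w (grad u x0))\<^sup>2) (grad u x0)"
    and g: "garding (Suc (Suc m)) UNIV l" and top: "\<And>a. l a \<le> l p"
    and level: "\<And>x. x \<in> S \<Longrightarrow> esym (Suc (Suc m)) (eigvals (curv_mat (u x) (grad u x) (hess u x))) = es (Suc (Suc m)) UNIV l"
    and \<sigma>: "0 < \<sigma>" "\<sigma> \<le> 1 / slope_w (grad u x0)"
  defines "N \<equiv> real (CARD('n)) - real (Suc m)" and "b \<equiv> 1 + 1 / (real (CARD('n)) - real (Suc m))"
  assumes max: "\<And>x V. x \<in> S \<Longrightarrow> (V \<bullet> (cmat (u x) (grad u x) (hess u x) *v V)) * slope_w (grad u x) powr (b - 1)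
      \<le> slope_w (grad u x0) * l p * slope_w (grad u x0) powr (b - 1) * (V \<bullet> (rank1 1 (grad u x) *v V))"
  shows "l p \<le> max (2 * (2 * N + 1) * (N + 1)) (4 / \<sigma>)"
proof -
  define z where "z = u x0"
  define G where "G x = rank1 1 (grad u x)" for x
  define C where "C x = cmat (u x) (grad u x) (hess u x)" for x
  define W where "W x = slope_w (grad u x)" for x
  define g0 where "g0 = grad u x0"
  define w where "w = W x0"
  define e where "e a = column a P" for a
  define q where "q a = (g0 \<bullet> e a) / z" for a
  define X where "X c t = x0 + t *\<^sub>R e c" for c t
  have z: "z > 0" unfolding z_def using u(2) S by blast
  have w1: "w \<ge> 1" unfolding w_def W_def by (rule slope_w_ge_1)
  have w2: "w\<^sup>2 = 1 + (norm g0)\<^sup>2" unfolding w_def W_def g0_def by (rule slope_w_sq)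
  have Gf: "(transpose P ** G x ** P) $ a $ d = e a \<bullet> e d + (grad u x \<bullet> e a) * (grad u x \<bullet> e d)" for x a d
    unfolding frame_entry G_def rank1_form e_def by simp
  have f1: "e a \<bullet> e d + (g0 \<bullet> e a) * (g0 \<bullet> e d) = (if a = d then z\<^sup>2 else 0)" for a d
    using Gf[of x0 a d, symmetric] F1 by (simp add: G_def[symmetric] z_def g0_def mat_def split: if_splits)
  have Cf: "(transpose P ** C x ** P) $ a $ d = e a \<bullet> e d + (grad u x \<bullet> e a) * (grad u x \<bullet> e d) + u x * (e a \<bullet> (hess u x *v e d))" for x a d
  proof -
    have "transpose P ** C x ** P = transpose P ** G x ** P + u x *\<^sub>R (transpose P ** hess u x ** P)"
      by (simp add: C_def cmat_def G_def matrix_add_ldistrib matrix_add_left matrix_scaleR_left matrix_scaleR_right)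
    then have "(transpose P ** C x ** P) $ a $ d = (transpose P ** G x ** P) $ a $ d + u x * (transpose P ** hess u x ** P) $ a $ d"
      by simp
    then show ?thesis unfolding Gf unfolding frame_entry e_def .
  qed
  have f2: "z * (e a \<bullet> (hess u x0 *v e d)) = (if a = d then (w * l a - 1) * z\<^sup>2 else 0)" for a d
  proof -
    have "(transpose P ** C x0 ** P) $ a $ d = w * z\<^sup>2 * (if a = d then l a else 0)"
      using F2 by (simp add: C_def w_def W_def z_def diag_def)
    then have "z * (e a \<bullet> (hess u x0 *v e d)) = w * z\<^sup>2 * (if a = d then l a else 0) - (if a = d then z\<^sup>2 else 0)"
      using Cf[of x0 a d] f1[of a d] unfolding z_def[symmetric] g0_def[symmetric] by linarith
    also have "\<dots> = (if a = d then (w * l a - 1) * z\<^sup>2 else 0)" by (simp add: algebra_simps)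
    finally show ?thesis .
  qed
  have f3: "(\<Sum>a\<in>UNIV. (h \<bullet> e a) * (k \<bullet> e a)) = z\<^sup>2 * (h \<bullet> k - (g0 \<bullet> h) * (g0 \<bullet> k) / w\<^sup>2)" for h k
  proof -
    have "(\<Sum>a\<in>UNIV. (h \<bullet> e a) * (k \<bullet> e a)) = (transpose P *v h) \<bullet> (transpose P *v k)"
      by (simp add: inner_vec_def[of "transpose P *v h"] matrix_vector_mult_def inner_vec_def e_def column_def transpose_def mult.commute)
    also have "\<dots> = h \<bullet> ((P ** transpose P) *v k)"
      by (metis dot_lmul_matrix matrix_vector_mul_assoc vector_transpose_matrix transpose_matrix_vector)
    also have "\<dots> = z\<^sup>2 * (h \<bullet> k - (g0 \<bullet> h) * (g0 \<bullet> k) / w\<^sup>2)"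
      unfolding F3 scaleR_matrix_vector_assoc[symmetric] inner_scaleR_right rank1_form by (simp add: z_def g0_def w_def W_def)
    finally show ?thesis .
  qed
  have op: "open S" by (rule S(1))
  have C4: "Ck (Suc (Suc (Suc (Suc 0)))) S u" using u(1) by (simp add: numeral_eq_Suc del: Ck.simps(2))
  have C3: "Ck (Suc (Suc (Suc 0))) S (dd v u)" for v by (rule Ck_dd[OF op C4])
  have C2: "Ck 2 S (dd v (dd v' u))" for v v' unfolding numeral_2_eq_2 by (rule Ck_dd[OF op C3])
  have C2u: "Ck 2 S u" unfolding numeral_2_eq_2 by (rule Ck_less[OF Ck_less[OF C4]])
  have C2d: "Ck 2 S (dd v u)" for v unfolding numeral_2_eq_2 by (rule Ck_less[OF C3])
  have cg: "dd v f x0 = dd v f' x0" if "\<And>x. x \<in> S \<Longrightarrow> f x = f' x" for v f f'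
    by (rule dd_cong[OF S that])
  have cg': "dd v f x = dd v f' x" if "x \<in> S" "\<And>x. x \<in> S \<Longrightarrow> f x = f' x" for v f f' x
    by (rule dd_cong[OF S(1) that])
  have sw1: "dd v (dd v' u) x = dd v' (dd v u) x" if "x \<in> S" for v v' x by (rule dd_commute[OF C2u op that])
  have sw2: "dd v (dd v' (dd v'' u)) x = dd v' (dd v (dd v'' u)) x" if "x \<in> S" for v v' v'' x by (rule dd_commute[OF C2d op that])
  have sw3: "dd v (dd v' (dd v'' (dd v3 u))) x0 = dd v' (dd v (dd v'' (dd v3 u))) x0" for v v' v'' v3 by (rule dd_commute[OF C2 op S(2)])
  define v3 where "v3 a d c = dd (e c) (dd (e a) (dd (e d) u)) x0 / z" for a d c
  define v4 where "v4 a d c = dd (e c) (dd (e c) (dd (e a) (dd (e d) u))) x0 / z" for a d c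
  have v3s: "v3 a d c = v3 d a c" "v3 a d c = v3 a c d" for a d c
  proof -
    show "v3 a d c = v3 d a c" unfolding v3_def by (rule arg_cong[where f = "\<lambda>r. r / z"], rule cg, rule sw1)
    have "dd (e c) (dd (e a) (dd (e d) u)) x0 = dd (e a) (dd (e c) (dd (e d) u)) x0" by (rule sw2[OF S(2)])
    also have "\<dots> = dd (e a) (dd (e d) (dd (e c) u)) x0" by (rule cg, rule sw1)
    also have "\<dots> = dd (e d) (dd (e a) (dd (e c) u)) x0" by (rule sw2[OF S(2)])
    finally show "v3 a d c = v3 a c d" unfolding v3_def by simp
  qed
  \<comment> \<open>only adjacent derivatives are exchanged, so \<open>C\<^sup>4\<close> regularity suffices\<close>
  have v4s: "v4 p p c = v4 c c p" for c
  proof -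
    have "dd (e c) (dd (e c) (dd (e p) (dd (e p) u))) x0 = dd (e c) (dd (e p) (dd (e c) (dd (e p) u))) x0" by (rule cg, rule sw2)
    also have "\<dots> = dd (e p) (dd (e c) (dd (e c) (dd (e p) u))) x0" by (rule sw3)
    also have "\<dots> = dd (e p) (dd (e c) (dd (e p) (dd (e c) u))) x0" by (rule cg, rule cg', assumption, rule sw1)
    also have "\<dots> = dd (e p) (dd (e p) (dd (e c) (dd (e c) u))) x0" by (rule cg, rule sw2)
    finally show ?thesis unfolding v4_def by simp
  qed
  define y where "y a = 1 - w * l a" for a
  define v2 where "v2 a c = (if a = c then - y a else 0)" for a c
  have v2: "dd (e a) (dd (e d) u) x0 / z = v2 a d" for a d
  proof -
    have "z * (dd (e a) (dd (e d) u) x0) = v2 a d * z * z"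
      unfolding dd_hess[OF C2u S] f2 by (simp add: v2_def y_def power2_eq_square)
    then show ?thesis using z by (simp add: field_simps)
  qed
  define U where "U c t = (1 / z) * u (X c t)" for c t
  define U1 where "U1 c a t = (1 / z) * dd (e a) u (X c t)" for c a t
  define U2 where "U2 c a d t = (1 / z) * dd (e a) (dd (e d) u) (X c t)" for c a d t
  have jU: "jet2 (U c) 1 (q c) (v2 c c)" for c
    unfolding U_def X_def
    by (rule jet2_eq[OF jet2_cmult[OF jet2_line[OF C2u S]]])
      (use z v2 in \<open>auto simp: z_def[symmetric] q_def dd_grad g0_def\<close>)
  have jU1: "jet2 (U1 c a) (q a) (v2 a c) (v3 a c c)" for c a
    unfolding U1_def X_def
  proof (rule jet2_eq[OF jet2_cmult[OF jet2_line[OF C2d S]]])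
    show "1 / z * dd (e a) u x0 = q a" by (simp add: q_def dd_grad g0_def)
    show "1 / z * dd (e c) (dd (e a) u) x0 = v2 a c" using v2[of c a] by (simp add: v2_def)
    show "1 / z * dd (e c) (dd (e c) (dd (e a) u)) x0 = v3 a c c"
    proof -
      have "dd (e c) (dd (e c) (dd (e a) u)) x0 = dd (e c) (dd (e a) (dd (e c) u)) x0" by (rule cg, rule sw1)
      then show ?thesis by (simp add: v3_def)
    qed
  qed
  have jU2: "jet2 (U2 c a d) (v2 a d) (v3 a d c) (v4 a d c)" for c a d
    unfolding U2_def X_def
    by (rule jet2_eq[OF jet2_cmult[OF jet2_line[OF C2 S]]]) (use v2 in \<open>auto simp: v3_def v4_def\<close>)
  have inS: "\<forall>\<^sub>F t in nhds 0. X c t \<in> S" for c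
  proof -
    have "((\<lambda>t. X c t) \<longlongrightarrow> x0 + 0 *\<^sub>R e c) (nhds 0)" unfolding X_def
      by (intro tendsto_intros filterlim_ident)
    then show ?thesis using S by (auto elim: topological_tendstoD)
  qed
  have gg: "(if a = d then 1 else 0) - q a * q d + U1 c a t * U1 c d t = (transpose P ** G (X c t) ** P) $ a $ d / z\<^sup>2" for c a d t
  proof -
    have "e a \<bullet> e d = (if a = d then z\<^sup>2 else 0) - (g0 \<bullet> e a) * (g0 \<bullet> e d)" using f1[of a d] by simp
    then show ?thesis unfolding Gf U1_def dd_grad q_def using z by (simp add: field_simps power2_eq_square)
  qed
  have CC: "(if a = d then 1 else 0) - q a * q d + U1 c a t * U1 c d t + U c t * U2 c a d t = (transpose P ** C (X c t) ** P) $ a $ d / z\<^sup>2"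
    if "X c t \<in> S" for c a d t
    unfolding gg Gf Cf U_def U2_def dd_hess[OF C2u op that] using z by (simp add: field_simps power2_eq_square)
  have ww: "sqrt (1 + (\<Sum>a\<in>UNIV. (U1 c a t)\<^sup>2) + w\<^sup>2 * (\<Sum>a\<in>UNIV. q a * U1 c a t)\<^sup>2) = W (X c t)" for c t
  proof -
    let ?g = "grad u (X c t)"
    have "(\<Sum>a\<in>UNIV. (U1 c a t)\<^sup>2) = (\<Sum>a\<in>UNIV. (?g \<bullet> e a) * (?g \<bullet> e a)) / z\<^sup>2"
      unfolding sum_divide_distrib U1_def dd_grad by (intro sum.cong refl) (simp add: power2_eq_square)
    also have "\<dots> = ?g \<bullet> ?g - (g0 \<bullet> ?g)\<^sup>2 / w\<^sup>2" unfolding f3 using z by (simp add: power2_eq_square)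
    finally have s1: "(\<Sum>a\<in>UNIV. (U1 c a t)\<^sup>2) = ?g \<bullet> ?g - (g0 \<bullet> ?g)\<^sup>2 / w\<^sup>2" .
    have "(\<Sum>a\<in>UNIV. q a * U1 c a t) = (\<Sum>a\<in>UNIV. (g0 \<bullet> e a) * (?g \<bullet> e a)) / z\<^sup>2"
      unfolding sum_divide_distrib U1_def dd_grad q_def by (intro sum.cong refl) (simp add: power2_eq_square)
    also have "\<dots> = g0 \<bullet> ?g - (g0 \<bullet> g0) * (g0 \<bullet> ?g) / w\<^sup>2" unfolding f3 using z by simp
    also have "g0 \<bullet> g0 = w\<^sup>2 - 1" using w2 by (simp add: power2_norm_eq_inner)
    also have "g0 \<bullet> ?g - (w\<^sup>2 - 1) * (g0 \<bullet> ?g) / w\<^sup>2 = (g0 \<bullet> ?g) / w\<^sup>2" using w1 by (simp add: field_simps)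
    finally have s2: "(\<Sum>a\<in>UNIV. q a * U1 c a t) = (g0 \<bullet> ?g) / w\<^sup>2" .
    have "w\<^sup>2 * ((g0 \<bullet> ?g) / w\<^sup>2)\<^sup>2 = (g0 \<bullet> ?g)\<^sup>2 / w\<^sup>2" using w1 by (simp add: field_simps power2_eq_square)
    then show ?thesis unfolding s1 s2 W_def slope_w_def by (simp add: power2_norm_eq_inner)
  qed
  have qn: "(\<Sum>a\<in>UNIV. (q a)\<^sup>2) = 1 - (1 / w)\<^sup>2"
  proof -
    have "(\<Sum>a\<in>UNIV. (q a)\<^sup>2) = (\<Sum>a\<in>UNIV. (g0 \<bullet> e a) * (g0 \<bullet> e a)) / z\<^sup>2"
      unfolding sum_divide_distrib q_def by (intro sum.cong refl) (simp add: power2_eq_square)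
    also have "\<dots> = g0 \<bullet> g0 - (g0 \<bullet> g0) * (g0 \<bullet> g0) / w\<^sup>2" unfolding f3 using z by simp
    also have "g0 \<bullet> g0 = w\<^sup>2 - 1" using w2 by (simp add: power2_norm_eq_inner)
    also have "w\<^sup>2 - 1 - (w\<^sup>2 - 1) * (w\<^sup>2 - 1) / w\<^sup>2 = 1 - (1 / w)\<^sup>2" using w1 by (simp add: field_simps power2_eq_square)
    finally show ?thesis .
  qed
  show ?thesis
    unfolding N_def
  proof (rule critical_jets_bound[where \<kappa> = l and q = q and w = w and \<theta> = "1 / w" and U = U and ?U1.0 = U1 and ?U2.0 = U2
        and ?v3.0 = v3 and ?v4.0 = v4, unfolded ww gg, OF m g top])
    show "w * (1 / w) = 1" "0 < \<sigma>" "\<sigma> \<le> 1 / w" "1 / w \<le> 1" using w1 \<sigma> by (auto simp: w_def W_def)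
    show "(\<Sum>a\<in>UNIV. (q a)\<^sup>2) = 1 - (1 / w)\<^sup>2" by (rule qn)
    show "jet2 (U c) 1 (q c) (if c = c then - (1 - w * l c) else 0)" for c using jU[of c] unfolding v2_def y_def .
    show "jet2 (U1 c a) (q a) (if a = c then - (1 - w * l a) else 0) (v3 a c c)" for c a using jU1[of c a] unfolding v2_def y_def .
    show "jet2 (U2 c a d) (if a = d then - (1 - w * l a) else 0) (v3 a d c) (v4 a d c)" for c a d using jU2[of c a d] unfolding v2_def y_def .
    show "v3 a d c = v3 d a c" "v3 a d c = v3 a c d" for a d c by (rule v3s)+
    show "v4 p p c = v4 c c p" for c by (rule v4s)
    show "\<forall>\<^sub>F t in nhds 0. \<exists>\<Lambda> (\<mu> :: 'n \<Rightarrow> real).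
      (\<forall>s. det (s *\<^sub>R (\<chi> i j. W (X c t) / w * ((transpose P ** G (X c t) ** P) $ i $ j / z\<^sup>2))
         - (\<chi> i j. ((transpose P ** G (X c t) ** P) $ i $ j / z\<^sup>2 + U c t * U2 c i j t) / w)) = \<Lambda> * (\<Prod>i\<in>UNIV. s - \<mu> i))
        \<and> es (Suc (Suc m)) UNIV \<mu> = es (Suc (Suc m)) UNIV l" for c
      using inS[of c]
    proof eventually_elim
      case (elim t)
      let ?x = "X c t"
      have CC': "(transpose P ** G ?x ** P) $ i $ j / z\<^sup>2 + U c t * U2 c i j t = (transpose P ** C ?x ** P) $ i $ j / z\<^sup>2" for i j
        using CC[OF elim, of i j] unfolding gg .
      obtain \<Lambda> where L: "\<And>s. det ((s * W ?x) *\<^sub>R G ?x - C ?x) = \<Lambda> * (\<Prod>i\<in>UNIV. s - eigvals (curv_mat (u ?x) (grad u ?x) (hess u ?x)) $ i)"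
        unfolding W_def G_def C_def using pencil_charpoly[OF hess_symmetric[OF C2u op elim]] by blast
      have "det (s *\<^sub>R (\<chi> i j. W ?x / w * ((transpose P ** G ?x ** P) $ i $ j / z\<^sup>2))
         - (\<chi> i j. ((transpose P ** G ?x ** P) $ i $ j / z\<^sup>2 + U c t * U2 c i j t) / w))
        = ((1 / (w * z\<^sup>2)) ^ CARD('n) * (det P)\<^sup>2 * \<Lambda>) * (\<Prod>i\<in>UNIV. s - eigvals (curv_mat (u ?x) (grad u ?x) (hess u ?x)) $ i)" for s
      proof -
        have "s *\<^sub>R (\<chi> i j. W ?x / w * ((transpose P ** G ?x ** P) $ i $ j / z\<^sup>2))
         - (\<chi> i j. ((transpose P ** G ?x ** P) $ i $ j / z\<^sup>2 + U c t * U2 c i j t) / w)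
         = (1 / (w * z\<^sup>2)) *\<^sub>R ((s * W ?x) *\<^sub>R (transpose P ** G ?x ** P) - transpose P ** C ?x ** P)"
          unfolding CC' using w1 z by (simp add: vec_eq_iff field_simps)
        also have "(s * W ?x) *\<^sub>R (transpose P ** G ?x ** P) - transpose P ** C ?x ** P = transpose P ** ((s * W ?x) *\<^sub>R G ?x - C ?x) ** P"
          by (simp add: matrix_diff_left matrix_diff_right matrix_scaleR_left matrix_scaleR_right)
        finally show ?thesis
          by (simp add: det_scaleR det_mul L power2_eq_square mult_ac)
      qed
      moreover have "es (Suc (Suc m)) UNIV (\<lambda>i. eigvals (curv_mat (u ?x) (grad u ?x) (hess u ?x)) $ i) = es (Suc (Suc m)) UNIV l"
        using level[OF elim] by (simp add: esym_eq_es)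
      ultimately show ?case by blast
    qed
    show "\<forall>\<^sub>F t in nhds 0.
      (\<Sum>a\<in>UNIV. \<Sum>d\<in>UNIV. ((if a = p then 1 else 0) + t * \<mu> a) * ((if d = p then 1 else 0) + t * \<mu> d) * ((transpose P ** G (X c t) ** P) $ a $ d / z\<^sup>2 + U c t * U2 c a d t))
        * W (X c t) powr (1 + 1 / (real CARD('n) - real (Suc m)) - 1)
      \<le> w * l p * w powr (1 + 1 / (real CARD('n) - real (Suc m)) - 1) *
       (\<Sum>a\<in>UNIV. \<Sum>d\<in>UNIV. ((if a = p then 1 else 0) + t * \<mu> a) * ((if d = p then 1 else 0) + t * \<mu> d) * ((transpose P ** G (X c t) ** P) $ a $ d / z\<^sup>2))" for \<mu> c
      using inS[of c]
    proof eventually_elim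
      case (elim t)
      let ?x = "X c t"
      define k where "k a = (if a = p then 1 else 0) + t * \<mu> a" for a
      define V where "V = P *v (\<chi> a. k a)"
      have CC': "(transpose P ** G ?x ** P) $ i $ j / z\<^sup>2 + U c t * U2 c i j t = (transpose P ** C ?x ** P) $ i $ j / z\<^sup>2" for i j
        using CC[OF elim, of i j] unfolding gg .
      have Q: "(\<Sum>a\<in>UNIV. \<Sum>d\<in>UNIV. k a * k d * ((transpose P ** M ** P) $ a $ d / z\<^sup>2)) = V \<bullet> (M *v V) / z\<^sup>2" for M
        unfolding V_def frame_quadratic[symmetric] sum_divide_distrib by simp
      have "V \<bullet> (C ?x *v V) * W ?x powr (b - 1) / z\<^sup>2 \<le> (w * l p * w powr (b - 1) * (V \<bullet> (G ?x *v V))) / z\<^sup>2"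
        unfolding w_def W_def C_def G_def by (intro divide_right_mono max[OF elim]) simp
      then show ?case
        unfolding CC' k_def[symmetric] Q b_def by simp
    qed
  qed
qed


section \<open>The global curvature estimate\<close>

lemma cmat_form: "V \<bullet> (cmat z q r *v V) = V \<bullet> V + (q \<bullet> V)\<^sup>2 + z * (V \<bullet> (r *v V))"
  by (simp add: cmat_def matrix_vector_mult_add_rdistrib inner_add_right rank1_form power2_eq_square
      scaleR_matrix_vector_assoc[symmetric])

lemma gram_form: "V \<bullet> (rank1 1 q *v V) = V \<bullet> V + (q \<bullet> V)\<^sup>2"
  by (simp add: rank1_form power2_eq_square)

text \<open>Both forms are diagonal in the frame, so the Rayleigh quotient is a weighted mean of the \<open>w * l a\<close>.\<close>

lemma frame_rayleigh:
  fixes P :: "real^'n^'n::finite" and l :: "'n \<Rightarrow> real"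
  assumes z: "z > 0" and F1: "transpose P ** rank1 1 q ** P = z\<^sup>2 *\<^sub>R mat 1"
    and F2: "transpose P ** M ** P = (w * z\<^sup>2) *\<^sub>R diag l"
    and F3: "P ** transpose P = z\<^sup>2 *\<^sub>R rank1 (- 1 / (slope_w q)\<^sup>2) q"
    and top: "\<And>a. l a \<le> l p" and w: "w \<ge> 0"
  shows "V \<bullet> (M *v V) \<le> w * l p * (V \<bullet> (rank1 1 q *v V))"
    and "\<exists>E. E \<bullet> (M *v E) = w * l p * z\<^sup>2 \<and> E \<bullet> (rank1 1 q *v E) = z\<^sup>2"
proof -
  define c where "c = (1 / z\<^sup>2) *\<^sub>R ((transpose P ** rank1 1 q) *v V)"
  have "rank1 (- 1 / (slope_w q)\<^sup>2) q ** rank1 1 q = mat 1"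
    unfolding gamma_gamma[symmetric] by (rule gamma_gamma_metric)
  then have "P ** (transpose P ** rank1 1 q) = z\<^sup>2 *\<^sub>R mat 1"
    by (simp add: matrix_mul_assoc F3 matrix_scaleR_left)
  then have "P *v ((transpose P ** rank1 1 q) *v V) = z\<^sup>2 *\<^sub>R V"
    by (simp add: matrix_vector_mul_assoc scaleR_matrix_vector_assoc[symmetric])
  then have V: "P *v c = V" using z by (simp add: c_def matrix_vector_mult_scaleR)
  have c: "c = (\<chi> a. c $ a)" by (simp add: vec_eq_iff)
  have Q: "(P *v e) \<bullet> (M' *v (P *v e)) = (\<Sum>a\<in>UNIV. \<Sum>d\<in>UNIV. e $ a * e $ d * (transpose P ** M' ** P) $ a $ d)" for e M'
    using frame_quadratic[of "\<lambda>a. e $ a" P M'] by simp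
  have GQ: "(P *v e) \<bullet> (rank1 1 q *v (P *v e)) = z\<^sup>2 * (\<Sum>a\<in>UNIV. (e $ a)\<^sup>2)" for e
    unfolding Q F1 by (simp add: mat_def if_distrib sum_distrib_left power2_eq_square mult_ac cong: if_cong)
  have MQ: "(P *v e) \<bullet> (M *v (P *v e)) = w * z\<^sup>2 * (\<Sum>a\<in>UNIV. l a * (e $ a)\<^sup>2)" for e
    unfolding Q F2 by (simp add: diag_def if_distrib sum_distrib_left power2_eq_square mult_ac cong: if_cong)
  have "(\<Sum>a\<in>UNIV. l a * (c $ a)\<^sup>2) \<le> (\<Sum>a\<in>UNIV. l p * (c $ a)\<^sup>2)"
    by (intro sum_mono mult_right_mono top) simp
  then have "w * z\<^sup>2 * (\<Sum>a\<in>UNIV. l a * (c $ a)\<^sup>2) \<le> w * z\<^sup>2 * (l p * (\<Sum>a\<in>UNIV. (c $ a)\<^sup>2))"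
    unfolding sum_distrib_left[symmetric] using w by (intro mult_left_mono) auto
  then show "V \<bullet> (M *v V) \<le> w * l p * (V \<bullet> (rank1 1 q *v V))"
    using MQ[of c] GQ[of c] unfolding V by (simp add: mult_ac)
  have "(\<Sum>a\<in>UNIV. (axis p (1::real) $ a)\<^sup>2) = 1" "(\<Sum>a\<in>UNIV. l a * (axis p (1::real) $ a)\<^sup>2) = l p"
    by (simp_all add: axis_def if_distrib[of "\<lambda>z. z\<^sup>2"] if_distrib[of "\<lambda>z. _ * z"] cong: if_cong)
  then show "\<exists>E. E \<bullet> (M *v E) = w * l p * z\<^sup>2 \<and> E \<bullet> (rank1 1 q *v E) = z\<^sup>2"
    using MQ[of "axis p 1"] GQ[of "axis p 1"] by (intro exI[of _ "P *v axis p 1"]) simp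
qed

lemma ex_maximal_index: "\<exists>p. \<forall>a. l a \<le> (l p :: real)" for l :: "'n::finite \<Rightarrow> real"
proof -
  have "Max (range l) \<in> range l" by (rule Max_in) auto
  then obtain p where "l p = Max (range l)" by (metis imageE)
  then show ?thesis by (intro exI[of _ p]) (auto intro: Max_ge)
qed

text \<open>By \<open>sum_squares_es\<close> the squared norm is at most the square of the sum when \<open>es 2\<close> is positive.\<close>

lemma norm_le_sigma1_in_cone:
  fixes x :: "'n::finite \<Rightarrow> real"
  assumes "garding 2 UNIV x" "\<And>a. x a \<le> K"
  shows "sqrt (\<Sum>i\<in>UNIV. (x i)\<^sup>2) \<le> real CARD('n) * K"
proof -
  have p: "es 1 UNIV x > 0" "es 2 UNIV x > 0" using assms(1) by (auto simp: garding_def)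
  have "(\<Sum>i\<in>UNIV. (x i)\<^sup>2) \<le> (es 1 UNIV x)\<^sup>2" using p sum_squares_es[of x] by simp
  then have "sqrt (\<Sum>i\<in>UNIV. (x i)\<^sup>2) \<le> es 1 UNIV x" using p by (simp add: real_le_lsqrt)
  also have "es 1 UNIV x = (\<Sum>i\<in>UNIV. x i)" using es_euler[of UNIV x 0] by simp
  also have "\<dots> \<le> real CARD('n) * K" using sum_bounded_above[of UNIV x K] assms(2) by simp
  finally show ?thesis .
qed

theorem theorem1p2:
  fixes k :: nat and \<sigma> :: real
  assumes "CARD('n::finite) \<ge> 3"
    and "2 \<le> k" and "k \<le> CARD('n) - 1"
    and "0 < \<sigma>" and "\<sigma> < 1"
  shows "\<exists>C>0. \<forall>(\<Omega> :: (real^'n) set) (\<epsilon> :: real) (u :: real^'n \<Rightarrow> real).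
    bounded_smooth_domain \<Omega> \<longrightarrow> 0 < \<epsilon> \<longrightarrow>
    Ck 4 \<Omega> u \<longrightarrow> C2_closure \<Omega> u \<longrightarrow> (\<forall>x\<in>closure \<Omega>. 0 < u x) \<longrightarrow>
    admissible k \<Omega> u \<longrightarrow>
    (\<forall>x\<in>\<Omega>. Hk k (kappa \<Omega> u x) = \<sigma>) \<longrightarrow>
    (\<forall>x\<in>frontier \<Omega>. u x = \<epsilon>) \<longrightarrow>
    (\<forall>x\<in>\<Omega>. 1 / sqrt (1 + (norm (grad_cl \<Omega> u x))\<^sup>2) \<ge> \<sigma>) \<longrightarrow>
    (\<exists>M m. is_max_on (\<lambda>p. norm (kappa \<Omega> u (fst p))) (vgraph u (closure \<Omega>)) M \<and>
           is_max_on (\<lambda>p. norm (kappa \<Omega> u (fst p))) (vgraph u (frontier \<Omega>)) m \<and>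
           M \<le> C * (1 + m))"
proof -
  define j where "j = k - 2"
  have k: "k = Suc (Suc j)" using \<open>2 \<le> k\<close> by (simp add: j_def)
  have n: "Suc (Suc (Suc j)) \<le> CARD('n)" using \<open>k \<le> CARD('n) - 1\<close> k by simp
  define N where "N = real (CARD('n)) - real (Suc j)"
  define b where "b = 1 + 1 / N"
  define K0 where "K0 = max (2 * (2 * N + 1) * (N + 1)) (4 / \<sigma>)"
  define B where "B = (1 / \<sigma>) powr b"
  define C where "C = real CARD('n) * B * K0"
  have N: "N \<ge> 2" using n by (simp add: N_def)
  have b: "b > 1" using N by (simp add: b_def)
  have "1 * 1 \<le> (2 * (2 * N + 1)) * (N + 1)" using N by (intro mult_mono) auto
  then have K0: "K0 \<ge> 1" unfolding K0_def by simp
  have B: "B \<ge> 1" unfolding B_def using \<open>0 < \<sigma>\<close> \<open>\<sigma> < 1\<close> b by (intro ge_one_powr_ge_zero) auto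
  have "real CARD('n) * B \<ge> 1 * 1" using n B by (intro mult_mono) auto
  then have nB: "real CARD('n) * B \<ge> 1" by simp
  have C0: "C > 0" unfolding C_def using nB K0 B by (intro mult_pos_pos) auto
  show ?thesis
  proof (rule exI[of _ C], rule conjI[OF C0], intro allI impI)
    fix S :: "(real^'n) set" and \<epsilon> :: real and u :: "real^'n \<Rightarrow> real"
    assume dom: "bounded_smooth_domain S" and C4: "Ck 4 S u" and C2: "C2_closure S u" and pos: "\<forall>x\<in>closure S. 0 < u x"
      and adm: "admissible k S u" and eq: "\<forall>x\<in>S. Hk k (kappa S u x) = \<sigma>"
      and slope: "\<forall>x\<in>S. 1 / sqrt (1 + (norm (grad_cl S u x))\<^sup>2) \<ge> \<sigma>"
    have S: "open S" "S \<noteq> {}" "bounded S" using dom by (auto simp: bounded_smooth_domain_def)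
    have cl: "S \<subseteq> closure S" by (rule closure_subset)
    have C2S: "Ck 2 S u" using C2 by (simp add: C2_closure_def)
    define q where "q = grad_cl S u"
    define r where "r = hess_cl S u"
    define W where "W x = slope_w (q x)" for x
    define A where "A x = curv_mat (u x) (q x) (r x)" for x
    have qS: "q x = grad u x" and rS: "r x = hess u x" if "x \<in> S" for x
      using that by (simp_all add: q_def r_def grad_cl_def hess_cl_def grad_def hess_def ext_cl_def)
    have cu: "continuous_on (closure S) u" and cq: "continuous_on (closure S) q" and cr: "continuous_on (closure S) (\<lambda>x. r x $ i $ i')" for i i'
      using C2 by (auto simp: C2_closure_def q_def r_def grad_cl_def[abs_def] hess_cl_def intro!: continuous_on_vec_lambda)
    have cW: "continuous_on (closure S) W" unfolding W_def slope_w_def by (intro continuous_intros cq)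
    have W1: "W x \<ge> 1" for x unfolding W_def by (rule slope_w_ge_1)
    have W\<sigma>: "W x \<le> 1 / \<sigma>" if "x \<in> closure S" for x
    proof (rule continuous_le_on_closure[OF cW that])
      fix x assume "x \<in> S"
      then have "\<sigma> \<le> 1 / W x" using slope by (simp add: W_def slope_w_def q_def)
      then show "W x \<le> 1 / \<sigma>" using W1[of x] \<open>0 < \<sigma>\<close> by (simp add: field_simps)
    qed
    have symr: "transpose (r x) = r x" if "x \<in> closure S" for x
    proof -
      have "r x $ i $ i' = r x $ i' $ i" for i i'
      proof -
        have "r x $ i $ i' - r x $ i' $ i = 0"
        proof (rule continuous_constant_on_closure[OF continuous_on_diff[OF cr cr] _ that])
          fix y assume y: "y \<in> S"
          show "r y $ i $ i' - r y $ i' $ i = 0"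
            using hess_symmetric[OF C2S S(1) y] rS[OF y] by (simp add: transpose_def vec_eq_iff)
        qed
        then show ?thesis by simp
      qed
      then show ?thesis by (simp add: transpose_def vec_eq_iff)
    qed
    have kap: "kappa S u x = eigvals (A x)" if "x \<in> closure S" for x
      using kappa_eq_curv_mat[of u x S] pos that by (simp add: A_def q_def r_def)
    \<comment> \<open>The squared norm of the curvatures is the squared Frobenius norm of \<open>curv_mat\<close>, hence continuous up to the
      frontier, whereas the choice of \<open>eigvals\<close> need not be.\<close>
    have ck: "continuous_on (closure S) (\<lambda>x. norm (kappa S u x))"
    proof -
      have "continuous_on (closure S) (\<lambda>x. sqrt (\<Sum>i\<in>UNIV. \<Sum>i'\<in>UNIV. (A x $ i $ i')\<^sup>2))"
      proof -
        have w0: "slope_w (q x) \<noteq> 0" "slope_w (q x) * (1 + slope_w (q x)) \<noteq> 0" for x using W1[of x] by (auto simp: W_def)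
        have cA: "continuous_on (closure S) (\<lambda>x. A x $ i $ i')" for i i'
          unfolding A_def curv_mat_def gamma_mat_def vec_lambda_beta
          by (intro continuous_intros cu cr cq cW[unfolded W_def] continuous_on_component) (use w0 in auto)
        show ?thesis by (intro continuous_on_real_sqrt continuous_on_sum continuous_on_power cA)
      qed
      moreover have "norm (kappa S u x) = sqrt (\<Sum>i\<in>UNIV. \<Sum>i'\<in>UNIV. (A x $ i $ i')\<^sup>2)" if "x \<in> closure S" for x
      proof -
        have "u x > 0" using pos that by blast
        from norm_kappa[OF symr[OF that] this, of "q x"] show ?thesis
          unfolding kap[OF that] A_def[symmetric] by (intro real_sqrt_unique[symmetric]) auto
      qed
      ultimately show ?thesis by (simp cong: continuous_on_cong)
    qed
    have cpt: "compact (closure S)" using S(3) by simp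
    have fne: "frontier S \<noteq> {}" using S(2,3) frontier_eq_empty[of S] not_bounded_UNIV by auto
    have fsub: "frontier S \<subseteq> closure S" by (simp add: frontier_def)
    have cne: "closure S \<noteq> {}" using S(2) by simp
    obtain xM where xM: "xM \<in> closure S" "\<And>x. x \<in> closure S \<Longrightarrow> norm (kappa S u x) \<le> norm (kappa S u xM)"
      using continuous_attains_sup[OF cpt cne ck] by blast
    have cptf: "compact (frontier S)" using S(3) by (simp add: compact_frontier_bounded)
    obtain xm where xm: "xm \<in> frontier S" "\<And>x. x \<in> frontier S \<Longrightarrow> norm (kappa S u x) \<le> norm (kappa S u xm)"
      using continuous_attains_sup[OF cptf fne continuous_on_subset[OF ck fsub]] by blast
    define m where "m = norm (kappa S u xm)"
    have m0: "m \<ge> 0" by (simp add: m_def)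
    \<comment> \<open>Restricting the direction to the unit sphere makes the domain compact; the quotient is homogeneous of degree zero.\<close>
    define GV where "GV x V = V \<bullet> (rank1 1 (q x) *v V)" for x V
    define CV where "CV x V = V \<bullet> (cmat (u x) (q x) (r x) *v V)" for x V
    have GVpos: "GV x V > 0" if "V \<noteq> 0" for x V
      using that unfolding GV_def gram_form by (simp add: add_pos_nonneg)
    define \<Psi> where "\<Psi> y = CV (fst y) (snd y) * W (fst y) powr (b - 1) / GV (fst y) (snd y)" for y
    have c\<Psi>: "continuous_on (closure S \<times> sphere 0 1) \<Psi>"
    proof -
      have f: "continuous_on (closure S \<times> sphere 0 1) (\<lambda>y. h (fst y))" if "continuous_on (closure S) h" for h :: "real^'n \<Rightarrow> real"
        by (rule continuous_on_compose2[OF that]) (auto intro: continuous_intros)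
      have s: "continuous_on (closure S \<times> sphere 0 1) (\<lambda>y::(real^'n) \<times> (real^'n). snd y $ i)" for i
        by (intro continuous_intros)
      have cq': "continuous_on (closure S) (\<lambda>x. q x $ i)" for i by (intro continuous_intros cq)
      note parts = f[OF cu] f[OF cW] f[OF cq'] f[OF cr] s
      have "GV (fst y) (snd y) \<noteq> 0" if "y \<in> closure S \<times> sphere 0 1" for y
        using GVpos[of "snd y" "fst y"] that by (cases "snd y = 0") (auto simp: sphere_def)
      moreover have "W x \<noteq> 0" "0 < W x" for x using W1[of x] by auto
      ultimately show ?thesis
        unfolding \<Psi>_def CV_def GV_def cmat_form gram_form unfolding inner_vec_def matrix_vector_mult_def inner_real_def vec_lambda_beta
        by (intro continuous_on_divide continuous_on_mult continuous_on_add continuous_on_sum continuous_on_power continuous_on_powr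
            continuous_on_const parts) auto
    qed
    have "closure S \<times> sphere 0 (1::real) \<noteq> ({} :: ((real^'n) \<times> (real^'n)) set)" using cne by (simp add: sphere_eq_empty)
    from continuous_attains_sup[OF compact_Times[OF cpt compact_sphere] this c\<Psi>]
    obtain y0 where y0: "y0 \<in> closure S \<times> sphere 0 1" "\<And>y. y \<in> closure S \<times> sphere 0 1 \<Longrightarrow> \<Psi> y \<le> \<Psi> y0"
      by blast
    define x0 where "x0 = fst y0"
    define V0 where "V0 = snd y0"
    define R where "R = \<Psi> y0"
    have x0: "x0 \<in> closure S" and V0: "V0 \<noteq> 0" using y0(1) by (auto simp: x0_def V0_def)
    have maxR: "CV x V * W x powr (b - 1) \<le> R * GV x V" if x: "x \<in> closure S" for x V
    proof (cases "V = 0")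
      case False
      \<comment> \<open>homogeneity extends the inequality from unit vectors to all directions\<close>
    define V' where "V' = V /\<^sub>R norm V"
      have "\<Psi> (x, V') \<le> R" unfolding R_def using x False by (intro y0(2)) (simp add: V'_def)
      moreover have "CV x V' = CV x V / (norm V)\<^sup>2" "GV x V' = GV x V / (norm V)\<^sup>2"
        by (simp_all add: V'_def CV_def GV_def matrix_vector_mult_scaleR power2_eq_square divide_inverse)
      ultimately have "CV x V * W x powr (b - 1) / GV x V \<le> R" using False by (simp add: \<Psi>_def)
      then show ?thesis using GVpos[OF False, of x] by (simp add: pos_divide_le_eq)
    qed (simp add: CV_def GV_def)
    have frame: "\<exists>(P :: real^'n^'n) (l :: 'n \<Rightarrow> real) p. transpose P ** rank1 1 (q x) ** P = (u x)\<^sup>2 *\<^sub>R mat 1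
      \<and> transpose P ** cmat (u x) (q x) (r x) ** P = (W x * (u x)\<^sup>2) *\<^sub>R diag l
      \<and> P ** transpose P = (u x)\<^sup>2 *\<^sub>R rank1 (- 1 / (W x)\<^sup>2) (q x)
      \<and> (\<forall>i. es i UNIV l = esym i (kappa S u x))
      \<and> norm (kappa S u x) = sqrt (\<Sum>i\<in>UNIV. (l i)\<^sup>2)
      \<and> (\<forall>a. l a \<le> l p)
      \<and> (\<forall>V. CV x V \<le> W x * l p * GV x V) \<and> W x powr b * l p \<le> R" if x: "x \<in> closure S" for x
    proof -
      have ux: "u x > 0" using pos x by blast
      obtain P :: "real^'n^'n" and l :: "'n \<Rightarrow> real" where F: "transpose P ** rank1 1 (q x) ** P = (u x)\<^sup>2 *\<^sub>R mat 1"
        "transpose P ** cmat (u x) (q x) (r x) ** P = (W x * (u x)\<^sup>2) *\<^sub>R diag l"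
        "P ** transpose P = (u x)\<^sup>2 *\<^sub>R rank1 (- 1 / (W x)\<^sup>2) (q x)"
        "\<forall>i. es i UNIV l = esym i (eigvals (A x))"
        "(\<Sum>i\<in>UNIV. (l i)\<^sup>2) = (\<Sum>i\<in>UNIV. \<Sum>j\<in>UNIV. (A x $ i $ j)\<^sup>2)"
        using eigenframe[OF symr[OF x] ux, of "q x"] unfolding W_def A_def by blast
      obtain p where p: "\<forall>a. l a \<le> l p" using ex_maximal_index by blast
      have W0: "W x \<ge> 0" using W1[of x] by simp
      have top: "l a \<le> l p" for a using p by blast
      note ray = frame_rayleigh[OF ux F(1,2) F(3)[unfolded W_def] top W0]
      obtain E where E: "CV x E = W x * l p * (u x)\<^sup>2" "GV x E = (u x)\<^sup>2"
        using ray(2) unfolding CV_def GV_def by blast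
      have "W x * l p * (u x)\<^sup>2 * W x powr (b - 1) \<le> R * (u x)\<^sup>2" using maxR[OF x, of E] unfolding E .
      then have "(W x * W x powr (b - 1) * l p) * (u x)\<^sup>2 \<le> R * (u x)\<^sup>2" by (simp only: mult_ac)
      then have "W x * W x powr (b - 1) * l p \<le> R" using ux by simp
      moreover have "W x * W x powr (b - 1) = W x powr b" using W1[of x] by (simp add: powr_mult_base)
      moreover have "norm (kappa S u x) = sqrt (\<Sum>i\<in>UNIV. (l i)\<^sup>2)"
        using norm_kappa[OF symr[OF x] ux, of "q x"] unfolding kap[OF x] F(5) A_def[symmetric]
        by (intro real_sqrt_unique[symmetric]) auto
      ultimately show ?thesis using F(1-4) p ray(1) kap[OF x] by (intro exI[of _ P] exI[of _ l] exI[of _ p]) (auto simp: CV_def GV_def)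
    qed
    have cone: "garding k UNIV l" if "x \<in> S" "\<forall>i. es i UNIV l = esym i (kappa S u x)" for x and l :: "'n \<Rightarrow> real"
    proof -
      have "kappa S u x \<in> Garding_cone k" using adm that(1) by (simp add: admissible_def)
      then have "es i UNIV l > 0" if "i \<le> k" for i
        using that \<open>\<forall>i. es i UNIV l = esym i (kappa S u x)\<close> by (cases "i = 0") (auto simp: Garding_cone_def esym_eq_es)
      then show ?thesis by (simp add: garding_def)
    qed
    \<comment> \<open>A maximum over \<open>S\<close> is bounded by the interior estimate and one over the frontier by \<open>m\<close>.\<close>
    have Rbound: "R \<le> B * K0 * (1 + m)"
    proof -
      obtain P :: "real^'n^'n" and l :: "'n \<Rightarrow> real" and p where F: "transpose P ** rank1 1 (q x0) ** P = (u x0)\<^sup>2 *\<^sub>R mat 1"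
        "transpose P ** cmat (u x0) (q x0) (r x0) ** P = (W x0 * (u x0)\<^sup>2) *\<^sub>R diag l"
        "P ** transpose P = (u x0)\<^sup>2 *\<^sub>R rank1 (- 1 / (W x0)\<^sup>2) (q x0)"
        "\<forall>i. es i UNIV l = esym i (kappa S u x0)" "norm (kappa S u x0) = sqrt (\<Sum>i\<in>UNIV. (l i)\<^sup>2)"
        "\<forall>a. l a \<le> l p" "\<forall>V. CV x0 V \<le> W x0 * l p * GV x0 V"
        using frame[OF x0] by blast
      have "R = CV x0 V0 * W x0 powr (b - 1) / GV x0 V0" by (simp add: R_def \<Psi>_def x0_def V0_def)
      also have "\<dots> \<le> (W x0 * l p * GV x0 V0) * W x0 powr (b - 1) / GV x0 V0"
        using F(7) GVpos[OF V0, of x0] by (intro divide_right_mono mult_right_mono) (auto simp: less_imp_le)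
      also have "\<dots> = W x0 * l p * W x0 powr (b - 1)" using GVpos[OF V0, of x0] by simp
      finally have R1: "R \<le> W x0 * l p * W x0 powr (b - 1)" .
      have WB: "W x0 powr b \<le> B" unfolding B_def using W1[of x0] W\<sigma>[OF x0] b by (intro powr_mono2) auto
      have R2: "R \<le> W x0 powr b * l p" 
      proof -
        have "W x0 powr b = W x0 * W x0 powr (b - 1)" using W1[of x0] by (simp add: powr_mult_base)
        then show ?thesis using R1 by (simp only: mult_ac)
      qed
      have lpK: "l p \<le> K0 * (1 + m)"
      proof (cases "x0 \<in> S")
        case True
        have g: "garding (Suc (Suc j)) UNIV l" using cone[OF True F(4)] unfolding k .
        have "l p \<le> max (2 * (2 * (real (CARD('n)) - real (Suc j)) + 1) * ((real (CARD('n)) - real (Suc j)) + 1)) (4 / \<sigma>)"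
        proof (rule interior_maximum_bound[OF n S(1) True C4 _ _ _ _ g])
          show "0 < u x" if "x \<in> S" for x using pos that cl by blast
          show "transpose P ** rank1 1 (grad u x0) ** P = (u x0)\<^sup>2 *\<^sub>R mat 1" using F(1) qS[OF True] by simp
          show "transpose P ** cmat (u x0) (grad u x0) (hess u x0) ** P = (slope_w (grad u x0) * (u x0)\<^sup>2) *\<^sub>R diag l"
            using F(2) qS[OF True] rS[OF True] by (simp add: W_def)
          show "P ** transpose P = (u x0)\<^sup>2 *\<^sub>R rank1 (- 1 / (slope_w (grad u x0))\<^sup>2) (grad u x0)"
            using F(3) qS[OF True] by (simp add: W_def)
          show "l a \<le> l p" for a using F(6) by blast
          show "esym (Suc (Suc j)) (eigvals (curv_mat (u x) (grad u x) (hess u x))) = es (Suc (Suc j)) UNIV l" if x: "x \<in> S" for x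
          proof -
            have ch: "real (CARD('n) choose k) \<noteq> 0" using n k by simp
            have h: "esym k (kappa S u y) = \<sigma> * real (CARD('n) choose k)" if "y \<in> S" for y
              using eq that ch by (simp add: Hk_def field_simps)
            have "eigvals (curv_mat (u x) (grad u x) (hess u x)) = kappa S u x"
              using kap[of x] x cl qS[OF x] rS[OF x] by (auto simp: A_def)
            then show ?thesis using h[OF x] h[OF True] F(4) unfolding k[symmetric] by simp
          qed
          show "0 < \<sigma>" by fact
          show "\<sigma> \<le> 1 / slope_w (grad u x0)" unfolding qS[OF True, symmetric] slope_w_def q_def using slope True by blast
          show "V \<bullet> (cmat (u x) (grad u x) (hess u x) *v V) * slope_w (grad u x) powr (1 + 1 / (real CARD('n) - real (Suc j)) - 1)
            \<le> slope_w (grad u x0) * l p * slope_w (grad u x0) powr (1 + 1 / (real CARD('n) - real (Suc j)) - 1) * (V \<bullet> (rank1 1 (grad u x) *v V))"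
            if x: "x \<in> S" for x V
          proof -
            have "CV x V * W x powr (b - 1) \<le> R * GV x V" using maxR x cl by blast
            also have "\<dots> \<le> (W x0 * l p * W x0 powr (b - 1)) * GV x V"
              using R1 GVpos[of V x] by (intro mult_right_mono) (cases "V = 0"; auto simp: GV_def less_imp_le)+
            finally show ?thesis unfolding CV_def GV_def W_def qS[OF x] rS[OF x] qS[OF True] b_def N_def .
          qed
        qed
        then have "l p \<le> K0" by (simp add: K0_def N_def)
        also have "\<dots> \<le> K0 * (1 + m)" using K0 m0 by simp
        finally show ?thesis .
      next
        case False
        then have fr: "x0 \<in> frontier S" using x0 S(1) by (simp add: frontier_def interior_open)
        have "l p \<le> \<bar>l p\<bar>" by simp
        also have "\<bar>l p\<bar> = sqrt ((l p)\<^sup>2)" by simp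
        also have "\<dots> \<le> sqrt (\<Sum>i\<in>UNIV. (l i)\<^sup>2)" by (intro real_sqrt_le_mono member_le_sum) auto
        also have "\<dots> \<le> m" using F(5) xm(2)[OF fr] by (simp add: m_def)
        also have "m \<le> 1 * (1 + m)" by simp
        also have "\<dots> \<le> K0 * (1 + m)" using K0 m0 by (intro mult_right_mono) auto
        finally show ?thesis .
      qed
      have K0m: "K0 * (1 + m) \<ge> 0" using K0 m0 by (intro mult_nonneg_nonneg) auto
      have "W x0 powr b * l p \<le> W x0 powr b * (K0 * (1 + m))" using lpK by (intro mult_left_mono) auto
      also have "\<dots> \<le> B * (K0 * (1 + m))" using WB K0m by (intro mult_right_mono)
      finally show ?thesis using R2 by (simp add: mult.assoc)
    qed
    \<comment> \<open>In \<open>S\<close> the largest curvature is at most \<open>W powr b\<close> times itself, hence at most \<open>R\<close>.\<close>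
    have "norm (kappa S u xM) \<le> C * (1 + m)"
    proof (cases "xM \<in> S")
      case True
      obtain l :: "'n \<Rightarrow> real" and p where F: "\<forall>i. es i UNIV l = esym i (kappa S u xM)" "norm (kappa S u xM) = sqrt (\<Sum>i\<in>UNIV. (l i)\<^sup>2)"
        "\<forall>a. l a \<le> l p" "W xM powr b * l p \<le> R"
        using frame[OF xM(1)] by blast
      have g: "garding k UNIV l" by (rule cone[OF True F(1)])
      have lp: "l p > 0" using garding_top_positive[of UNIV "Suc j" l "l p"] g F(3) by (simp add: k)
      have "1 * l p \<le> W xM powr b * l p" using lp W1[of xM] b by (intro mult_right_mono ge_one_powr_ge_zero) auto
      then have lR: "l p \<le> R" using F(4) by simp
      have "garding 2 UNIV l" using g by (auto simp: garding_def k)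
      then have "norm (kappa S u xM) \<le> real CARD('n) * l p"
        unfolding F(2) using F(3) by (intro norm_le_sigma1_in_cone) auto
      also have "\<dots> \<le> real CARD('n) * (B * K0 * (1 + m))" using lR Rbound by (intro mult_left_mono) auto
      finally show ?thesis by (simp add: C_def mult_ac)
    next
      case False
      then have "xM \<in> frontier S" using xM(1) S(1) by (simp add: frontier_def interior_open)
      then have "norm (kappa S u xM) \<le> m" using xm(2) by (simp add: m_def)
      also have "m \<le> 1 * (1 + m)" by simp
      also have "\<dots> \<le> C * (1 + m)"
      proof (rule mult_right_mono)
        show "1 \<le> C" using mult_mono[OF nB K0] nB unfolding C_def by simp
      qed (use m0 in simp)
      finally show ?thesis .
    qed
    then show "\<exists>M m. is_max_on (\<lambda>p. norm (kappa S u (fst p))) (vgraph u (closure S)) M \<and>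
           is_max_on (\<lambda>p. norm (kappa S u (fst p))) (vgraph u (frontier S)) m \<and> M \<le> C * (1 + m)"
      using xM xm by (intro exI[of _ "norm (kappa S u xM)"] exI[of _ m]) (auto simp: is_max_on_def vgraph_def m_def)
  qed
qed

end
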